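(* Consider the problem $$J[y(\cdot),u(\cdot)]=\int_a^b L(t,y(t),u(t))\,\Delta t\longrightarrow\min,\qquad y^\Delta(t)=\varphi(t,y(t),u(t)),\qquad (y(a)=y_a),\ (y(b)=y_b),\tag{P}$$ where $y(\cdot)\in C^1_{rd}[\mathbb{T}]$, $u(\cdot)\in C_{rd}[\mathbb{T}]$, $y(t)\in\mathbb{R}^n$ and $u(t)\in\mathbb{R}^m$ for all $t\in\mathbb{T}$, $m\le n$, and each of the endpoint conditions in parentheses may or may not be present. Assume that $L:\mathbb{T}\times\mathbb{R}^n\times\mathbb{R}^m\to\mathbb{R}$ and $\varphi:\mathbb{T}\times\mathbb{R}^n\times\mathbb{R}^m\to\mathbb{R}^n$ are $C^1$-functions of $(y,u)$ for each $t$, and that for each control $u(\cdot)\in C_{rd}[\mathbb{T};\mathbb{R}^m]$ there exists a corresponding $y(\cdot)\in C^1_{rd}[\mathbb{T};\mathbb{R}^n]$ solving $y^\Delta(t)=\varphi(t,y(t),u(t))$. If $(y_\ast(\cdot),u_\ast(\cdot))$ is a weak local minimizer of (P), then there exists a collection of multipliers $(\psi_{0_\ast},\psi_\ast(\cdot))$, with $\psi_{0_\ast}$ a nonnegative constant and $\psi_\ast(\cdot):\mathbb{T}\to\mathbb{R}^n$ a function delta differentiable on $\mathbb{T}^k$, not all vanishing, such that $(y_\ast(\cdot),u_\ast(\cdot),\psi_{0_\ast},\psi_\ast(\cdot))$ satisfies the Euler-Lagrange equations of the augmented functional $$J^\ast[y(\cdot),u(\cdot),\psi(\cdot)]=\int_a^b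 L^\ast\left(t,y(t),u(t),\psi^\sigma(t),y^\Delta(t)\right)\Delta t=\int_a^b\left[\psi_0L(t,y(t),u(t))+\psi^\sigma(t)\cdot\left(\varphi(t,y(t),u(t))-y^\Delta(t)\right)\right]\Delta t ,$$ that is, the equations $$\left(L^\ast_{y^\Delta}-\mu(t)L^\ast_y\right)^\Delta=L^\ast_y,\qquad \left(-\mu(t)L^\ast_u\right)^\Delta=L^\ast_u,\qquad L^\ast_{\psi^\sigma}=0,$$ where the partial derivatives of $L^\ast$ (with $\psi_0=\psi_{0_\ast}$) are evaluated at $(t,y_\ast(t),u_\ast(t),\psi_\ast^\sigma(t),y_\ast^\Delta(t))$ and $t\in\mathbb{T}^{k^2}$.
   Context: A time scale is a nonempty closed subset of $\mathbb{R}$. Throughout $\mathbb{T}=[a,b]\cap\mathbb{T}_0$ with $a<b$ and $\mathbb{T}_0$ a time scale, where $a=\min\mathbb{T}$ and $b=\max\mathbb{T}$. The forward jump operator is $\sigma(t)=\inf\{s\in\mathbb{T}:s>t\}$ (with $\sigma(b)=b$), the backward jump operator is $\rho(t)=\sup\{s\in\mathbb{T}:s<t\}$ (with $\rho(a)=a$), the graininess is $\mu(t)=\sigma(t)-t$. A point $t$ is right-dense if $\sigma(t)=t$, left-dense if $\rho(t)=t$. $\mathbb{T}^k=\mathbb{T}\setminus(\rho(b),b]$ and $\mathbb{T}^{k^2}=(\mathbb{T}^k)^k$. We write $f^\sigma=f\circ\sigma$. A function $f$ on $\mathbb{T}$ is delta differentiable at $t\in\mathbb{T}^k$ with delta derivative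 $f^\Delta(t)$ if for all $\varepsilon>0$ there is a neighborhood $U=(t-\delta,t+\delta)\cap\mathbb{T}$ with $|f(\sigma(t))-f(s)-f^\Delta(t)(\sigma(t)-s)|\le\varepsilon|\sigma(t)-s|$ for all $s\in U$ (similarly for functions on $\mathbb{T}^k$ at points of $\mathbb{T}^{k^2}$). A function is rd-continuous if it is continuous at right-dense points and its left-sided limit exists at left-dense points; $C_{rd}[\mathbb{T}]=C_{rd}[\mathbb{T};\mathbb{R}^m]$ is the set of rd-continuous functions and $C^1_{rd}[\mathbb{T}]=C^1_{rd}[\mathbb{T};\mathbb{R}^n]$ the set of delta differentiable functions with rd-continuous delta derivative. The delta integral is $\int_c^d f(t)\Delta t=F(d)-F(c)$ where $F^\Delta=f$. A pair $(y,u)$ is admissible for (P) if $y\in C^1_{rd}[\mathbb{T};\mathbb{R}^n]$, $u\in C_{rd}[\mathbb{T};\mathbb{R}^m]$, $y^\Delta(t)=\varphi(t,y(t),u(t))$ for $t\in\mathbb{T}^k$, and the boundary conditions that are present hold. An admissible pair $(y_\ast,u_\ast)$ is a weak local minimizer of (P) if there exists $\delta>0$ such that $J[y_\ast,u_\ast]\le J[y,u]$ for all admissible pairs $(y,u)$ with $\|y-y_\ast\|_{1,\infty}+\|u-u_\ast\|_\infty<\delta$, where $\|f\|_\infty=\sup_{t\in\mathbb{T}^k}|f(t)|$ and $\|y\|_{1,\infty}=\|y\|_\infty+\|y^\Delta\|_\infty$. The Lagrangian of the augmented functional is $L^\ast(t,y,u,p,v)=\psi_0L(t,y,u)+p\cdot(\varphi(t,y,u)-v)$,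 and $L^\ast_y,L^\ast_u,L^\ast_{\psi^\sigma},L^\ast_{y^\Delta}$ denote its partial derivatives with respect to $y,u,p,v$, respectively. The Euler-Lagrange equation in delta differentiated form for a Lagrangian depending on $(t,z(t),z^\Delta(t))$ is $(L_{z^\Delta}-\mu L_z)^\Delta=L_z$, and for one depending on $(t,z^\sigma(t),z^\Delta(t))$ it is $(L_{z^\Delta})^\Delta=L_{z^\sigma}$, on $\mathbb{T}^{k^2}$; the first is used for the variables $y,u$, the second for $\psi$. $\psi$ is regarded as a row vector.
   Formalization: Beyond being C^1 in (y,u) for each t, L and φ and their derivatives in (y,u) are assumed rd-continuous in t along every continuous y and every rd-continuous u; with no condition in t the claim is false. *)

theory Defs
  imports "HOL-Analysis.Analysis"
begin

section \<open>Time scales\<close>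

definition time_scale :: "real set \<Rightarrow> bool" where
  "time_scale T \<longleftrightarrow> closed T \<and> T \<noteq> {}"

definition sigma :: "real set \<Rightarrow> real \<Rightarrow> real" where
  "sigma T t = (if \<exists>s\<in>T. t < s then Inf {s \<in> T. t < s} else t)"

definition rho :: "real set \<Rightarrow> real \<Rightarrow> real" where
  "rho T t = (if \<exists>s\<in>T. s < t then Sup {s \<in> T. s < t} else t)"

definition mu :: "real set \<Rightarrow> real \<Rightarrow> real" where
  "mu T t = sigma T t - t"

definition right_dense :: "real set \<Rightarrow> real \<Rightarrow> bool" where
  "right_dense T t \<longleftrightarrow> sigma T t = t"

definition left_dense :: "real set \<Rightarrow> real \<Rightarrow> bool" where
  "left_dense T t \<longleftrightarrow> rho T t = t"

text \<open>The time scales considered are compact, so \<^term>\<open>Sup T\<close> is the maximum.\<close>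

definition kappa :: "real set \<Rightarrow> real set" where
  "kappa T = T - {rho T (Sup T) <.. Sup T}"


section \<open>Delta derivative, rd-continuity, delta integral\<close>

definition has_delta_deriv ::
    "real set \<Rightarrow> (real \<Rightarrow> 'a::real_normed_vector) \<Rightarrow> 'a \<Rightarrow> real \<Rightarrow> bool" where
  "has_delta_deriv T f D t \<longleftrightarrow>
     (\<forall>\<epsilon>>0. \<exists>\<delta>>0. \<forall>s\<in>T. \<bar>s - t\<bar> < \<delta> \<longrightarrow>
        norm (f (sigma T t) - f s - (sigma T t - s) *\<^sub>R D) \<le> \<epsilon> * \<bar>sigma T t - s\<bar>)"

definition delta_differentiable ::
    "real set \<Rightarrow> (real \<Rightarrow> 'a::real_normed_vector) \<Rightarrow> real \<Rightarrow> bool" where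
  "delta_differentiable T f t \<longleftrightarrow> (\<exists>D. has_delta_deriv T f D t)"

definition delta_deriv ::
    "real set \<Rightarrow> (real \<Rightarrow> 'a::real_normed_vector) \<Rightarrow> real \<Rightarrow> 'a" where
  "delta_deriv T f t = (THE D. has_delta_deriv T f D t)"

text \<open>Rd-continuity of a function with domain \<open>S\<close>, where \<open>S\<close> is \<open>T\<close> or \<^term>\<open>kappa T\<close>;
  density of points always refers to \<open>T\<close>.  At the minimum of \<open>T\<close>, which is left-dense by
  convention, the filter is trivial and the left limit imposes no condition.\<close>

definition rd_continuous_on ::
    "real set \<Rightarrow> real set \<Rightarrow> (real \<Rightarrow> 'a::real_normed_vector) \<Rightarrow> bool" where
  "rd_continuous_on T S f \<longleftrightarrow>
     (\<forall>t\<in>S. (right_dense T t \<longrightarrow> continuous (at t within S) f) \<and>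
            (left_dense T t \<longrightarrow> (\<exists>l. (f \<longlongrightarrow> l) (at t within (S \<inter> {..<t})))))"

definition Crd :: "real set \<Rightarrow> (real \<Rightarrow> 'a::real_normed_vector) set" where
  "Crd T = {f. rd_continuous_on T T f}"

definition C1rd :: "real set \<Rightarrow> (real \<Rightarrow> 'a::real_normed_vector) set" where
  "C1rd T = {f. (\<forall>t\<in>kappa T. delta_differentiable T f t) \<and>
                rd_continuous_on T (kappa T) (delta_deriv T f)}"

definition delta_integral ::
    "real set \<Rightarrow> real \<Rightarrow> real \<Rightarrow> (real \<Rightarrow> 'a::real_normed_vector) \<Rightarrow> 'a" where
  "delta_integral T c d f =
     (THE I. \<exists>F. (\<forall>t\<in>kappa T. has_delta_deriv T F (f t) t) \<and> I = F d - F c)"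

definition sup_norm :: "real set \<Rightarrow> (real \<Rightarrow> 'a::real_normed_vector) \<Rightarrow> real" where
  "sup_norm T f = (SUP t\<in>kappa T. norm (f t))"

definition sup_norm1 :: "real set \<Rightarrow> (real \<Rightarrow> 'a::real_normed_vector) \<Rightarrow> real" where
  "sup_norm1 T f = sup_norm T f + sup_norm T (delta_deriv T f)"


section \<open>Smoothness of the data\<close>

definition C1_map :: "('a::real_normed_vector \<Rightarrow> 'b::real_normed_vector) \<Rightarrow> bool" where
  "C1_map f \<longleftrightarrow>
     (\<exists>f'. (\<forall>x. (f has_derivative blinfun_apply (f' x)) (at x)) \<and> continuous_on UNIV f')"

text \<open>Rd-continuity of a function of \<open>(t, y, u)\<close> in the usual sense of the theory of dynamic
  equations: rd-continuity along trajectories, here continuous in the state and rd-continuous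
  in the control.  The condition below demands it of \<open>F\<close> and of its derivative in \<open>(y, u)\<close>.\<close>

definition rd_along ::
    "real set \<Rightarrow> (real \<Rightarrow> 'a::real_normed_vector \<Rightarrow> 'b::real_normed_vector
       \<Rightarrow> 'c::real_normed_vector) \<Rightarrow> bool" where
  "rd_along T F \<longleftrightarrow>
     (\<forall>y u. continuous_on T y \<longrightarrow> u \<in> Crd T \<longrightarrow> (\<lambda>t. F t (y t) (u t)) \<in> Crd T)"

definition rd_regular ::
    "real set \<Rightarrow> (real \<Rightarrow> 'a::real_normed_vector \<Rightarrow> 'b::real_normed_vector
       \<Rightarrow> 'c::real_normed_vector) \<Rightarrow> bool" where
  "rd_regular T F \<longleftrightarrow>
     rd_along T F \<and>
     (\<forall>h. rd_along T (\<lambda>t y u. frechet_derivative (\<lambda>(y, u). F t y u) (at (y, u)) h))"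

text \<open>The vector of partial derivatives.\<close>

definition grad :: "(real ^ 'k \<Rightarrow> real) \<Rightarrow> real ^ 'k \<Rightarrow> real ^ 'k" where
  "grad f x = (\<chi> i. deriv (\<lambda>s. f (x + s *\<^sub>R axis i 1)) 0)"


section \<open>The optimal control problem\<close>

definition cost ::
    "real set \<Rightarrow> real \<Rightarrow> real \<Rightarrow> (real \<Rightarrow> real ^ 'n \<Rightarrow> real ^ 'm \<Rightarrow> real)
      \<Rightarrow> (real \<Rightarrow> real ^ 'n) \<Rightarrow> (real \<Rightarrow> real ^ 'm) \<Rightarrow> real" where
  "cost T a b L y u = delta_integral T a b (\<lambda>t. L t (y t) (u t))"

definition solves ::
    "real set \<Rightarrow> (real \<Rightarrow> real ^ 'n \<Rightarrow> real ^ 'm \<Rightarrow> real ^ 'n)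
      \<Rightarrow> (real \<Rightarrow> real ^ 'n) \<Rightarrow> (real \<Rightarrow> real ^ 'm) \<Rightarrow> bool" where
  "solves T \<phi> y u \<longleftrightarrow>
     y \<in> C1rd T \<and> (\<forall>t\<in>kappa T. delta_deriv T y t = \<phi> t (y t) (u t))"

text \<open>An endpoint condition is given as an option; \<^term>\<open>None\<close> means that it is absent.\<close>

definition admissible ::
    "real set \<Rightarrow> real \<Rightarrow> real \<Rightarrow> (real \<Rightarrow> real ^ 'n \<Rightarrow> real ^ 'm \<Rightarrow> real ^ 'n)
      \<Rightarrow> (real ^ 'n) option \<Rightarrow> (real ^ 'n) option
      \<Rightarrow> (real \<Rightarrow> real ^ 'n) \<Rightarrow> (real \<Rightarrow> real ^ 'm) \<Rightarrow> bool" where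
  "admissible T a b \<phi> ya yb y u \<longleftrightarrow>
     u \<in> Crd T \<and> solves T \<phi> y u \<and>
     (\<forall>c. ya = Some c \<longrightarrow> y a = c) \<and> (\<forall>c. yb = Some c \<longrightarrow> y b = c)"

definition weak_local_minimizer ::
    "real set \<Rightarrow> real \<Rightarrow> real \<Rightarrow> (real \<Rightarrow> real ^ 'n \<Rightarrow> real ^ 'm \<Rightarrow> real)
      \<Rightarrow> (real \<Rightarrow> real ^ 'n \<Rightarrow> real ^ 'm \<Rightarrow> real ^ 'n)
      \<Rightarrow> (real ^ 'n) option \<Rightarrow> (real ^ 'n) option
      \<Rightarrow> (real \<Rightarrow> real ^ 'n) \<Rightarrow> (real \<Rightarrow> real ^ 'm) \<Rightarrow> bool" where
  "weak_local_minimizer T a b L \<phi> ya yb y0 u0 \<longleftrightarrow>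
     admissible T a b \<phi> ya yb y0 u0 \<and>
     (\<exists>\<delta>>0. \<forall>y u. admissible T a b \<phi> ya yb y u \<longrightarrow>
        sup_norm1 T (\<lambda>t. y t - y0 t) + sup_norm T (\<lambda>t. u t - u0 t) < \<delta> \<longrightarrow>
        cost T a b L y0 u0 \<le> cost T a b L y u)"

definition Lstar ::
    "(real \<Rightarrow> real ^ 'n \<Rightarrow> real ^ 'm \<Rightarrow> real) \<Rightarrow> (real \<Rightarrow> real ^ 'n \<Rightarrow> real ^ 'm \<Rightarrow> real ^ 'n)
      \<Rightarrow> real \<Rightarrow> real \<Rightarrow> real ^ 'n \<Rightarrow> real ^ 'm \<Rightarrow> real ^ 'n \<Rightarrow> real ^ 'n \<Rightarrow> real" where
  "Lstar L \<phi> \<psi>0 t y u p v = \<psi>0 * L t y u + p \<bullet> (\<phi> t y u - v)"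

text \<open>The Euler-Lagrange equations on \<open>kappa (kappa T)\<close>, with jump operator and graininess of
  \<open>T\<close>.  If \<open>b = max T\<close> is left-scattered and its predecessor is left-dense, the jump at that
  predecessor leads to \<open>b\<close>, where \<^term>\<open>delta_deriv T y b\<close> carries no information; this is
  harmless because the partial derivatives of \<^const>\<open>Lstar\<close> in \<open>y\<close>, \<open>u\<close>, \<open>v\<close> do not depend
  on \<open>v\<close>.\<close>

definition euler_lagrange ::
    "real set \<Rightarrow> (real \<Rightarrow> real ^ 'n \<Rightarrow> real ^ 'm \<Rightarrow> real)
      \<Rightarrow> (real \<Rightarrow> real ^ 'n \<Rightarrow> real ^ 'm \<Rightarrow> real ^ 'n)
      \<Rightarrow> (real \<Rightarrow> real ^ 'n) \<Rightarrow> (real \<Rightarrow> real ^ 'm) \<Rightarrow> real \<Rightarrow> (real \<Rightarrow> real ^ 'n) \<Rightarrow> bool" where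
  "euler_lagrange T L \<phi> y u \<psi>0 \<psi> \<longleftrightarrow>
     (let p = (\<lambda>t. \<psi> (sigma T t));
          v = delta_deriv T y;
          Ly = (\<lambda>t. grad (\<lambda>x. Lstar L \<phi> \<psi>0 t x (u t) (p t) (v t)) (y t));
          Lu = (\<lambda>t. grad (\<lambda>x. Lstar L \<phi> \<psi>0 t (y t) x (p t) (v t)) (u t));
          Lp = (\<lambda>t. grad (\<lambda>x. Lstar L \<phi> \<psi>0 t (y t) (u t) x (v t)) (p t));
          Lv = (\<lambda>t. grad (\<lambda>x. Lstar L \<phi> \<psi>0 t (y t) (u t) (p t) x) (v t))
      in \<forall>t\<in>kappa (kappa T).
           has_delta_deriv T (\<lambda>s. Lv s - mu T s *\<^sub>R Ly s) (Ly t) t \<and>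
           has_delta_deriv T (\<lambda>s. - (mu T s *\<^sub>R Lu s)) (Lu t) t \<and>
           Lp t = 0)"

end

theory Submission
  imports Defs
begin

text \<open>The statement is a weak maximum principle, and its Euler-Lagrange form is a rewriting of it.
  Write \<open>H = \<psi>0 * L + \<psi>\<^sup>\<sigma> \<bullet> \<phi>\<close>.  If \<open>\<psi>\<close> solves the adjoint equation \<open>\<psi>\<^sup>\<Delta> = - H\<^sub>y\<close>, then
  \<open>- \<psi>\<^sup>\<sigma> - \<mu> * H\<^sub>y = - \<psi>\<close>, so the first equation is the adjoint equation itself; the second one holds as
  soon as \<open>H\<^sub>u = 0\<close>, and the third one is the state equation.  It remains to find nontrivial
  \<open>(\<psi>0, \<psi>)\<close> with \<open>\<psi>\<^sup>\<Delta> = - H\<^sub>y\<close> and \<open>H\<^sub>u = 0\<close>.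

  The cost is made an additional state, so that the minimizer is a trajectory of a control system
  whose final state cannot be moved to one with the same \<open>y b\<close> and lower cost.  Consider the
  solutions \<open>y\<close> of the linearised system with \<open>y a = 0\<close> that are generated by the controls \<open>w\<close>.  If
  their final values filled the whole space, the endpoint map of the nonlinear system would be
  open (\<open>endpoint_map_open\<close>), which contradicts minimality.  Hence some \<open>\<nu> \<noteq> 0\<close> is orthogonal to all
  of them (\<open>endpoint_alternative\<close>).  The costate with terminal value \<open>\<nu>\<close> exists, because the adjoint
  equation can always be solved backwards (\<open>adjoint_equation_solvable\<close>), and integration by parts
  turns the orthogonality into \<open>H\<^sub>u = 0\<close> (\<open>costate_annihilates_controls\<close>).

  All analysis takes place on the interval \<open>{a..b}\<close>.  Replacing \<open>s\<close> by the last point \<open>ts_floor T s\<close> of \<open>T\<close>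
  not after it turns a delta integral into an ordinary integral and a dynamic equation into a
  Volterra integral equation with delay.  Existence for such equations and the stability of
  their solutions under small defects replace the theory of dynamic equations.  The
  linearisation needs estimates that are uniform in time; these follow from rd-continuity along
  all trajectories (\<open>rd_along_uniform\<close>).\<close>

section \<open>Regulated functions\<close>

definition regulated_on :: "real \<Rightarrow> real \<Rightarrow> (real \<Rightarrow> 'a::real_normed_vector) \<Rightarrow> bool" where
  "regulated_on a b f \<longleftrightarrow>
     (\<forall>x. a < x \<longrightarrow> x \<le> b \<longrightarrow> (\<exists>l. (f \<longlongrightarrow> l) (at_left x))) \<and>
     (\<forall>x. a \<le> x \<longrightarrow> x < b \<longrightarrow> (\<exists>l. (f \<longlongrightarrow> l) (at_right x)))"

text \<open>Near each point a regulated function is uniformly close to a function with three values,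
  the two one-sided limits and the value at the point; Bolzano's bisection principle patches
  these together.\<close>

lemma regulated_on_step_approximation:
  fixes f :: "real \<Rightarrow> 'a::banach"
  assumes ab: "a \<le> b" and reg: "regulated_on a b f" and e: "e > 0"
  shows "\<exists>g. g integrable_on {a..b} \<and> bounded (g ` {a..b}) \<and> (\<forall>x\<in>{a..b}. norm (f x - g x) \<le> e)"
proof -
  define P where "P c d \<longleftrightarrow> (a \<le> c \<longrightarrow> d \<le> b \<longrightarrow> (\<exists>g. g integrable_on {c..d} \<and> bounded (g ` {c..d}) \<and>
      (\<forall>x\<in>{c..d}. norm (f x - g x) \<le> e)))" for c d
  have "P a b" using ab
  proof (induction a b rule: Bolzano)
    case (trans c m d)
    show ?case unfolding P_def
    proof (intro impI)
      assume "a \<le> c" "d \<le> b"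
      with trans obtain g1 g2 where
        g1: "g1 integrable_on {c..m}" "bounded (g1 ` {c..m})" "\<And>x. x\<in>{c..m} \<Longrightarrow> norm (f x - g1 x) \<le> e" and
        g2: "g2 integrable_on {m..d}" "bounded (g2 ` {m..d})" "\<And>x. x\<in>{m..d} \<Longrightarrow> norm (f x - g2 x) \<le> e"
        unfolding P_def by (meson order_trans)
      define g where "g x = (if x \<le> m then g1 x else g2 x)" for x
      have "g integrable_on {c..m}"
        using g1(1) by (rule integrable_eq) (simp add: g_def)
      moreover have "g integrable_on {m..d}"
        by (rule integrable_spike_finite[of "{m}", OF _ _ g2(1)]) (auto simp: g_def)
      ultimately have "g integrable_on {c..d}"
        using trans by (intro Henstock_Kurzweil_Integration.integrable_combine[of c m d]) auto
      moreover have "g ` {c..d} \<subseteq> g1 ` {c..m} \<union> g2 ` {m..d}"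
        by (auto simp: g_def)
      then have "bounded (g ` {c..d})"
        using g1(2) g2(2) bounded_Un bounded_subset by blast
      moreover have "\<forall>x\<in>{c..d}. norm (f x - g x) \<le> e"
        using g1(3) g2(3) by (auto simp: g_def)
      ultimately show "\<exists>g. g integrable_on {c..d} \<and> bounded (g ` {c..d}) \<and>
          (\<forall>x\<in>{c..d}. norm (f x - g x) \<le> e)" by blast
    qed
  next
    case (local x)
    obtain lL dL where dL: "dL > 0" "\<And>y. a \<le> y \<Longrightarrow> x - dL < y \<Longrightarrow> y < x \<Longrightarrow> norm (f y - lL) \<le> e"
    proof (cases "a < x")
      case True
      then obtain l where "(f \<longlongrightarrow> l) (at_left x)"
        using reg local unfolding regulated_on_def by blast
      then have "eventually (\<lambda>y. dist (f y) l < e) (at_left x)"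
        using e tendstoD by blast
      then obtain d where "d < x" "\<And>y. d < y \<Longrightarrow> y < x \<Longrightarrow> dist (f y) l < e"
        unfolding eventually_at_left_field by blast
      then show ?thesis
        by (intro that[of "x - d" l]) (auto simp: dist_norm intro: less_imp_le)
    next
      case False
      then show ?thesis by (intro that[of 1]) auto
    qed
    obtain lR dR where dR: "dR > 0" "\<And>y. y \<le> b \<Longrightarrow> x < y \<Longrightarrow> y < x + dR \<Longrightarrow> norm (f y - lR) \<le> e"
    proof (cases "x < b")
      case True
      then obtain l where "(f \<longlongrightarrow> l) (at_right x)"
        using reg local unfolding regulated_on_def by blast
      then have "eventually (\<lambda>y. dist (f y) l < e) (at_right x)"
        using e tendstoD by blast
      then obtain d where "d > x" "\<And>y. x < y \<Longrightarrow> y < d \<Longrightarrow> dist (f y) l < e"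
        unfolding eventually_at_right_field by blast
      then show ?thesis
        by (intro that[of "d - x" l]) (auto simp: dist_norm intro: less_imp_le)
    next
      case False
      then show ?thesis by (intro that[of 1]) auto
    qed
    define g where "g y = (if y < x then lL else if y = x then f x else lR)" for y
    have "P c d" if cd: "c \<le> x" "x \<le> d" "d - c < min dL dR" for c d
      unfolding P_def
    proof (intro impI exI conjI ballI)
      assume "a \<le> c" "d \<le> b"
      have "g integrable_on {c..x}"
        by (rule integrable_spike_finite[of "{x}" _ _ "\<lambda>_. lL"]) (auto simp: g_def)
      moreover have "g integrable_on {x..d}"
        by (rule integrable_spike_finite[of "{x}" _ _ "\<lambda>_. lR"]) (auto simp: g_def)
      ultimately show "g integrable_on {c..d}"
        using cd by (intro Henstock_Kurzweil_Integration.integrable_combine[of c x d]) auto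
      have "g ` {c..d} \<subseteq> {lL, f x, lR}"
        by (auto simp: g_def)
      then show "bounded (g ` {c..d})"
        using finite_imp_bounded finite_subset by blast
      fix y assume "y \<in> {c..d}"
      then show "norm (f y - g y) \<le> e"
        using dL dR cd \<open>a \<le> c\<close> \<open>d \<le> b\<close> e by (auto simp: g_def)
    qed
    then show ?case
      using dL(1) dR(1) by (intro exI[of _ "min dL dR"]) auto
  qed
  then show ?thesis unfolding P_def by simp
qed

lemma regulated_on_integrable:
  fixes f :: "real \<Rightarrow> 'a::banach"
  assumes "a \<le> b" "regulated_on a b f"
  shows "f integrable_on {a..b}"
proof -
  have "\<exists>g. (\<forall>x\<in>cbox a b. norm (f x - g x) \<le> e) \<and> g integrable_on cbox a b" if "e > 0" for e
    using regulated_on_step_approximation[OF assms that] by auto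
  then show ?thesis
    using integrable_uniform_limit[of a b f] by simp
qed

lemma regulated_on_bounded:
  fixes f :: "real \<Rightarrow> 'a::banach"
  assumes "a \<le> b" "regulated_on a b f"
  shows "bounded (f ` {a..b})"
proof -
  obtain g where g: "bounded (g ` {a..b})" "\<forall>x\<in>{a..b}. norm (f x - g x) \<le> 1"
    using regulated_on_step_approximation[OF assms, of 1] by auto
  from g(1) obtain B where B: "\<And>x. x \<in> {a..b} \<Longrightarrow> norm (g x) \<le> B"
    unfolding bounded_iff by (meson imageI)
  have "norm (f x) \<le> B + 1" if "x \<in> {a..b}" for x
    using B[OF that] g(2) that norm_triangle_sub[of "f x" "g x"] by fastforce
  then show ?thesis unfolding bounded_iff by blast
qed


section \<open>Volterra equations with delay\<close>

lemma norm_integral_le_exp_weight: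
  fixes h :: "real \<Rightarrow> 'a::banach"
  assumes "a \<le> t" "K > 0" "M \<ge> 0" "h integrable_on {a..t}"
    and h: "\<And>s. s \<in> {a..t} \<Longrightarrow> norm (h s) \<le> K * (M * exp (2 * K * (s - a)))"
  shows "norm (integral {a..t} h) \<le> M / 2 * exp (2 * K * (t - a))"
proof -
  define E where "E s = M / 2 * exp (2 * K * (s - a))" for s
  have "((\<lambda>s. K * (M * exp (2 * K * (s - a)))) has_integral (E t - E a)) {a..t}"
  proof (rule fundamental_theorem_of_calculus[OF \<open>a \<le> t\<close>])
    fix s
    have "(E has_real_derivative K * (M * exp (2 * K * (s - a)))) (at s within {a..t})"
      unfolding E_def by (auto intro!: derivative_eq_intros)
    then show "(E has_vector_derivative K * (M * exp (2 * K * (s - a)))) (at s within {a..t})"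
      by (simp add: has_real_derivative_iff_has_vector_derivative)
  qed
  then have "norm (integral {a..t} h) \<le> E t - E a"
    using integral_norm_bound_integral[of h "{a..t}"] assms by (metis has_integral_iff)
  moreover have "E a \<ge> 0"
    using assms by (simp add: E_def)
  ultimately show ?thesis
    by (simp add: E_def)
qed

text \<open>The equation \<open>x t = c + integral {a..t} (\<lambda>s. f s (x (d s)))\<close>, in which \<open>d s \<le> s\<close>.  Both a dynamic
  equation on a time scale and, read backwards in time, its adjoint have this form.\<close>

locale volterra =
  fixes a b K :: real and d :: "real \<Rightarrow> real" and f :: "real \<Rightarrow> 'x::euclidean_space \<Rightarrow> 'x"
  assumes ab: "a \<le> b" and K: "K > 0"
    and delay: "\<And>s. s \<in> {a..b} \<Longrightarrow> d s \<in> {a..s}"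
    and lip: "\<And>s x y. s \<in> {a..b} \<Longrightarrow> norm (f s x - f s y) \<le> K * norm (x - y)"
    and integrable: "\<And>x. continuous_on {a..b} x \<Longrightarrow> (\<lambda>s. f s (x (d s))) integrable_on {a..b}"
begin

lemma norm_integral_diff_le:
  assumes x: "continuous_on {a..b} x" and y: "continuous_on {a..b} y" and "M \<ge> 0"
    and xy: "\<And>s. s \<in> {a..b} \<Longrightarrow> norm (x s - y s) \<le> M * exp (2 * K * (s - a))"
    and t: "t \<in> {a..b}"
  shows "norm (integral {a..t} (\<lambda>s. f s (x (d s))) - integral {a..t} (\<lambda>s. f s (y (d s))))
    \<le> M / 2 * exp (2 * K * (t - a))"
proof -
  have int: "(\<lambda>s. f s (z (d s))) integrable_on {a..t}" if "continuous_on {a..b} z" for z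
    using integrable[OF that] t by (auto intro: integrable_subinterval_real)
  have "norm (f s (x (d s)) - f s (y (d s))) \<le> K * (M * exp (2 * K * (s - a)))" if "s \<in> {a..t}" for s
  proof -
    have s: "s \<in> {a..b}" using that t by auto
    have ds: "d s \<in> {a..b}" "d s \<le> s" using delay[OF s] s by auto
    have "norm (f s (x (d s)) - f s (y (d s))) \<le> K * norm (x (d s) - y (d s))"
      using lip[OF s] .
    also have "\<dots> \<le> K * (M * exp (2 * K * (d s - a)))"
      using xy[OF ds(1)] K by simp
    also have "\<dots> \<le> K * (M * exp (2 * K * (s - a)))"
      using ds(2) K \<open>M \<ge> 0\<close> by (simp add: mult_left_mono)
    finally show ?thesis .
  qed
  then have "norm (integral {a..t} (\<lambda>s. f s (x (d s)) - f s (y (d s)))) \<le> M / 2 * exp (2 * K * (t - a))"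
    using t K \<open>M \<ge> 0\<close> int[OF x] int[OF y]
    by (intro norm_integral_le_exp_weight integrable_diff) auto
  then show ?thesis
    by (simp add: integral_diff[OF int[OF x] int[OF y]])
qed

text \<open>In the norm weighted by \<open>exp (- 2 * K * (t - a))\<close> the integral operator contracts by the
  factor \<open>1/2\<close>, because the delay only makes the weight more favourable.\<close>

lemma solution_exists:
  obtains x where "continuous_on {a..b} x"
    "\<And>t. t \<in> {a..b} \<Longrightarrow> x t = c + integral {a..t} (\<lambda>s. f s (x (d s)))"
proof -
  define w where "w t = exp (2 * K * (t - a))" for t
  have w_pos: "w t > 0" for t by (simp add: w_def)
  have w_cont: "continuous_on S w" for S unfolding w_def by (intro continuous_intros)
  define X where "X z t = w t *\<^sub>R apply_bcontfun z t" for z :: "real \<Rightarrow>\<^sub>C 'x" and t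
  have X_cont: "continuous_on {a..b} (X z)" for z
    unfolding X_def by (intro continuous_intros w_cont continuous_on_apply_bcontfun)
  define I where "I z t = c + integral {a..t} (\<lambda>s. f s (X z (d s)))" for z t
  have I_cont: "continuous_on {a..b} (I z)" for z
    unfolding I_def by (intro continuous_intros indefinite_integral_continuous_1 integrable X_cont)
  have "\<exists>g. \<forall>t. apply_bcontfun g t = inverse (w (clamp a b t)) *\<^sub>R I z (clamp a b t)" for z
  proof -
    have "continuous_on (cbox a b) (\<lambda>t. inverse (w t) *\<^sub>R I z t)"
      using w_pos by (auto intro!: continuous_intros w_cont I_cont simp: less_imp_neq[THEN not_sym])
    then show ?thesis
      by (rule continuous_on_cbox_bcontfunE) blast
  qed
  then obtain \<Phi> where \<Phi>: "\<And>z t. apply_bcontfun (\<Phi> z) t = inverse (w (clamp a b t)) *\<^sub>R I z (clamp a b t)"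
    by metis
  have "dist (\<Phi> z1) (\<Phi> z2) \<le> 1 / 2 * dist z1 z2" for z1 z2
  proof (rule dist_bound)
    fix t
    define r where "r = clamp a b t"
    have r: "r \<in> {a..b}"
      using ab clamp_in_interval[of a b t] by (auto simp: r_def)
    have "norm (X z1 s - X z2 s) \<le> dist z1 z2 * exp (2 * K * (s - a))" for s
    proof -
      have "norm (X z1 s - X z2 s) = w s * dist (z1 s) (z2 s)"
        using w_pos[of s] unfolding X_def dist_norm by (metis abs_of_pos norm_scaleR real_vector.scale_right_diff_distrib)
      also have "\<dots> \<le> w s * dist z1 z2"
        using w_pos[of s] by (intro mult_left_mono dist_bounded) auto
      finally show ?thesis by (simp add: w_def mult.commute)
    qed
    then have "norm (I z1 r - I z2 r) \<le> dist z1 z2 / 2 * w r"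
      unfolding I_def w_def using norm_integral_diff_le[OF X_cont X_cont _ _ r] by simp
    moreover have "dist (\<Phi> z1 t) (\<Phi> z2 t) = inverse (w r) * norm (I z1 r - I z2 r)"
      using w_pos[of r] unfolding \<Phi> r_def[symmetric] dist_norm
      by (metis abs_of_pos inverse_positive_iff_positive norm_scaleR real_vector.scale_right_diff_distrib)
    ultimately have "dist (\<Phi> z1 t) (\<Phi> z2 t) \<le> inverse (w r) * (dist z1 z2 / 2 * w r)"
      using w_pos[of r] by (simp add: mult_left_mono)
    also have "\<dots> = 1 / 2 * dist z1 z2"
      using w_pos[of r] by simp
    finally show "dist (\<Phi> z1 t) (\<Phi> z2 t) \<le> 1 / 2 * dist z1 z2" .
  qed
  then obtain z where z: "\<Phi> z = z"
    using banach_fix_type[of "1/2" \<Phi>] by auto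
  have "X z t = c + integral {a..t} (\<lambda>s. f s (X z (d s)))" if t: "t \<in> {a..b}" for t
  proof -
    have "clamp a b t = t" using t by (intro clamp_cancel_cbox) auto
    then have "z t = inverse (w t) *\<^sub>R I z t" using \<Phi>[of z t] z by simp
    then have "X z t = I z t" using w_pos[of t] by (simp add: X_def)
    then show ?thesis by (simp add: I_def)
  qed
  then show thesis using that X_cont by blast
qed

text \<open>Gronwall's inequality in the form needed here: an approximate solution is close to the
  solution, with a constant that does not depend on \<open>f\<close> except through \<open>K\<close>.  It takes
  the role of uniqueness, of continuous dependence and of differentiable dependence.\<close>

lemma approximate_solution_close:
  assumes x: "continuous_on {a..b} x" and y: "continuous_on {a..b} y"
    and xeq: "\<And>t. t \<in> {a..b} \<Longrightarrow> x t = c + integral {a..t} (\<lambda>s. f s (x (d s)))"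
    and yeq: "\<And>t. t \<in> {a..b} \<Longrightarrow> norm (y t - (c + integral {a..t} (\<lambda>s. f s (y (d s))))) \<le> \<epsilon>"
    and t: "t \<in> {a..b}"
  shows "norm (x t - y t) \<le> 2 * exp (2 * K * (b - a)) * \<epsilon>"
proof -
  define w where "w t = exp (2 * K * (t - a))" for t
  have "continuous_on {a..b} (\<lambda>t. norm (x t - y t) / w t)"
    unfolding w_def by (intro continuous_intros x y) auto
  then obtain m where m: "m \<in> {a..b}" "\<And>s. s \<in> {a..b} \<Longrightarrow> norm (x s - y s) / w s \<le> norm (x m - y m) / w m"
    using ab continuous_attains_sup[of "{a..b}" "\<lambda>t. norm (x t - y t) / w t"] by auto
  define M where "M = norm (x m - y m) / w m"
  have "M \<ge> 0" by (simp add: M_def w_def)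
  have bound: "norm (x s - y s) \<le> M * w s" if "s \<in> {a..b}" for s
    using m(2)[OF that] by (simp add: M_def w_def field_simps)
  have "w m \<ge> 1" using m K by (simp add: w_def)
  have "\<epsilon> \<ge> 0" using yeq[OF t] norm_ge_zero order_trans by blast
  have "norm (x m - y m) \<le> norm (integral {a..m} (\<lambda>s. f s (x (d s))) - integral {a..m} (\<lambda>s. f s (y (d s))))
      + norm (y m - (c + integral {a..m} (\<lambda>s. f s (y (d s)))))"
    using xeq[OF m(1)] norm_triangle_ineq4[of "integral {a..m} (\<lambda>s. f s (x (d s))) - integral {a..m} (\<lambda>s. f s (y (d s)))"
      "y m - (c + integral {a..m} (\<lambda>s. f s (y (d s))))"] by (simp add: algebra_simps)
  also have "\<dots> \<le> M / 2 * w m + \<epsilon>"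
    using norm_integral_diff_le[OF x y \<open>M \<ge> 0\<close> _ m(1)] bound yeq[OF m(1)] unfolding w_def
    by (intro add_mono) auto
  finally have "M * w m \<le> M / 2 * w m + \<epsilon>"
    using \<open>w m \<ge> 1\<close> by (simp add: M_def)
  moreover have "\<epsilon> \<le> \<epsilon> * w m"
    using \<open>w m \<ge> 1\<close> \<open>\<epsilon> \<ge> 0\<close> by (simp add: mult_le_cancel_left1)
  ultimately have "M * w m \<le> 2 * \<epsilon> * w m" by (simp add: algebra_simps)
  then have "M \<le> 2 * \<epsilon>" using \<open>w m \<ge> 1\<close> by simp
  then have "norm (x t - y t) \<le> 2 * \<epsilon> * w t"
    using bound[OF t] mult_right_mono[of M "2 * \<epsilon>" "w t"] unfolding w_def
    by (meson exp_ge_zero order_trans)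
  also have "\<dots> \<le> 2 * \<epsilon> * exp (2 * K * (b - a))"
    using t K \<open>\<epsilon> \<ge> 0\<close> by (intro mult_left_mono) (auto simp: w_def)
  finally show ?thesis by (simp add: algebra_simps)
qed

end

section \<open>Compact time scales\<close>

text \<open>The last point of \<open>T\<close> not after \<open>s\<close>.  A function on \<open>T\<close>, composed with it, becomes a function
  on the whole interval which is constant on the gaps; the ordinary integral of that function
  is the delta integral.\<close>

definition ts_floor :: "real set \<Rightarrow> real \<Rightarrow> real" where
  "ts_floor T s = Sup {r \<in> T. r \<le> s}"

locale compact_time_scale =
  fixes T :: "real set" and a b :: real
  assumes closed_T: "closed T" and T_sub: "T \<subseteq> {a..b}" and a_in: "a \<in> T" and b_in: "b \<in> T"
    and a_less_b: "a < b"
begin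

lemma T_bounds: "t \<in> T \<Longrightarrow> a \<le> t" "t \<in> T \<Longrightarrow> t \<le> b"
  using T_sub by auto

lemma Sup_T: "Sup T = b"
  using b_in T_sub by (intro cSup_eq_maximum) auto

lemma Sup_mem_T:
  assumes "S \<subseteq> T" "S \<noteq> {}"
  shows "Sup S \<in> T"
proof -
  have "bdd_above S" using assms T_sub by (meson bdd_above_Icc bdd_above_mono order_trans)
  then have "Sup S \<in> closure S" using assms closure_contains_Sup by blast
  then show ?thesis using closure_minimal[OF assms(1) closed_T] by auto
qed

lemma Inf_mem_T:
  assumes "S \<subseteq> T" "S \<noteq> {}"
  shows "Inf S \<in> T"
proof -
  have "bdd_below S" using assms T_sub by (meson bdd_below_Icc bdd_below_mono order_trans)
  then have "Inf S \<in> closure S" using assms closure_contains_Inf by blast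
  then show ?thesis using closure_minimal[OF assms(1) closed_T] by auto
qed

lemma sigma_in: "t \<in> T \<Longrightarrow> sigma T t \<in> T"
  unfolding sigma_def using Inf_mem_T[of "{s \<in> T. t < s}"] by auto

lemma sigma_ge: "t \<le> sigma T t"
  unfolding sigma_def by (auto intro: cInf_greatest)

lemma sigma_le:
  assumes "s \<in> T" "t < s"
  shows "sigma T t \<le> s"
proof -
  have "bdd_below {s \<in> T. t < s}" by (rule bdd_belowI[of _ t]) auto
  then show ?thesis using assms by (auto simp: sigma_def intro: cInf_lower)
qed

lemma sigma_b [simp]: "sigma T b = b"
  using T_bounds(2) unfolding sigma_def by fastforce

lemma right_dense_approx:
  assumes "t < b" "sigma T t = t" "t < u"
  shows "\<exists>s\<in>T. t < s \<and> s < u"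
proof (rule ccontr)
  assume *: "\<not> ?thesis"
  have "\<exists>s\<in>T. t < s" using b_in assms(1) by blast
  moreover then have "u \<le> Inf {s \<in> T. t < s}" using * by (intro cInf_greatest) (auto simp: not_less)
  ultimately show False using assms by (simp add: sigma_def)
qed

lemma left_dense_approx:
  assumes "a < t" "rho T t = t" "u < t"
  shows "\<exists>s\<in>T. u < s \<and> s < t"
proof (rule ccontr)
  assume *: "\<not> ?thesis"
  have "\<exists>s\<in>T. s < t" using a_in assms(1) by blast
  moreover then have "Sup {s \<in> T. s < t} \<le> u" using * by (intro cSup_least) (auto simp: not_less)
  ultimately show False using assms by (simp add: rho_def)
qed

lemma rho_le: "rho T t \<le> t"
  unfolding rho_def by (auto intro: cSup_least)

lemma le_rho:
  assumes "s \<in> T" "s < t"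
  shows "s \<le> rho T t"
proof -
  have "bdd_above {s \<in> T. s < t}" by (rule bdd_aboveI[of _ t]) auto
  then show ?thesis using assms by (auto simp: rho_def intro: cSup_upper)
qed

lemma kappa_iff: "t \<in> kappa T \<longleftrightarrow> t \<in> T \<and> (t < b \<or> rho T b = b)"
  using T_bounds le_rho[of t b] rho_le[of b] unfolding kappa_def Sup_T by force

lemma kappa_sub: "kappa T \<subseteq> T"
  by (auto simp: kappa_iff)

lemma a_in_kappa: "a \<in> kappa T"
  using a_in a_less_b by (simp add: kappa_iff)

text \<open>Passing from \<open>T\<close> to \<^term>\<open>kappa T\<close> removes the maximum exactly when it is isolated; this makes
  delta derivatives unique.\<close>

lemma sigma_limit_point:
  assumes "t \<in> kappa T" "sigma T t = t" "e > 0"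
  shows "\<exists>s\<in>T. s \<noteq> t \<and> \<bar>s - t\<bar> < e"
proof (cases "t < b")
  case True
  then show ?thesis using right_dense_approx[of t "t + e"] assms by force
next
  case False
  then have "t = b" "rho T b = b" using assms kappa_iff T_bounds by force+
  then show ?thesis using left_dense_approx[of b "b - e"] assms a_less_b by force
qed

subsection \<open>The floor\<close>

lemma ts_floor_in: "a \<le> s \<Longrightarrow> ts_floor T s \<in> T"
  unfolding ts_floor_def using a_in by (intro Sup_mem_T) auto

lemma ts_floor_le: "a \<le> s \<Longrightarrow> ts_floor T s \<le> s"
  unfolding ts_floor_def using a_in by (intro cSup_least) auto

lemma le_ts_floor: "r \<in> T \<Longrightarrow> r \<le> s \<Longrightarrow> r \<le> ts_floor T s"
  unfolding ts_floor_def by (intro cSup_upper bdd_aboveI[of _ s]) auto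

lemma ts_floor_id [simp]: "t \<in> T \<Longrightarrow> ts_floor T t = t"
  by (meson T_bounds(1) le_ts_floor order_antisym order_refl ts_floor_le)

lemma ts_floor_eqI:
  assumes "r \<in> T" "r \<le> s" "\<And>q. q \<in> T \<Longrightarrow> q \<le> s \<Longrightarrow> q \<le> r"
  shows "ts_floor T s = r"
  using assms unfolding ts_floor_def by (intro cSup_eq_maximum) auto

lemma ts_floor_gap:
  assumes "t \<in> T" "t \<le> s" "s < sigma T t"
  shows "ts_floor T s = t"
proof (rule ts_floor_eqI)
  show "q \<le> t" if "q \<in> T" "q \<le> s" for q
    using sigma_le[OF that(1), of t] that(2) assms(3) by force
qed (use assms in auto)

lemma sigma_ts_floor_ge:
  assumes "a \<le> s" "s \<le> b"
  shows "s \<le> sigma T (ts_floor T s)"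
proof (rule ccontr)
  assume less: "\<not> ?thesis"
  let ?r = "ts_floor T s"
  have r: "?r \<in> T" using assms(1) by (rule ts_floor_in)
  have "sigma T ?r \<le> ?r" using less sigma_in[OF r] le_ts_floor by auto
  then have "sigma T ?r = ?r" using sigma_ge[of ?r] by auto
  then obtain q where "q \<in> T" "?r < q" "q < s"
    using right_dense_approx[of ?r s] less assms by auto
  then show False using le_ts_floor[of q s] by auto
qed

subsection \<open>Rd-continuous functions\<close>

lemma Crd_continuous: "f \<in> Crd T \<Longrightarrow> t \<in> T \<Longrightarrow> sigma T t = t \<Longrightarrow> continuous (at t within T) f"
  by (simp add: Crd_def rd_continuous_on_def right_dense_def)

lemma Crd_left_limit:
  assumes "f \<in> Crd T" "t \<in> T"
  shows "\<exists>l. (f \<longlongrightarrow> l) (at t within T \<inter> {..<t})"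
proof (cases "rho T t = t")
  case True
  then show ?thesis using assms by (simp add: Crd_def rd_continuous_on_def left_dense_def)
next
  case False
  then have "rho T t < t" using rho_le[of t] by auto
  then have "eventually (\<lambda>_. False) (at t within T \<inter> {..<t})"
    unfolding eventually_at using le_rho[of _ t]
    by (intro exI[of _ "t - rho T t"]) (force simp: dist_real_def)
  then show ?thesis by (auto simp: trivial_limit_def[symmetric] eventually_False)
qed

lemma Crd_right_limit:
  assumes "f \<in> Crd T" "t \<in> T"
  shows "\<exists>l. (f \<longlongrightarrow> l) (at t within T \<inter> {t<..})"
proof (cases "sigma T t = t")
  case True
  then have "(f \<longlongrightarrow> f t) (at t within T)"
    using Crd_continuous[OF assms] by (simp add: continuous_within)
  then show ?thesis by (metis inf_le1 tendsto_within_subset)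
next
  case False
  then have "t < sigma T t" using sigma_ge[of t] by auto
  then have "eventually (\<lambda>_. False) (at t within T \<inter> {t<..})"
    unfolding eventually_at using sigma_le[of _ t]
    by (intro exI[of _ "sigma T t - t"]) (force simp: dist_real_def)
  then show ?thesis by (auto simp: trivial_limit_def[symmetric] eventually_False)
qed

lemma CrdI:
  assumes "\<And>t. t \<in> T \<Longrightarrow> sigma T t = t \<Longrightarrow> (f \<longlongrightarrow> f t) (at t within T)"
    "\<And>t. t \<in> T \<Longrightarrow> rho T t = t \<Longrightarrow> \<exists>l. (f \<longlongrightarrow> l) (at t within T \<inter> {..<t})"
  shows "f \<in> Crd T"
  using assms by (auto simp: Crd_def rd_continuous_on_def right_dense_def left_dense_def continuous_within)

lemma Crd_cong:
  assumes "\<And>t. t \<in> T \<Longrightarrow> f t = g t"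
  shows "f \<in> Crd T \<longleftrightarrow> g \<in> Crd T"
proof -
  have "g \<in> Crd T" if f: "f \<in> Crd T" and eq: "\<And>t. t \<in> T \<Longrightarrow> f t = g t" for f g :: "real \<Rightarrow> 'a"
  proof (rule CrdI)
    fix t assume t: "t \<in> T"
    have *: "(g \<longlongrightarrow> l) (at t within S)" if "(f \<longlongrightarrow> l) (at t within S)" "S \<subseteq> T" for l S
      using that eq by (intro Lim_transform_within[OF that(1), of 1]) auto
    show "(g \<longlongrightarrow> g t) (at t within T)" if "sigma T t = t"
      using Crd_continuous[OF f t that] eq[OF t] by (intro *) (auto simp: continuous_within)
    show "\<exists>l. (g \<longlongrightarrow> l) (at t within T \<inter> {..<t})"
      using Crd_left_limit[OF f t] * by blast
  qed
  from this[of f g] this[of g f] show ?thesis using assms by metis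
qed

lemma continuous_imp_Crd:
  assumes "continuous_on T f"
  shows "f \<in> Crd T"
proof (rule CrdI)
  fix t assume "t \<in> T"
  then show *: "(f \<longlongrightarrow> f t) (at t within T)"
    using assms by (simp add: continuous_on_def)
  then show "\<exists>l. (f \<longlongrightarrow> l) (at t within T \<inter> {..<t})"
    by (metis inf_le1 tendsto_within_subset)
qed

lemma Crd_add:
  assumes "f \<in> Crd T" "g \<in> Crd T"
  shows "(\<lambda>t. f t + g t) \<in> Crd T"
proof (rule CrdI)
  fix t assume t: "t \<in> T"
  show "((\<lambda>t. f t + g t) \<longlongrightarrow> f t + g t) (at t within T)" if "sigma T t = t"
    using Crd_continuous[OF assms(1) t that] Crd_continuous[OF assms(2) t that]
    by (auto simp: continuous_within intro: tendsto_add)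
  show "\<exists>l. ((\<lambda>t. f t + g t) \<longlongrightarrow> l) (at t within T \<inter> {..<t})"
    using Crd_left_limit[OF assms(1) t] Crd_left_limit[OF assms(2) t] tendsto_add by blast
qed

lemma Crd_bilinear:
  assumes "bounded_bilinear h" "f \<in> Crd T" "g \<in> Crd T"
  shows "(\<lambda>t. h (f t) (g t)) \<in> Crd T"
proof (rule CrdI)
  fix t assume t: "t \<in> T"
  show "((\<lambda>t. h (f t) (g t)) \<longlongrightarrow> h (f t) (g t)) (at t within T)" if "sigma T t = t"
    using Crd_continuous[OF assms(2) t that] Crd_continuous[OF assms(3) t that]
    by (auto simp: continuous_within intro: bounded_bilinear.tendsto[OF assms(1)])
  show "\<exists>l. ((\<lambda>t. h (f t) (g t)) \<longlongrightarrow> l) (at t within T \<inter> {..<t})"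
    using Crd_left_limit[OF assms(2) t] Crd_left_limit[OF assms(3) t]
    using bounded_bilinear.tendsto[OF assms(1)] by blast
qed

lemma Crd_linear:
  assumes "bounded_linear h" "f \<in> Crd T"
  shows "(\<lambda>t. h (f t)) \<in> Crd T"
proof (rule CrdI)
  fix t assume t: "t \<in> T"
  show "((\<lambda>t. h (f t)) \<longlongrightarrow> h (f t)) (at t within T)" if "sigma T t = t"
    using Crd_continuous[OF assms(2) t that]
    by (auto simp: continuous_within intro: bounded_linear.tendsto[OF assms(1)])
  show "\<exists>l. ((\<lambda>t. h (f t)) \<longlongrightarrow> l) (at t within T \<inter> {..<t})"
    using Crd_left_limit[OF assms(2) t] bounded_linear.tendsto[OF assms(1)] by blast
qed

lemma Crd_Pair:
  assumes "f \<in> Crd T" "g \<in> Crd T"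
  shows "(\<lambda>t. (f t, g t)) \<in> Crd T"
proof -
  have "bounded_linear (\<lambda>x. (x, 0))" "bounded_linear (\<lambda>x. (0, x))"
    by (auto intro!: bounded_linear_Pair bounded_linear_ident bounded_linear_zero)
  then have "(\<lambda>t. (f t, 0) + (0, g t)) \<in> Crd T"
    using assms by (intro Crd_add Crd_linear[of "\<lambda>x. (x, 0)"] Crd_linear[of "\<lambda>x. (0, x)"])
  then show ?thesis by simp
qed

lemma Crd_scaleR: "f \<in> Crd T \<Longrightarrow> g \<in> Crd T \<Longrightarrow> (\<lambda>t. f t *\<^sub>R g t) \<in> Crd T"
  by (rule Crd_bilinear[OF bounded_bilinear_scaleR])

lemma Crd_inner: "f \<in> Crd T \<Longrightarrow> g \<in> Crd T \<Longrightarrow> (\<lambda>t. f t \<bullet> g t) \<in> Crd T"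
  by (rule Crd_bilinear[OF bounded_bilinear_inner])

lemma Crd_const: "(\<lambda>t. c) \<in> Crd T"
  by (simp add: continuous_imp_Crd)

lemma Crd_sum:
  assumes "\<And>i. i \<in> I \<Longrightarrow> f i \<in> Crd T"
  shows "(\<lambda>t. \<Sum>i\<in>I. f i t) \<in> Crd T"
  using assms by (induction I rule: infinite_finite_induct) (auto intro: Crd_const Crd_add)

text \<open>Towards a right-dense point the jump operator is squeezed between the identity and the next
  point of \<open>T\<close>; towards a left-dense point it is squeezed between the identity and that point.\<close>

lemma Crd_comp_sigma:
  assumes "continuous_on T f"
  shows "(\<lambda>t. f (sigma T t)) \<in> Crd T"
proof (rule CrdI)
  fix t assume t: "t \<in> T"
  have f: "(f \<longlongrightarrow> f t) (at t within T)"
    using assms t by (simp add: continuous_on_def)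
  have lim: "((\<lambda>t. f (sigma T t)) \<longlongrightarrow> f t) (at t within S)"
    if "S \<subseteq> T" "(sigma T \<longlongrightarrow> t) (at t within S)" for S
  proof (rule continuous_within_tendsto_compose[OF _ _ that(2)])
    show "continuous (at t within T) f" using f by (simp add: continuous_within)
    show "eventually (\<lambda>x. sigma T x \<in> T) (at t within S)"
      using that(1) sigma_in by (auto simp: eventually_at intro!: exI[of _ 1])
  qed
  show "((\<lambda>t. f (sigma T t)) \<longlongrightarrow> f (sigma T t)) (at t within T)" if dense: "sigma T t = t"
  proof -
    have "(sigma T \<longlongrightarrow> t) (at t within T)"
      unfolding Lim_within
    proof (intro allI impI)
      fix e :: real assume "e > 0"
      obtain q where q: "q > t" "\<And>s. s \<in> T \<Longrightarrow> s < q \<Longrightarrow> sigma T s < t + e"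
      proof (cases "t < b")
        case True
        then obtain q where "q \<in> T" "t < q" "q < t + e"
          using right_dense_approx[OF _ dense, of "t + e"] \<open>e > 0\<close> by auto
        moreover have "sigma T s \<le> q" if "s < q" for s using sigma_le[of q s] that \<open>q \<in> T\<close> by simp
        ultimately show ?thesis by (intro that[of q]) fastforce+
      next
        case False
        then have "t = b" using T_bounds t by force
        have "sigma T s < t + e" if "s \<in> T" for s
          using T_bounds(2)[OF sigma_in[OF that]] \<open>t = b\<close> \<open>e > 0\<close> by simp
        then show ?thesis by (intro that[of "t + 1"]) auto
      qed
      have "dist (sigma T s) t < e" if "s \<in> T" "dist s t < min e (q - t)" for s
      proof -
        have "sigma T s < t + e" using q(2)[of s] that by (auto simp: dist_real_def)
        moreover have "t - e < sigma T s" using sigma_ge[of s] that by (auto simp: dist_real_def)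
        ultimately show ?thesis by (simp add: dist_real_def abs_less_iff)
      qed
      then show "\<exists>d>0. \<forall>s\<in>T. 0 < dist s t \<and> dist s t < d \<longrightarrow> dist (sigma T s) t < e"
        using q(1) \<open>e > 0\<close> by (intro exI[of _ "min e (q - t)"]) auto
    qed
    then show ?thesis using lim[of T] dense by simp
  qed
  have "(sigma T \<longlongrightarrow> t) (at t within T \<inter> {..<t})"
    unfolding Lim_within
  proof (intro allI impI)
    fix e :: real assume "e > 0"
    have "dist (sigma T s) t < e" if "s \<in> T" "s < t" "dist s t < e" for s
      using sigma_le[OF t, of s] sigma_ge[of s] that by (simp add: dist_real_def)
    then show "\<exists>d>0. \<forall>s\<in>T \<inter> {..<t}. 0 < dist s t \<and> dist s t < d \<longrightarrow> dist (sigma T s) t < e"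
      using \<open>e > 0\<close> by auto
  qed
  then show "\<exists>l. ((\<lambda>t. f (sigma T t)) \<longlongrightarrow> l) (at t within T \<inter> {..<t})"
    using lim by blast
qed

text \<open>To the left of a point \<open>x\<close> the floor is either constant near by or increases to \<open>x\<close> through
  points of \<open>T\<close> below \<open>x\<close>; to the right it is constant or decreases to \<open>x\<close> through points above \<open>x\<close>.
  In all four cases a one-sided limit of \<open>f\<close> on \<open>T\<close> is inherited.\<close>

lemma regulated_on_comp_ts_floor:
  assumes f: "f \<in> Crd T"
  shows "regulated_on a b (\<lambda>s. f (ts_floor T s))"
  unfolding regulated_on_def
proof (intro conjI allI impI)
  fix x assume x: "a < x" "x \<le> b"
  define m where "m = Sup {r \<in> T. r < x}"
  have m: "m \<in> T" unfolding m_def using a_in x by (intro Sup_mem_T) auto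
  have m_ge: "r \<le> m" if "r \<in> T" "r < x" for r
    unfolding m_def using that by (intro cSup_upper bdd_aboveI[of _ x]) auto
  have "m \<le> x" unfolding m_def using a_in x by (intro cSup_least) auto
  show "\<exists>l. ((\<lambda>s. f (ts_floor T s)) \<longlongrightarrow> l) (at_left x)"
  proof (cases "m < x")
    case True
    have "eventually (\<lambda>s. f (ts_floor T s) = f m) (at_left x)"
      unfolding eventually_at_left_field
    proof (intro exI[of _ m] conjI True allI impI)
      fix s assume s: "m < s" "s < x"
      have "ts_floor T s = m"
        using s m_ge by (intro ts_floor_eqI m) auto
      then show "f (ts_floor T s) = f m" by simp
    qed
    then show ?thesis by (intro exI tendsto_eventually)
  next
    case False
    then have "m = x" using \<open>m \<le> x\<close> by simp
    then have "rho T x = x" using a_in x by (auto simp: rho_def m_def)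
    have "filterlim (ts_floor T) (at x within T \<inter> {..<x}) (at_left x)"
      unfolding filterlim_at
    proof
      have "eventually (\<lambda>s. a < s) (at_left x)"
        unfolding eventually_at_left_field using x by blast
      moreover have "eventually (\<lambda>s. s < x) (at_left x)"
        unfolding eventually_at_left_field using x by blast
      ultimately show "eventually (\<lambda>s. ts_floor T s \<in> T \<inter> {..<x} \<and> ts_floor T s \<noteq> x) (at_left x)"
      proof eventually_elim
        case (elim s)
        then show ?case using ts_floor_in[of s] ts_floor_le[of s] by auto
      qed
      show "(ts_floor T \<longlongrightarrow> x) (at_left x)"
      proof (rule tendstoI)
        fix e :: real assume "e > 0"
        then obtain r where r: "r \<in> T" "x - e < r" "r < x"
          using left_dense_approx[OF x(1) \<open>rho T x = x\<close>, of "x - e"] by auto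
        have "dist (ts_floor T s) x < e" if "r < s" "s < x" for s
          using le_ts_floor[OF r(1), of s] ts_floor_le[of s] that r T_bounds(1)[OF r(1)]
          by (auto simp: dist_real_def)
        then show "eventually (\<lambda>s. dist (ts_floor T s) x < e) (at_left x)"
          unfolding eventually_at_left_field using r by blast
      qed
    qed
    moreover obtain l where l: "(f \<longlongrightarrow> l) (at x within T \<inter> {..<x})"
      using Crd_left_limit[OF f m] \<open>m = x\<close> by auto
    ultimately have "((\<lambda>s. f (ts_floor T s)) \<longlongrightarrow> l) (at_left x)"
      by (intro filterlim_compose[OF l])
    then show ?thesis by blast
  qed
next
  fix x assume x: "a \<le> x" "x < b"
  define m where "m = Inf {r \<in> T. x < r}"
  have m: "m \<in> T" unfolding m_def using b_in x by (intro Inf_mem_T) auto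
  have m_le: "m \<le> r" if "r \<in> T" "x < r" for r
    unfolding m_def using that by (intro cInf_lower bdd_belowI[of _ x]) auto
  have "x \<le> m" unfolding m_def using b_in x by (intro cInf_greatest) auto
  show "\<exists>l. ((\<lambda>s. f (ts_floor T s)) \<longlongrightarrow> l) (at_right x)"
  proof (cases "x < m")
    case True
    have "ts_floor T s = ts_floor T x" if "x < s" "s < m" for s
    proof (rule ts_floor_eqI)
      show "ts_floor T x \<in> T" using x by (intro ts_floor_in) 
      show "ts_floor T x \<le> s" using x that ts_floor_le[of x] by auto
      show "q \<le> ts_floor T x" if "q \<in> T" "q \<le> s" for q
        using m_le[OF that(1)] le_ts_floor[OF that(1), of x] \<open>s < m\<close> that(2) by linarith
    qed
    then have "eventually (\<lambda>s. f (ts_floor T s) = f (ts_floor T x)) (at_right x)"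
      unfolding eventually_at_right_field using True by (intro exI[of _ m]) auto
    then show ?thesis by (intro exI tendsto_eventually)
  next
    case False
    then have "m = x" using \<open>x \<le> m\<close> by simp
    then have "sigma T x = x" using b_in x by (auto simp: sigma_def m_def)
    have "filterlim (ts_floor T) (at x within T \<inter> {x<..}) (at_right x)"
      unfolding filterlim_at
    proof
      have "x < ts_floor T s" if "x < s" for s
      proof -
        obtain q where "q \<in> T" "x < q" "q < s"
          using right_dense_approx[OF x(2) \<open>sigma T x = x\<close> \<open>x < s\<close>] by blast
        then show ?thesis using le_ts_floor[of q s] by simp
      qed
      then have *: "x < s \<Longrightarrow> ts_floor T s \<in> T \<inter> {x<..} \<and> ts_floor T s \<noteq> x" for s
        using ts_floor_in[of s] x by fastforce
      have "eventually (\<lambda>s. x < s) (at_right x)"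
        unfolding eventually_at_right_field using x by blast
      then show "eventually (\<lambda>s. ts_floor T s \<in> T \<inter> {x<..} \<and> ts_floor T s \<noteq> x) (at_right x)"
        by eventually_elim (rule *)
      show "(ts_floor T \<longlongrightarrow> x) (at_right x)"
      proof (rule tendstoI)
        fix e :: real assume "e > 0"
        have "dist (ts_floor T s) x < e" if "x < s" "s < x + e" for s
          using *[OF that(1)] ts_floor_le[of s] that x by (auto simp: dist_real_def)
        then show "eventually (\<lambda>s. dist (ts_floor T s) x < e) (at_right x)"
          unfolding eventually_at_right_field using \<open>e > 0\<close> by (intro exI[of _ "x + e"]) auto
      qed
    qed
    moreover obtain l where l: "(f \<longlongrightarrow> l) (at x within T \<inter> {x<..})"
      using Crd_right_limit[OF f m] \<open>m = x\<close> by auto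
    ultimately have "((\<lambda>s. f (ts_floor T s)) \<longlongrightarrow> l) (at_right x)"
      by (intro filterlim_compose[OF l])
    then show ?thesis by blast
  qed
qed

lemma Crd_integrable:
  fixes f :: "real \<Rightarrow> 'a::banach"
  assumes "f \<in> Crd T"
  shows "(\<lambda>s. f (ts_floor T s)) integrable_on {a..b}"
  using a_less_b by (intro regulated_on_integrable regulated_on_comp_ts_floor assms) simp

lemma Crd_bounded:
  fixes f :: "real \<Rightarrow> 'a::banach"
  assumes "f \<in> Crd T"
  obtains B where "B > 0" "\<And>t. t \<in> T \<Longrightarrow> norm (f t) \<le> B"
proof -
  have "bounded ((\<lambda>s. f (ts_floor T s)) ` {a..b})"
    using a_less_b by (intro regulated_on_bounded regulated_on_comp_ts_floor assms) simp
  then obtain B where B: "B > 0" "\<And>s. s \<in> {a..b} \<Longrightarrow> norm (f (ts_floor T s)) \<le> B"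
    unfolding bounded_pos by auto
  have "norm (f t) \<le> B" if "t \<in> T" for t
    using B(2)[of t] that T_sub by auto
  with B(1) show thesis using that by blast
qed

end

section \<open>Delta derivative and delta integral\<close>

context compact_time_scale
begin

lemma has_delta_deriv_cong:
  assumes "has_delta_deriv T f D t" "\<And>s. s \<in> T \<Longrightarrow> f s = g s" "t \<in> T"
  shows "has_delta_deriv T g D t"
  using assms(1,2) sigma_in[OF assms(3)] unfolding has_delta_deriv_def by auto

lemma has_delta_deriv_linear:
  assumes h: "bounded_linear h" and f: "has_delta_deriv T f D t"
  shows "has_delta_deriv T (\<lambda>s. h (f s)) (h D) t"
  unfolding has_delta_deriv_def
proof (intro allI impI)
  fix e :: real assume e: "e > 0"
  interpret h: bounded_linear h by fact
  obtain B where B: "B > 0" "\<And>x. norm (h x) \<le> norm x * B"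
    using h.pos_bounded by blast
  have "e / B > 0" using e B by simp
  then obtain d where d: "d > 0"
    "\<And>s. s \<in> T \<Longrightarrow> \<bar>s - t\<bar> < d \<Longrightarrow> norm (f (sigma T t) - f s - (sigma T t - s) *\<^sub>R D) \<le> e / B * \<bar>sigma T t - s\<bar>"
    using f unfolding has_delta_deriv_def by blast
  have "norm (h (f (sigma T t)) - h (f s) - (sigma T t - s) *\<^sub>R h D) \<le> e * \<bar>sigma T t - s\<bar>"
    if "s \<in> T" "\<bar>s - t\<bar> < d" for s
  proof -
    have "norm (h (f (sigma T t) - f s - (sigma T t - s) *\<^sub>R D)) \<le> (e / B * \<bar>sigma T t - s\<bar>) * B"
      using B d(2)[OF that] by (meson less_imp_le mult_right_mono order_trans)
    then show ?thesis using B(1) by (simp add: h.diff h.scaleR)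
  qed
  then show "\<exists>d>0. \<forall>s\<in>T. \<bar>s - t\<bar> < d \<longrightarrow>
      norm (h (f (sigma T t)) - h (f s) - (sigma T t - s) *\<^sub>R h D) \<le> e * \<bar>sigma T t - s\<bar>"
    using d(1) by blast
qed

lemma has_delta_deriv_add:
  assumes f: "has_delta_deriv T f D t" and g: "has_delta_deriv T g E t"
  shows "has_delta_deriv T (\<lambda>s. f s + g s) (D + E) t"
  unfolding has_delta_deriv_def
proof (intro allI impI)
  fix e :: real assume "e > 0"
  then have e: "e / 2 > 0" by simp
  obtain d where d: "d > 0"
    "\<And>s. s \<in> T \<Longrightarrow> \<bar>s - t\<bar> < d \<Longrightarrow> norm (f (sigma T t) - f s - (sigma T t - s) *\<^sub>R D) \<le> e / 2 * \<bar>sigma T t - s\<bar>"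
    using f e unfolding has_delta_deriv_def by blast
  obtain d' where d': "d' > 0"
    "\<And>s. s \<in> T \<Longrightarrow> \<bar>s - t\<bar> < d' \<Longrightarrow> norm (g (sigma T t) - g s - (sigma T t - s) *\<^sub>R E) \<le> e / 2 * \<bar>sigma T t - s\<bar>"
    using g e unfolding has_delta_deriv_def by blast
  have "norm (f (sigma T t) + g (sigma T t) - (f s + g s) - (sigma T t - s) *\<^sub>R (D + E)) \<le> e * \<bar>sigma T t - s\<bar>"
    if "s \<in> T" "\<bar>s - t\<bar> < min d d'" for s
  proof -
    have "norm ((f (sigma T t) - f s - (sigma T t - s) *\<^sub>R D) + (g (sigma T t) - g s - (sigma T t - s) *\<^sub>R E))
        \<le> e / 2 * \<bar>sigma T t - s\<bar> + e / 2 * \<bar>sigma T t - s\<bar>"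
      using that by (intro norm_triangle_mono d d') auto
    then show ?thesis by (simp add: algebra_simps)
  qed
  then show "\<exists>d>0. \<forall>s\<in>T. \<bar>s - t\<bar> < d \<longrightarrow>
      norm (f (sigma T t) + g (sigma T t) - (f s + g s) - (sigma T t - s) *\<^sub>R (D + E)) \<le> e * \<bar>sigma T t - s\<bar>"
    using d(1) d'(1) by (intro exI[of _ "min d d'"]) auto
qed

lemma has_delta_deriv_minus: "has_delta_deriv T f D t \<Longrightarrow> has_delta_deriv T (\<lambda>s. - f s) (- D) t"
  by (rule has_delta_deriv_linear[OF bounded_linear_minus[OF bounded_linear_ident]])

lemma has_delta_deriv_diff:
  assumes "has_delta_deriv T f D t" "has_delta_deriv T g E t"
  shows "has_delta_deriv T (\<lambda>s. f s - g s) (D - E) t"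
  using has_delta_deriv_add[OF assms(1) has_delta_deriv_minus[OF assms(2)]] by simp

lemma has_delta_deriv_Pair:
  assumes "has_delta_deriv T f D t" "has_delta_deriv T g E t"
  shows "has_delta_deriv T (\<lambda>s. (f s, g s)) (D, E) t"
proof -
  have "bounded_linear (\<lambda>x. (x, 0))" "bounded_linear (\<lambda>x. (0, x))"
    by (auto intro!: bounded_linear_Pair bounded_linear_ident bounded_linear_zero)
  from has_delta_deriv_add[OF has_delta_deriv_linear[OF this(1) assms(1)] has_delta_deriv_linear[OF this(2) assms(2)]]
  show ?thesis by simp
qed

lemma has_delta_deriv_const: "has_delta_deriv T (\<lambda>s. c) 0 t"
  unfolding has_delta_deriv_def by (auto intro!: exI[of _ 1])

lemma has_delta_deriv_jump:
  assumes "has_delta_deriv T f D t" "t \<in> T"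
  shows "f (sigma T t) - f t = (sigma T t - t) *\<^sub>R D"
proof -
  have "norm (f (sigma T t) - f t - (sigma T t - t) *\<^sub>R D) \<le> 0 + e" if "e > 0" for e
  proof -
    let ?A = "\<bar>sigma T t - t\<bar>"
    have "e / (?A + 1) > 0" using that by simp
    then have "norm (f (sigma T t) - f t - (sigma T t - t) *\<^sub>R D) \<le> e / (?A + 1) * ?A"
      using assms unfolding has_delta_deriv_def by force
    also have "\<dots> \<le> e" using that by (simp add: field_simps)
    finally show ?thesis by simp
  qed
  then have "norm (f (sigma T t) - f t - (sigma T t - t) *\<^sub>R D) \<le> 0"
    using field_le_epsilon by blast
  then show ?thesis by simp
qed

lemma has_delta_deriv_continuous:
  assumes f: "has_delta_deriv T f D t" and t: "t \<in> T"
  shows "continuous (at t within T) f"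
proof -
  obtain d where d: "d > 0"
    "\<And>s. s \<in> T \<Longrightarrow> \<bar>s - t\<bar> < d \<Longrightarrow> norm (f (sigma T t) - f s - (sigma T t - s) *\<^sub>R D) \<le> 1 * \<bar>sigma T t - s\<bar>"
    using f unfolding has_delta_deriv_def by (meson zero_less_one)
  show ?thesis
  proof (cases "sigma T t = t")
    case True
    have "norm (f s - f t) \<le> (1 + norm D) * \<bar>s - t\<bar>" if "s \<in> T" "\<bar>s - t\<bar> < d" for s
    proof -
      have "norm (f t - f s) \<le> norm (f t - f s - (t - s) *\<^sub>R D) + \<bar>t - s\<bar> * norm D"
        using norm_triangle_ineq[of "f t - f s - (t - s) *\<^sub>R D" "(t - s) *\<^sub>R D"] by simp
      also have "\<dots> \<le> \<bar>t - s\<bar> + \<bar>t - s\<bar> * norm D"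
        using d(2)[OF that] True by simp
      finally show ?thesis
        by (simp add: norm_minus_commute abs_minus_commute ring_distribs mult.commute)
    qed
    then have "eventually (\<lambda>s. norm (f s - f t) \<le> (1 + norm D) * \<bar>s - t\<bar>) (at t within T)"
      unfolding eventually_at using d(1) by (auto simp: dist_real_def)
    moreover have "((\<lambda>s. (1 + norm D) * \<bar>s - t\<bar>) \<longlongrightarrow> (1 + norm D) * \<bar>t - t\<bar>) (at t within T)"
      by (intro tendsto_intros)
    ultimately have "((\<lambda>s. f s - f t) \<longlongrightarrow> 0) (at t within T)"
      by (simp add: Lim_null_comparison)
    then show ?thesis by (simp add: continuous_within LIM_zero_cancel)
  next
    case False
    (* The difference quotients at s and at t have the same far end point sigma T t. *)
    show ?thesis unfolding continuous_within
    proof (rule tendstoI)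
      fix e :: real assume "e > 0"
      define M where "M = sigma T t - t"
      have M: "M > 0" using False sigma_ge[of t] by (simp add: M_def)
      define e' where "e' = e / (4 * M)"
      have "e' > 0" using M \<open>e > 0\<close> by (simp add: e'_def)
      then obtain d where d: "d > 0"
        "\<And>s. s \<in> T \<Longrightarrow> \<bar>s - t\<bar> < d \<Longrightarrow> norm (f (sigma T t) - f s - (sigma T t - s) *\<^sub>R D) \<le> e' * \<bar>sigma T t - s\<bar>"
        using f unfolding has_delta_deriv_def by meson
      define k where "k = 1 + norm D"
      have "k > 0" by (simp add: k_def add_pos_nonneg)
      define r where "r = min d (min M (e / (4 * k)))"
      then have "r > 0" using d(1) M \<open>e > 0\<close> \<open>k > 0\<close> by (simp add: r_def)
      have "dist (f s) (f t) < e" if s: "s \<in> T" "dist s t < r" for s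
      proof -
        have st: "\<bar>s - t\<bar> < d" "\<bar>s - t\<bar> < M" "\<bar>s - t\<bar> < e / (4 * k)"
          using s by (auto simp: r_def dist_real_def)
        have "f s - f t = (s - t) *\<^sub>R D - (f (sigma T t) - f s - (sigma T t - s) *\<^sub>R D)"
          using has_delta_deriv_jump[OF f t] by (simp add: algebra_simps)
        then have "norm (f s - f t) \<le> \<bar>s - t\<bar> * norm D + e' * \<bar>sigma T t - s\<bar>"
          using norm_triangle_ineq4[of "(s - t) *\<^sub>R D"] d(2)[OF s(1) st(1)]
          by (metis add_left_mono norm_scaleR order_trans real_norm_def)
        also have "\<dots> \<le> \<bar>s - t\<bar> * k + e' * (2 * M)"
          using st(2) \<open>e' > 0\<close> by (intro add_mono mult_left_mono) (auto simp: M_def k_def)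
        also have "\<dots> < e / (4 * k) * k + e' * (2 * M)"
          using st(3) \<open>k > 0\<close> by (intro add_strict_right_mono mult_strict_right_mono)
        also have "\<dots> = e / 4 + e / 2"
          using M \<open>k > 0\<close> by (simp add: e'_def)
        also have "\<dots> < e" using \<open>e > 0\<close> by simp
        finally show ?thesis by (simp add: dist_norm)
      qed
      then show "eventually (\<lambda>s. dist (f s) (f t) < e) (at t within T)"
        unfolding eventually_at using \<open>r > 0\<close> by blast
    qed
  qed
qed

lemma has_delta_deriv_unique:
  assumes D: "has_delta_deriv T f D t" and E: "has_delta_deriv T f E t" and t: "t \<in> kappa T"
  shows "D = E"
proof (cases "sigma T t = t")
  case False
  have "t \<in> T" using t kappa_sub by auto
  then have "(sigma T t - t) *\<^sub>R D = (sigma T t - t) *\<^sub>R E"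
    using has_delta_deriv_jump[OF D] has_delta_deriv_jump[OF E] by metis
  then show ?thesis using False by auto
next
  case True
  have zero: "has_delta_deriv T (\<lambda>s. 0) (D - E) t"
    using has_delta_deriv_diff[OF D E] by simp
  have "norm (D - E) \<le> 0 + e" if "e > 0" for e
  proof -
    obtain d where d: "d > 0"
      "\<And>s. s \<in> T \<Longrightarrow> \<bar>s - t\<bar> < d \<Longrightarrow> norm ((t - s) *\<^sub>R (D - E)) \<le> e * \<bar>t - s\<bar>"
      using zero \<open>e > 0\<close> True unfolding has_delta_deriv_def by auto
    obtain s where s: "s \<in> T" "s \<noteq> t" "\<bar>s - t\<bar> < d"
      using sigma_limit_point[OF t True d(1)] by auto
    then show ?thesis using d(2)[of s] by (simp add: mult.commute)
  qed
  then have "norm (D - E) \<le> 0" by (rule field_le_epsilon)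
  then show ?thesis by simp
qed

lemma delta_deriv_eq:
  assumes "has_delta_deriv T f D t" "t \<in> kappa T"
  shows "delta_deriv T f t = D"
  unfolding delta_deriv_def using has_delta_deriv_unique assms by blast

lemma has_delta_deriv_delta_deriv:
  assumes "delta_differentiable T f t" "t \<in> kappa T"
  shows "has_delta_deriv T f (delta_deriv T f t) t"
  using assms delta_deriv_eq unfolding delta_differentiable_def by metis

text \<open>A point of \<open>T\<close> outside \<^term>\<open>kappa T\<close> is isolated, so continuity there is automatic.\<close>

lemma continuous_on_if_has_delta_deriv:
  assumes "\<And>t. t \<in> kappa T \<Longrightarrow> has_delta_deriv T f (f' t) t"
  shows "continuous_on T f"
  unfolding continuous_on_eq_continuous_within
proof
  fix t assume t: "t \<in> T"
  show "continuous (at t within T) f"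
  proof (cases "t \<in> kappa T")
    case True
    then show ?thesis using assms has_delta_deriv_continuous t by blast
  next
    case False
    then have "t = b" "rho T b < b" using t T_bounds rho_le[of b] by (force simp: kappa_iff)+
    then have "eventually (\<lambda>_. False) (at t within T)"
      unfolding eventually_at using le_rho[of _ b] T_bounds
      by (intro exI[of _ "b - rho T b"]) (force simp: dist_real_def)
    then show ?thesis by (simp add: continuous_within trivial_limit_def[symmetric] eventually_False)
  qed
qed

lemma has_delta_deriv_inner:
  assumes f: "has_delta_deriv T f D t" and g: "has_delta_deriv T g E t" and t: "t \<in> T"
  shows "has_delta_deriv T (\<lambda>s. f s \<bullet> g s) (f (sigma T t) \<bullet> E + D \<bullet> g t) t"
  unfolding has_delta_deriv_def
proof (intro allI impI)
  fix e :: real assume e: "e > 0"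
  define N where "N = norm (f (sigma T t)) + norm (g t) + 1 + norm D"
  have N: "N > 0"
    using norm_ge_zero[of "f (sigma T t)"] norm_ge_zero[of "g t"] norm_ge_zero[of D]
    unfolding N_def by linarith
  define e' where "e' = min 1 (e / N)"
  have e': "e' > 0" "e' \<le> 1" "e' * N \<le> e" using e N by (auto simp: e'_def min_def field_simps)
  obtain d1 where d1: "d1 > 0"
    "\<And>s. s \<in> T \<Longrightarrow> \<bar>s - t\<bar> < d1 \<Longrightarrow> norm (f (sigma T t) - f s - (sigma T t - s) *\<^sub>R D) \<le> e' * \<bar>sigma T t - s\<bar>"
    using f e' unfolding has_delta_deriv_def by meson
  obtain d2 where d2: "d2 > 0"
    "\<And>s. s \<in> T \<Longrightarrow> \<bar>s - t\<bar> < d2 \<Longrightarrow> norm (g (sigma T t) - g s - (sigma T t - s) *\<^sub>R E) \<le> e' * \<bar>sigma T t - s\<bar>"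
    using g e' unfolding has_delta_deriv_def by meson
  obtain d3 where d3: "d3 > 0" "\<And>s. s \<in> T \<Longrightarrow> dist s t < d3 \<Longrightarrow> dist (g s) (g t) < e'"
    using has_delta_deriv_continuous[OF g t] e' unfolding continuous_within_eps_delta by meson
  have "norm (f (sigma T t) \<bullet> g (sigma T t) - f s \<bullet> g s - (sigma T t - s) *\<^sub>R (f (sigma T t) \<bullet> E + D \<bullet> g t))
      \<le> e * \<bar>sigma T t - s\<bar>"
    if s: "s \<in> T" "\<bar>s - t\<bar> < min d1 (min d2 d3)" for s
  proof -
    define p where "p = f (sigma T t) - f s - (sigma T t - s) *\<^sub>R D"
    define q where "q = g (sigma T t) - g s - (sigma T t - s) *\<^sub>R E"
    define A where "A = \<bar>sigma T t - s\<bar>"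
    have A: "A \<ge> 0" by (simp add: A_def)
    have p: "norm p \<le> e' * A" and q: "norm q \<le> e' * A" and gg: "norm (g s - g t) \<le> e'"
      using d1(2)[of s] d2(2)[of s] d3(2)[of s] s by (auto simp: p_def q_def A_def dist_norm)
    have gs: "norm (g s) \<le> norm (g t) + 1"
      using gg e'(2) norm_triangle_sub[of "g s" "g t"] by linarith
    have "f (sigma T t) \<bullet> g (sigma T t) - f s \<bullet> g s - (sigma T t - s) *\<^sub>R (f (sigma T t) \<bullet> E + D \<bullet> g t)
        = f (sigma T t) \<bullet> q + p \<bullet> g s + (sigma T t - s) * (D \<bullet> (g s - g t))"
      by (simp add: p_def q_def inner_diff_left inner_diff_right algebra_simps)
    moreover have "\<bar>f (sigma T t) \<bullet> q\<bar> \<le> norm (f (sigma T t)) * (e' * A)"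
      using Cauchy_Schwarz_ineq2 q by (meson mult_left_mono norm_ge_zero order_trans)
    moreover have "\<bar>p \<bullet> g s\<bar> \<le> (e' * A) * (norm (g t) + 1)"
      using Cauchy_Schwarz_ineq2[of p "g s"] mult_mono[OF p gs] A e' by (auto intro: order_trans)
    moreover have "\<bar>(sigma T t - s) * (D \<bullet> (g s - g t))\<bar> \<le> A * (norm D * e')"
      unfolding abs_mult A_def[symmetric]
      using Cauchy_Schwarz_ineq2[of D "g s - g t"] mult_left_mono[OF gg, of "norm D"] A
      by (intro mult_left_mono) auto
    ultimately have "\<bar>f (sigma T t) \<bullet> g (sigma T t) - f s \<bullet> g s - (sigma T t - s) *\<^sub>R (f (sigma T t) \<bullet> E + D \<bullet> g t)\<bar>
        \<le> norm (f (sigma T t)) * (e' * A) + (e' * A) * (norm (g t) + 1) + A * (norm D * e')"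
      by linarith
    also have "\<dots> = (e' * N) * A"
      by (simp add: N_def algebra_simps)
    also have "\<dots> \<le> e * A"
      using e' A by (intro mult_right_mono)
    finally show ?thesis by (simp add: A_def)
  qed
  then show "\<exists>d>0. \<forall>s\<in>T. \<bar>s - t\<bar> < d \<longrightarrow>
      norm (f (sigma T t) \<bullet> g (sigma T t) - f s \<bullet> g s - (sigma T t - s) *\<^sub>R (f (sigma T t) \<bullet> E + D \<bullet> g t))
        \<le> e * \<bar>sigma T t - s\<bar>"
    using d1(1) d2(1) d3(1) by (intro exI[of _ "min d1 (min d2 d3)"]) auto
qed

text \<open>Induction along \<open>T\<close>: for each slope \<open>e\<close> the bound \<open>norm (f t - f a) \<le> e * (t - a)\<close> holds up to
  some last point, which it passes by the derivative condition if the point is right-dense and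
  by the jump formula if it is right-scattered.\<close>

lemma has_delta_deriv_zero_constant:
  assumes f: "\<And>t. t \<in> kappa T \<Longrightarrow> has_delta_deriv T f 0 t" and t: "t \<in> T"
  shows "f t = f a"
proof -
  have cont: "continuous_on T f" using continuous_on_if_has_delta_deriv[of f "\<lambda>_. 0"] f by simp
  have bound: "norm (f t - f a) \<le> e * (t - a)" if e: "e > 0" for e
  proof -
    define P where "P s \<longleftrightarrow> norm (f s - f a) \<le> e * (s - a)" for s
    define S where "S = {r \<in> T. \<forall>s\<in>T. s \<le> r \<longrightarrow> P s}"
    have "a \<in> S"
      using a_in T_bounds(1) by (fastforce simp: S_def P_def)
    define c where "c = Sup S"
    have bdd: "bdd_above S" using T_bounds(2) by (intro bdd_aboveI[of _ b]) (auto simp: S_def)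
    have c: "c \<in> T" unfolding c_def using \<open>a \<in> S\<close> by (intro Sup_mem_T) (auto simp: S_def)
    have below: "P s" if "s \<in> T" "s < c" for s
      using that less_cSupD[of S s] \<open>a \<in> S\<close> unfolding c_def by (fastforce simp: S_def)
    have "P c"
    proof (cases "\<exists>s\<in>S. s = c")
      case True
      then show ?thesis by (auto simp: S_def)
    next
      case False
      have "\<exists>s\<in>T. c - r < s \<and> s < c" if "r > 0" for r
      proof -
        obtain s where s: "s \<in> S" "c - r < s"
          using less_cSupD[of S "c - r"] \<open>a \<in> S\<close> \<open>r > 0\<close> unfolding c_def by force
        moreover have "s \<le> c" "s \<noteq> c" using cSup_upper[OF s(1) bdd] False s(1) by (auto simp: c_def)
        ultimately show ?thesis by (intro bexI[of _ s]) (auto simp: S_def)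
      qed
      then have "c islimpt T \<inter> {..<c}"
        unfolding islimpt_approachable by (force simp: dist_real_def)
      then have nt: "at c within T \<inter> {..<c} \<noteq> bot"
        by (simp add: trivial_limit_within)
      have "((\<lambda>s. norm (f s - f a)) \<longlongrightarrow> norm (f c - f a)) (at c within T \<inter> {..<c})"
        using cont c by (intro tendsto_intros) (auto simp: continuous_on_def intro: tendsto_within_subset)
      moreover have "((\<lambda>s. e * (s - a)) \<longlongrightarrow> e * (c - a)) (at c within T \<inter> {..<c})"
        by (intro tendsto_intros)
      moreover have "eventually (\<lambda>s. norm (f s - f a) \<le> e * (s - a)) (at c within T \<inter> {..<c})"
        using below by (auto simp: P_def eventually_at intro!: exI[of _ 1])
      ultimately show ?thesis unfolding P_def using tendsto_le[OF nt] by blast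
    qed
    have "c = b"
    proof (rule ccontr)
      assume "c \<noteq> b"
      then have "c < b" using T_bounds(2)[OF c] by simp
      then have "c \<in> kappa T" using c by (simp add: kappa_iff)
      have "\<exists>r\<in>T. c < r \<and> (\<forall>s\<in>T. c < s \<longrightarrow> s \<le> r \<longrightarrow> P s)"
      proof (cases "sigma T c = c")
        case False
        have "f (sigma T c) = f c"
          using has_delta_deriv_jump[OF f[OF \<open>c \<in> kappa T\<close>] c] by simp
        moreover have "c < sigma T c" using False sigma_ge[of c] by simp
        ultimately have "P (sigma T c)"
          using \<open>P c\<close> e unfolding P_def by (smt (verit) mult_left_mono)
        then show ?thesis using sigma_in[OF c] sigma_le[of _ c] \<open>c < sigma T c\<close>
          by (intro bexI[of _ "sigma T c"]) (auto dest: order_antisym)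
      next
        case True
        obtain d where d: "d > 0" "\<And>s. s \<in> T \<Longrightarrow> \<bar>s - c\<bar> < d \<Longrightarrow> norm (f c - f s) \<le> e * \<bar>c - s\<bar>"
          using f[OF \<open>c \<in> kappa T\<close>] e True unfolding has_delta_deriv_def by auto
        obtain r where r: "r \<in> T" "c < r" "r < c + d"
          using right_dense_approx[OF \<open>c < b\<close> True, of "c + d"] d(1) by auto
        have "P s" if "s \<in> T" "c < s" "s \<le> r" for s
        proof -
          have "norm (f c - f s) \<le> e * (s - c)" using d(2)[of s] that r by auto
          then have "norm (f s - f a) \<le> e * (s - c) + e * (c - a)"
            using \<open>P c\<close> norm_triangle_ineq[of "f s - f c" "f c - f a"]
            by (simp add: P_def norm_minus_commute)
          then show ?thesis by (simp add: P_def algebra_simps)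
        qed
        then show ?thesis using r by blast
      qed
      then obtain r where r: "r \<in> T" "c < r" "\<And>s. s \<in> T \<Longrightarrow> c < s \<Longrightarrow> s \<le> r \<Longrightarrow> P s" by blast
      have "P s" if "s \<in> T" "s \<le> r" for s
        using below[of s] \<open>P c\<close> r(3)[of s] that by (cases s c rule: linorder_cases) auto
      then have "r \<in> S" using r(1) by (simp add: S_def)
      then show False using cSup_upper[OF _ bdd] \<open>c < r\<close> by (simp add: c_def not_le[symmetric])
    qed
    then have "P t" using below[OF t] \<open>P c\<close> T_bounds(2)[OF t] by (cases "t < b") auto
    then show ?thesis by (simp add: P_def)
  qed
  have "norm (f t - f a) \<le> 0 + e" if "e > 0" for e
  proof -
    have "t - a \<ge> 0" using T_bounds(1)[OF t] by simp
    then have "norm (f t - f a) \<le> e / (t - a + 1) * (t - a)" using \<open>e > 0\<close> by (intro bound) simp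
    also have "\<dots> \<le> e" using \<open>e > 0\<close> \<open>t - a \<ge> 0\<close> by (simp add: field_simps)
    finally show ?thesis by simp
  qed
  then have "norm (f t - f a) \<le> 0" by (rule field_le_epsilon)
  then show ?thesis by simp
qed

subsection \<open>The fundamental theorem of calculus\<close>

text \<open>At a right-scattered point the integrand is constant up to the jump; at a right-dense point
  it is close to its value on the points of \<open>T\<close> near by, and the floor stays among them.\<close>

lemma has_delta_deriv_integral:
  fixes f :: "real \<Rightarrow> 'a::banach"
  assumes f: "f \<in> Crd T" and t: "t \<in> kappa T"
  shows "has_delta_deriv T (\<lambda>t. c + integral {a..t} (\<lambda>s. f (ts_floor T s))) (f t) t"
proof -
  let ?g = "\<lambda>s. f (ts_floor T s)"
  have tT: "t \<in> T" using t kappa_sub by auto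
  have int: "?g integrable_on {s..r}" if "a \<le> s" "r \<le> b" for s r
    using Crd_integrable[OF f] that by (auto intro: integrable_subinterval_real)
  have split: "integral {a..r} ?g - integral {a..s} ?g = integral {s..r} ?g" if "a \<le> s" "s \<le> r" "r \<le> b" for s r
    using Henstock_Kurzweil_Integration.integral_combine[OF that(1,2) int] that by (simp add: algebra_simps)
  have est: "norm (integral {s..r} ?g - (r - s) *\<^sub>R v) \<le> e * (r - s)"
    if "a \<le> s" "s \<le> r" "r \<le> b" "\<And>q. s \<le> q \<Longrightarrow> q \<le> r \<Longrightarrow> norm (?g q - v) \<le> e" for s r v e
  proof -
    have "norm (integral {s..r} (\<lambda>q. ?g q - v)) \<le> integral {s..r} (\<lambda>_. e)"
      using that by (intro integral_norm_bound_integral integrable_diff int) auto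
    then have "norm (integral {s..r} (\<lambda>q. ?g q - v)) \<le> e * (r - s)"
      using that by (simp add: mult.commute)
    moreover have "integral {s..r} (\<lambda>q. ?g q - v) = integral {s..r} ?g - (r - s) *\<^sub>R v"
      using that by (subst integral_diff[OF int]) auto
    ultimately show ?thesis by simp
  qed
  show ?thesis unfolding has_delta_deriv_def add_diff_cancel_left
  proof (intro allI impI)
    fix e :: real assume e: "e > 0"
    show "\<exists>d>0. \<forall>s\<in>T. \<bar>s - t\<bar> < d \<longrightarrow>
        norm (integral {a..sigma T t} ?g - integral {a..s} ?g - (sigma T t - s) *\<^sub>R f t) \<le> e * \<bar>sigma T t - s\<bar>"
    proof (cases "sigma T t = t")
      case True
      obtain d where d: "d > 0" "\<And>s. s \<in> T \<Longrightarrow> dist s t < d \<Longrightarrow> dist (f s) (f t) < e"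
        using Crd_continuous[OF f tT True] e unfolding continuous_within_eps_delta by meson
      have "norm (integral {a..t} ?g - integral {a..s} ?g - (t - s) *\<^sub>R f t) \<le> e * \<bar>t - s\<bar>"
        if s: "s \<in> T" "\<bar>s - t\<bar> < d" for s
      proof -
        have near: "norm (?g q - f t) \<le> e" if "min s t \<le> q" "q \<le> max s t" for q
        proof -
          have "min s t \<in> T" using s tT by (simp add: min_def)
          then have "a \<le> q" "min s t \<le> ts_floor T q" "ts_floor T q \<le> q"
            using that T_bounds(1) le_ts_floor ts_floor_le by (meson order_trans)+
          then have "dist (ts_floor T q) t < d"
            using that s by (auto simp: dist_real_def)
          then show ?thesis
            using d(2) ts_floor_in[OF \<open>a \<le> q\<close>] by (auto simp: dist_norm less_imp_le)
        qed
        show ?thesis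
        proof (cases "s \<le> t")
          case True
          then show ?thesis
            using est[of s t "f t" e] near split[of s t] T_bounds s tT by auto
        next
          case False
          then have "norm (integral {t..s} ?g - (s - t) *\<^sub>R f t) \<le> e * (s - t)"
            using est[of t s "f t" e] near T_bounds s tT by auto
          moreover have "integral {a..t} ?g - integral {a..s} ?g - (t - s) *\<^sub>R f t
              = - (integral {t..s} ?g - (s - t) *\<^sub>R f t)"
            using split[of t s] False T_bounds s tT by (simp add: algebra_simps)
          ultimately show ?thesis using False by (simp only: norm_minus_cancel) simp
        qed
      qed
      then show ?thesis using d(1) True by auto
    next
      case False
      define M where "M = sigma T t - t"
      have M: "M > 0" using False sigma_ge[of t] by (simp add: M_def)
      obtain B where B: "B > 0" "\<And>t. t \<in> T \<Longrightarrow> norm (f t) \<le> B"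
        using Crd_bounded[OF f] by blast
      have jump: "integral {t..sigma T t} ?g = M *\<^sub>R f t"
      proof -
        have "integral {t..sigma T t} ?g = integral {t..sigma T t} (\<lambda>_. f t)"
          using ts_floor_gap[OF tT] by (intro integral_spike[of "{sigma T t}"]) auto
        then show ?thesis using sigma_ge[of t] by (simp add: M_def)
      qed
      define d where "d = min M (e * M / (2 * B))"
      have "d > 0" using M B e by (simp add: d_def)
      have "norm (integral {a..sigma T t} ?g - integral {a..s} ?g - (sigma T t - s) *\<^sub>R f t) \<le> e * \<bar>sigma T t - s\<bar>"
        if s: "s \<in> T" "\<bar>s - t\<bar> < d" for s
      proof -
        have "s \<le> t"
          using sigma_le[OF s(1), of t] s(2) by (cases "s \<le> t") (auto simp: d_def M_def)
        have "norm (?g q - f t) \<le> 2 * B" if "s \<le> q" "q \<le> t" for q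
          using B(2)[OF ts_floor_in, of q] B(2)[OF tT] T_bounds(1)[OF s(1)] that
            norm_triangle_ineq4[of "?g q" "f t"] by linarith
        then have "norm (integral {s..t} ?g - (t - s) *\<^sub>R f t) \<le> 2 * B * (t - s)"
          using \<open>s \<le> t\<close> T_bounds s tT by (intro est) auto
        also have "\<dots> \<le> 2 * B * (e * M / (2 * B))"
          using s(2) B \<open>s \<le> t\<close> by (intro mult_left_mono) (auto simp: d_def)
        also have "\<dots> = e * M" using B by simp
        also have "\<dots> \<le> e * \<bar>sigma T t - s\<bar>"
          using e \<open>s \<le> t\<close> by (intro mult_left_mono) (auto simp: M_def)
        finally have "norm (integral {s..t} ?g - (t - s) *\<^sub>R f t) \<le> e * \<bar>sigma T t - s\<bar>" .
        moreover have "integral {a..sigma T t} ?g - integral {a..s} ?g - (sigma T t - s) *\<^sub>R f t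
            = integral {s..t} ?g - (t - s) *\<^sub>R f t"
          using split[of s t] split[of t "sigma T t"] jump T_bounds s tT \<open>s \<le> t\<close> sigma_ge[of t] sigma_in[OF tT]
          by (simp add: M_def algebra_simps)
        ultimately show ?thesis by simp
      qed
      then show ?thesis using \<open>d > 0\<close> by blast
    qed
  qed
qed

lemma delta_antiderivative_eq_integral:
  fixes f :: "real \<Rightarrow> 'a::banach"
  assumes f: "f \<in> Crd T" and F: "\<And>t. t \<in> kappa T \<Longrightarrow> has_delta_deriv T F (f t) t" and t: "t \<in> T"
  shows "F t = F a + integral {a..t} (\<lambda>s. f (ts_floor T s))"
proof -
  let ?G = "\<lambda>t. F a + integral {a..t} (\<lambda>s. f (ts_floor T s))"
  have "F t - ?G t = F a - ?G a"
  proof (rule has_delta_deriv_zero_constant[where f = "\<lambda>t. F t - ?G t", OF _ t])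
    show "has_delta_deriv T (\<lambda>t. F t - ?G t) 0 t" if "t \<in> kappa T" for t
      using has_delta_deriv_diff[OF F[OF that] has_delta_deriv_integral[OF f that, of "F a"]] by simp
  qed
  then show ?thesis by simp
qed

lemma delta_integral_eq:
  assumes F: "\<And>t. t \<in> kappa T \<Longrightarrow> has_delta_deriv T F (f t) t" and cd: "c \<in> T" "d \<in> T"
  shows "delta_integral T c d f = F d - F c"
  unfolding delta_integral_def
proof (rule the_equality)
  show "\<exists>G. (\<forall>t\<in>kappa T. has_delta_deriv T G (f t) t) \<and> F d - F c = G d - G c"
    using F by blast
next
  fix I assume "\<exists>G. (\<forall>t\<in>kappa T. has_delta_deriv T G (f t) t) \<and> I = G d - G c"
  then obtain G where G: "\<And>t. t \<in> kappa T \<Longrightarrow> has_delta_deriv T G (f t) t" "I = G d - G c" by blast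
  have "G t - F t = G a - F a" if "t \<in> T" for t
    using has_delta_deriv_zero_constant[of "\<lambda>t. G t - F t", OF _ that] has_delta_deriv_diff[OF G(1) F] by simp
  from this[OF cd(1)] this[OF cd(2)] have "G d - F d = G c - F c" by simp
  then have "G d - G c = F d - F c" by (simp add: algebra_simps)
  then show "I = F d - F c" using G(2) by simp
qed

end

section \<open>Uniformity along a trajectory\<close>

text \<open>Since the distances to \<open>p\<close> at least halve, each \<open>t k\<close> is isolated in the closed set formed by \<open>p\<close>
  and all \<open>t k\<close>; the data extended by their limit \<open>0\<close> at \<open>p\<close> are therefore continuous on that set, and Tietze's
  theorem extends them.\<close>

lemma interpolate_null_sequence:
  fixes t :: "nat \<Rightarrow> real" and v :: "nat \<Rightarrow> 'a::euclidean_space"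
  assumes ne: "\<And>k. t k \<noteq> p" and dec: "\<And>k. 2 * \<bar>t (Suc k) - p\<bar> < \<bar>t k - p\<bar>" and v: "v \<longlonglongrightarrow> 0"
  obtains c where "continuous_on UNIV c" "\<And>k. c (t k) = v k"
proof -
  define d where "d k = \<bar>t k - p\<bar>" for k
  have d_pos: "d k > 0" for k using ne[of k] by (simp add: d_def)
  have dec': "2 * d k < d j" if "j < k" for j k
    using that
  proof (induction k)
    case (Suc k)
    have "2 * d (Suc k) < d k" using dec by (simp add: d_def)
    then show ?case
      using Suc d_pos[of k] by (cases "j = k") auto
  qed simp
  have sep: "d k / 2 \<le> \<bar>t j - t k\<bar>" if "j \<noteq> k" for j k
  proof -
    have "\<bar>d j - d k\<bar> \<le> \<bar>t j - t k\<bar>" by (simp add: d_def)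
    then show ?thesis
      using dec'[of j k] dec'[of k j] that d_pos[of j] d_pos[of k] by (cases "j < k") auto
  qed
  have "inj t"
    using sep d_pos by (intro injI) (metis abs_zero diff_self half_gt_zero_iff not_le)
  have "d k \<le> d 0 * (1 / 2) ^ k" for k
  proof (induction k)
    case (Suc k)
    then show ?case using dec'[of k "Suc k"] by simp
  qed simp
  moreover have "(\<lambda>k. d 0 * (1 / 2) ^ k) \<longlonglongrightarrow> 0"
    by (intro tendsto_mult_right_zero LIMSEQ_realpow_zero) auto
  ultimately have "d \<longlonglongrightarrow> 0"
    using d_pos by (intro tendsto_sandwich[of "\<lambda>_. 0" d sequentially "\<lambda>k. d 0 * (1 / 2) ^ k"])
      (auto simp: less_imp_le)
  then have "t \<longlonglongrightarrow> p"
    unfolding d_def by (simp add: LIM_zero_iff tendsto_rabs_zero_iff)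
  then have closed: "closed (insert p (range t))"
    using compact_sequence_with_limit compact_imp_closed by blast
  define c0 where "c0 x = (if x = p then 0 else v (inv t x))" for x
  have c0_t [simp]: "c0 (t k) = v k" for k using ne[of k] \<open>inj t\<close> by (simp add: c0_def)
  have c0_p [simp]: "c0 p = 0" by (simp add: c0_def)
  have c0_cont: "continuous_on (insert p (range t)) c0"
    unfolding continuous_on_iff
  proof (intro ballI allI impI)
    fix x and e :: real assume x: "x \<in> insert p (range t)" and e: "e > 0"
    show "\<exists>r>0. \<forall>x'\<in>insert p (range t). dist x' x < r \<longrightarrow> dist (c0 x') (c0 x) < e"
    proof (cases "x = p")
      case True
      obtain N where N: "\<And>k. k \<ge> N \<Longrightarrow> norm (v k) < e"
        using v e unfolding LIMSEQ_iff by auto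
      have "norm (v k) < e" if "d k < d N" for k
        using N[of k] dec'[of k N] d_pos[of N] that by (cases "k \<ge> N") auto
      then show ?thesis
        using True e d_pos[of N] by (intro exI[of _ "d N"]) (auto simp: dist_real_def d_def)
    next
      case False
      then obtain k where k: "x = t k" using x by auto
      have "x' = x" if "x' \<in> insert p (range t)" "dist x' x < d k / 2" for x'
      proof (cases "x' = p")
        case True
        then show ?thesis using that d_pos[of k] k by (auto simp: d_def dist_real_def abs_minus_commute)
      next
        case False
        then obtain j where "x' = t j" using \<open>x' \<in> insert p (range t)\<close> by auto
        then show ?thesis using sep[of j k] that k by (cases "j = k") (auto simp: dist_real_def)
      qed
      then have "\<forall>x'\<in>insert p (range t). dist x' x < d k / 2 \<longrightarrow> dist (c0 x') (c0 x) < e"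
        using e by (metis dist_self)
      then show ?thesis using d_pos[of k] half_gt_zero by blast
    qed
  qed
  obtain B where B: "B > 0" "\<And>k. norm (v k) \<le> B"
    using convergent_imp_Bseq[OF convergentI[OF v]] unfolding Bseq_def by auto
  have bound: "norm (c0 x) \<le> B" if "x \<in> insert p (range t)" for x
    using that B by (auto simp: less_imp_le)
  have "closedin (top_of_set UNIV) (insert p (range t))" using closed by simp
  then obtain c where c: "continuous_on UNIV c" "\<And>x. x \<in> insert p (range t) \<Longrightarrow> c x = c0 x"
    by (rule Tietze[OF c0_cont _ less_imp_le[OF B(1)] bound]) (assumption | rule that)+
  show thesis
    using that[OF c(1)] c(2) by simp
qed

context compact_time_scale
begin

text \<open>Pointwise continuity in \<open>(x, u)\<close> together with rd-continuity along all trajectories gives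
  continuity that is uniform in time near a given trajectory.  Otherwise there are times
  \<open>t k\<close>, converging to some \<open>p\<close> strictly from one side, with perturbations \<open>v k\<close> tending to zero
  which change the value of \<open>G\<close> by at least \<open>e\<close>.  A continuous perturbation that takes the values \<open>v k\<close>
  at \<open>t k\<close> for even \<open>k\<close> and vanishes there for odd \<open>k\<close> gives a trajectory along which \<open>G\<close> must have a
  one-sided limit at \<open>p\<close>; the odd times identify this limit with the limit along
  the given trajectory, and the even times keep it away from that.\<close>

lemma rd_along_uniform:
  fixes G :: "real \<Rightarrow> 'x::euclidean_space \<Rightarrow> 'u::euclidean_space \<Rightarrow> 'c::real_normed_vector"
  assumes G: "rd_along T G" and cont: "\<And>t. t \<in> T \<Longrightarrow> continuous_on UNIV (\<lambda>(x, u). G t x u)"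
    and x: "continuous_on T x" and u: "u \<in> Crd T" and e: "e > 0"
  obtains r where "r > 0" "\<And>t x' u'. t \<in> T \<Longrightarrow> norm (x' - x t) < r \<Longrightarrow> norm (u' - u t) < r \<Longrightarrow>
    norm (G t x' u' - G t (x t) (u t)) < e"
proof -
  define bad where "bad r t \<longleftrightarrow> (\<exists>z w. norm z < r \<and> norm w < r \<and>
    e \<le> norm (G t (x t + z) (u t + w) - G t (x t) (u t)))" for r t
  have bad_mono: "bad r' t" if "bad r t" "r \<le> r'" for r r' t
    using that unfolding bad_def by (meson less_le_trans)
  have "\<exists>r>0. \<forall>t\<in>T. \<not> bad r t"
  proof (rule ccontr)
    assume "\<not> ?thesis"
    then have ex_bad: "\<exists>t\<in>T. bad r t" if "r > 0" for r using that by blast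
    then have "\<forall>k. \<exists>t. t \<in> T \<and> bad (inverse (real (Suc k))) t" by (meson inverse_positive_iff_positive of_nat_0_less_iff zero_less_Suc)
    then obtain s where s: "\<And>k. s k \<in> T" "\<And>k. bad (inverse (real (Suc k))) (s k)" by metis
    have "compact T" using closed_T T_sub compact_eq_bounded_closed bounded_subset bounded_closed_interval by blast
    then obtain p q where p: "p \<in> T" "strict_mono q" "(s \<circ> q) \<longlonglongrightarrow> p"
      using s(1) unfolding compact_def by metis
    have acc: "\<exists>t\<in>T. \<bar>t - p\<bar> < \<delta> \<and> bad r t" if "r > 0" "\<delta> > 0" for r \<delta>
    proof -
      obtain N where N: "\<And>k. k \<ge> N \<Longrightarrow> \<bar>s (q k) - p\<bar> < \<delta>"
        using p(3) \<open>\<delta> > 0\<close> unfolding LIMSEQ_iff by auto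
      obtain M where M: "inverse (real (Suc M)) < r" using \<open>r > 0\<close> reals_Archimedean by blast
      define k where "k = max N M"
      have "M \<le> q k" using seq_suble[OF p(2), of k] by (simp add: k_def)
      then have "inverse (real (Suc (q k))) \<le> inverse (real (Suc M))"
        by (intro le_imp_inverse_le) auto
      then have "bad r (s (q k))" using bad_mono[OF s(2)[of "q k"], of r] M by linarith
      moreover have "\<bar>s (q k) - p\<bar> < \<delta>" by (rule N) (simp add: k_def)
      ultimately show ?thesis using s(1) by blast
    qed
    obtain r0 where r0: "r0 > 0" "\<not> bad r0 p"
    proof -
      have "isCont (\<lambda>(x, u). G p x u) (x p, u p)"
        using cont[OF p(1)] continuous_on_eq_continuous_at open_UNIV by blast
      then obtain r where r: "r > 0" "\<And>y. dist y (x p, u p) < r \<Longrightarrow>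
          dist ((\<lambda>(x, u). G p x u) y) (G p (x p) (u p)) < e"
        using e unfolding continuous_at_eps_delta by (metis case_prod_conv)
      have "\<not> bad (r / 2) p"
        unfolding bad_def
      proof clarify
        fix z w assume zw: "norm z < r / 2" "norm w < r / 2"
          and *: "e \<le> norm (G p (x p + z) (u p + w) - G p (x p) (u p))"
        have "dist (x p + z, u p + w) (x p, u p) \<le> norm z + norm w"
          using norm_Pair_le[of z w] by (simp add: dist_norm)
        then have "dist (G p (x p + z) (u p + w)) (G p (x p) (u p)) < e"
          using r(2)[of "(x p + z, u p + w)"] zw by simp
        then show False using * by (simp add: dist_norm)
      qed
      then show thesis using that[of "r / 2"] r by simp
    qed
    have side: "\<exists>S. S \<subseteq> T \<and> p \<notin> S \<and> (S = T \<inter> {..<p} \<or> S = T \<inter> {p<..}) \<and>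
        (\<forall>r>0. \<forall>\<delta>>0. \<exists>t\<in>S. \<bar>t - p\<bar> < \<delta> \<and> bad r t)"
    proof (rule ccontr)
      assume no: "\<not> ?thesis"
      obtain r1 \<delta>1 where 1: "r1 > 0" "\<delta>1 > 0" "\<And>t. t \<in> T \<Longrightarrow> t < p \<Longrightarrow> \<bar>t - p\<bar> < \<delta>1 \<Longrightarrow> \<not> bad r1 t"
        using no[unfolded not_ex, rule_format, of "T \<inter> {..<p}"] by auto
      obtain r2 \<delta>2 where 2: "r2 > 0" "\<delta>2 > 0" "\<And>t. t \<in> T \<Longrightarrow> p < t \<Longrightarrow> \<bar>t - p\<bar> < \<delta>2 \<Longrightarrow> \<not> bad r2 t"
        using no[unfolded not_ex, rule_format, of "T \<inter> {p<..}"] by auto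
      obtain t where t: "t \<in> T" "\<bar>t - p\<bar> < min \<delta>1 \<delta>2" "bad (min r0 (min r1 r2)) t"
        using acc[of "min r0 (min r1 r2)" "min \<delta>1 \<delta>2"] r0(1) 1 2 by auto
      have "bad r0 t" "bad r1 t" "bad r2 t"
        using bad_mono[OF t(3)] by simp_all
      then show False
        using 1(3)[OF t(1)] 2(3)[OF t(1)] r0(2) t(2) by (cases t p rule: linorder_cases) auto
    qed
    then obtain S where S: "S \<subseteq> T" "p \<notin> S" "S = T \<inter> {..<p} \<or> S = T \<inter> {p<..}"
      "\<And>r \<delta>. r > 0 \<Longrightarrow> \<delta> > 0 \<Longrightarrow> \<exists>t\<in>S. \<bar>t - p\<bar> < \<delta> \<and> bad r t" by blast
    obtain t where t: "\<And>k. t k \<in> S \<and> bad (inverse (real (Suc k))) (t k)"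
      "\<And>k. 2 * \<bar>t (Suc k) - p\<bar> < \<bar>t k - p\<bar>"
    proof -
      have "\<exists>t. \<forall>k. (t k \<in> S \<and> bad (inverse (real (Suc k))) (t k)) \<and> 2 * \<bar>t (Suc k) - p\<bar> < \<bar>t k - p\<bar>"
      proof (rule dependent_nat_choice)
        show "\<exists>y. y \<in> S \<and> bad (inverse (real (Suc 0))) y"
          using S(4)[of 1 1] by auto
        fix y k assume "y \<in> S \<and> bad (inverse (real (Suc k))) y"
        then have "\<bar>y - p\<bar> / 2 > 0" using S(2) by auto
        moreover have "inverse (real (Suc (Suc k))) > 0" by simp
        ultimately obtain y' where "y' \<in> S" "\<bar>y' - p\<bar> < \<bar>y - p\<bar> / 2" "bad (inverse (real (Suc (Suc k)))) y'"
          using S(4) by blast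
        then show "\<exists>y'. (y' \<in> S \<and> bad (inverse (real (Suc (Suc k)))) y') \<and> 2 * \<bar>y' - p\<bar> < \<bar>y - p\<bar>"
          by (intro exI[of _ y']) auto
      qed
      then show thesis using that by blast
    qed
    obtain z w where zw: "\<And>k. norm (z k) < inverse (real (Suc k))" "\<And>k. norm (w k) < inverse (real (Suc k))"
      "\<And>k. e \<le> norm (G (t k) (x (t k) + z k) (u (t k) + w k) - G (t k) (x (t k)) (u (t k)))"
      using t(1) unfolding bad_def by metis
    define v where "v k = (if even k then (z k, w k) else 0)" for k
    have le: "norm (v k) \<le> 2 * inverse (real (Suc k))" for k
      using norm_Pair_le[of "z k" "w k"] zw(1,2)[of k] unfolding v_def by auto
    have "(\<lambda>k. 2 * inverse (real (Suc k))) \<longlonglongrightarrow> 0"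
      using tendsto_mult_right_zero[OF LIMSEQ_inverse_real_of_nat] by blast
    then have v: "v \<longlonglongrightarrow> 0"
      by (rule Lim_null_comparison[OF always_eventually[OF allI[OF le]]])
    have ne: "t k \<noteq> p" for k using t(1) S(2) by metis
    obtain c where c: "continuous_on UNIV c" "\<And>k. c (t k) = v k"
      using interpolate_null_sequence[of t p v, OF ne t(2) v] by blast
    have cT: "continuous_on T c" using c(1) continuous_on_subset by blast
    define g where "g t = G t (x t + fst (c t)) (u t + snd (c t))" for t
    define h where "h t = G t (x t) (u t)" for t
    have "continuous_on T (\<lambda>t. x t + fst (c t))"
      by (intro continuous_intros x cT)
    moreover have "(\<lambda>t. u t + snd (c t)) \<in> Crd T"
      by (intro Crd_add u continuous_imp_Crd continuous_intros cT)
    ultimately have "g \<in> Crd T"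
      using G unfolding rd_along_def g_def by blast
    moreover have "h \<in> Crd T" unfolding h_def
      using G x u unfolding rd_along_def by blast
    ultimately have "(\<lambda>t. g t + (-1) *\<^sub>R h t) \<in> Crd T"
      by (intro Crd_add Crd_scaleR Crd_const)
    then obtain l where l: "((\<lambda>t. g t + (-1) *\<^sub>R h t) \<longlongrightarrow> l) (at p within S)"
      using S(3) Crd_left_limit[OF _ p(1)] Crd_right_limit[OF _ p(1)] by blast
    have "t \<longlonglongrightarrow> p"
    proof (rule LIM_zero_cancel, rule Lim_null_comparison)
      have "\<bar>t k - p\<bar> \<le> \<bar>t 0 - p\<bar> * (1 / 2) ^ k" for k
      proof (induction k)
        case (Suc k)
        then show ?case using t(2)[of k] by simp
      qed simp
      then show "eventually (\<lambda>k. norm (t k - p) \<le> \<bar>t 0 - p\<bar> * (1 / 2) ^ k) sequentially" by simp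
      show "(\<lambda>k. \<bar>t 0 - p\<bar> * (1 / 2) ^ k) \<longlonglongrightarrow> 0"
        by (intro tendsto_mult_right_zero LIMSEQ_realpow_zero) auto
    qed
    then have "filterlim t (at p within S) sequentially"
      using t(1) ne by (simp add: filterlim_at)
    with l have lim: "(\<lambda>k. g (t k) + (-1) *\<^sub>R h (t k)) \<longlonglongrightarrow> l"
      by (rule filterlim_compose)
    have "strict_mono (\<lambda>k::nat. 2 * k)" "strict_mono (\<lambda>k::nat. 2 * k + 1)"
      by (auto simp: strict_mono_def)
    note sub = LIMSEQ_subseq_LIMSEQ[OF lim this(1)] LIMSEQ_subseq_LIMSEQ[OF lim this(2)]
    have "g (t (2 * k + 1)) + (-1) *\<^sub>R h (t (2 * k + 1)) = 0" for k
      by (simp add: g_def h_def c(2) v_def)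
    then have "l = 0"
      using sub(2) by (simp add: o_def LIMSEQ_const_iff)
    moreover have "e \<le> norm (g (t (2 * k)) + (-1) *\<^sub>R h (t (2 * k)))" for k
      using zw(3)[of "2 * k"] by (simp add: g_def h_def c(2) v_def)
    then have "e \<le> norm l"
      by (intro Lim_bounded2[OF tendsto_norm[OF sub(1)]]) (auto simp: o_def)
    ultimately show False using e by simp
  qed
  then obtain r where r: "r > 0" "\<And>t. t \<in> T \<Longrightarrow> \<not> bad r t" by blast
  have "norm (G t x' u' - G t (x t) (u t)) < e" if "t \<in> T" "norm (x' - x t) < r" "norm (u' - u t) < r" for t x' u'
    using r(2)[OF that(1)] that(2,3) unfolding bad_def not_ex
    by (elim allE[of _ "x' - x t"] allE[of _ "u' - u t"]) (auto simp: not_le)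
  then show thesis using that r(1) by blast
qed

end

section \<open>Variations of a controlled trajectory\<close>

lemma linear_Basis_expansion:
  fixes A :: "'a::euclidean_space \<Rightarrow> 'b::real_vector"
  assumes "linear A"
  shows "A h = (\<Sum>i\<in>Basis. (h \<bullet> i) *\<^sub>R A i)"
proof -
  have "A h = A (\<Sum>i\<in>Basis. (h \<bullet> i) *\<^sub>R i)" by (simp only: euclidean_representation)
  then show ?thesis by (simp add: linear_sum[OF assms] linear_scale[OF assms])
qed

lemma norm_linear_le_Basis:
  fixes A :: "'a::euclidean_space \<Rightarrow> 'b::real_normed_vector"
  assumes A: "linear A" and c: "\<And>i. i \<in> Basis \<Longrightarrow> norm (A i) \<le> c"
  shows "norm (A h) \<le> real DIM('a) * c * norm h"
proof -
  have "A h = (\<Sum>i\<in>Basis. (h \<bullet> i) *\<^sub>R A i)"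
    by (rule linear_Basis_expansion[OF A])
  also have "norm \<dots> \<le> (\<Sum>i\<in>(Basis::'a set). norm h * c)"
    using c by (intro sum_norm_le) (auto intro!: mult_mono Basis_le_norm)
  finally show ?thesis by (simp add: mult_ac)
qed

text \<open>A control system together with one trajectory \<open>(xs, us)\<close> of it, about which everything is
  linearised; \<open>DF t x u\<close> is the derivative of \<open>F t\<close> in \<open>(x, u)\<close>.\<close>

locale control_system = compact_time_scale T a b
  for T :: "real set" and a b :: real +
  fixes F :: "real \<Rightarrow> 'x::euclidean_space \<Rightarrow> 'u::euclidean_space \<Rightarrow> 'x"
    and DF :: "real \<Rightarrow> 'x \<Rightarrow> 'u \<Rightarrow> 'x \<times> 'u \<Rightarrow> 'x"
    and xs :: "real \<Rightarrow> 'x" and us :: "real \<Rightarrow> 'u"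
  assumes F_rd: "rd_along T F"
    and DF_rd: "\<And>h. rd_along T (\<lambda>t x u. DF t x u h)"
    and F_deriv: "\<And>t x u. t \<in> T \<Longrightarrow> ((\<lambda>(x, u). F t x u) has_derivative DF t x u) (at (x, u))"
    and DF_cont: "\<And>t h. t \<in> T \<Longrightarrow> continuous_on UNIV (\<lambda>(x, u). DF t x u h)"
    and us: "us \<in> Crd T"
    and xs: "\<And>t. t \<in> kappa T \<Longrightarrow> has_delta_deriv T xs (F t (xs t) (us t)) t"
begin

definition Lin :: "real \<Rightarrow> 'x \<times> 'u \<Rightarrow> 'x" where
  "Lin t = DF t (xs t) (us t)"

lemma xs_cont: "continuous_on T xs"
  using xs by (rule continuous_on_if_has_delta_deriv)

lemma DF_linear: "t \<in> T \<Longrightarrow> linear (DF t x u)"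
  using F_deriv has_derivative_linear by blast

lemma Lin_linear: "t \<in> T \<Longrightarrow> linear (Lin t)"
  unfolding Lin_def by (rule DF_linear)

lemma F_traj_Crd: "continuous_on T x \<Longrightarrow> u \<in> Crd T \<Longrightarrow> (\<lambda>t. F t (x t) (u t)) \<in> Crd T"
  using F_rd unfolding rd_along_def by blast

lemma Lin_Crd:
  assumes "z \<in> Crd T"
  shows "(\<lambda>t. Lin t (z t)) \<in> Crd T"
proof -
  have "(\<lambda>t. Lin t i) \<in> Crd T" for i
    using DF_rd[of i] xs_cont us unfolding rd_along_def Lin_def by blast
  then have "(\<lambda>t. \<Sum>i\<in>Basis. (z t \<bullet> i) *\<^sub>R Lin t i) \<in> Crd T"
    using assms by (intro Crd_sum Crd_scaleR Crd_inner Crd_const)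
  moreover have "(\<Sum>i\<in>Basis. (z t \<bullet> i) *\<^sub>R Lin t i) = Lin t (z t)" if "t \<in> T" for t
    by (rule linear_Basis_expansion[OF Lin_linear[OF that], symmetric])
  ultimately show ?thesis by (subst Crd_cong[symmetric])
qed

lemma Lin_bounded:
  obtains M where "M > 0" "\<And>t h. t \<in> T \<Longrightarrow> norm (Lin t h) \<le> M * norm h"
proof -
  have "\<exists>B>0. \<forall>t\<in>T. norm (Lin t i) \<le> B" for i
    using Crd_bounded[OF Lin_Crd[OF Crd_const[of i]]] by metis
  then obtain B where B: "\<And>i. B i > 0" "\<And>i t. t \<in> T \<Longrightarrow> norm (Lin t i) \<le> B i" by metis
  define c where "c = Max (B ` Basis)"
  have c: "B i \<le> c" if "i \<in> Basis" for i using that by (simp add: c_def)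
  have "c > 0" using B(1) c by (metis SOME_Basis less_le_trans)
  have "norm (Lin t h) \<le> real DIM('x \<times> 'u) * c * norm h" if "t \<in> T" for t h
    using norm_linear_le_Basis[OF Lin_linear[OF that]] B(2)[OF that] c by (meson order_trans)
  moreover have "real DIM('x \<times> 'u) * c > 0" using \<open>c > 0\<close> DIM_positive[where 'a = "'x \<times> 'u"]
    by (metis mult_pos_pos of_nat_0_less_iff)
  ultimately show thesis using that by blast
qed

text \<open>Along the trajectory \<^term>\<open>F\<close> is strictly differentiable, uniformly in time: the mean value
  inequality for \<^term>\<open>F t x u - Lin t (x, u)\<close>, whose derivative is uniformly small in a tube.
  This one estimate serves both as a Lipschitz bound and as a linearisation.\<close>

lemma F_strict_derivative:
  assumes e: "e > 0"
  obtains r where "r > 0"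
    "\<And>t x1 u1 x2 u2. t \<in> T \<Longrightarrow> norm x1 < r \<Longrightarrow> norm u1 < r \<Longrightarrow> norm x2 < r \<Longrightarrow> norm u2 < r \<Longrightarrow>
      norm (F t (xs t + x1) (us t + u1) - F t (xs t + x2) (us t + u2) - Lin t (x1 - x2, u1 - u2))
        \<le> e * norm (x1 - x2, u1 - u2)"
proof -
  define n where "n = real DIM('x \<times> 'u)"
  have n: "n > 0" unfolding n_def using DIM_positive[where 'a = "'x \<times> 'u"] by (metis of_nat_0_less_iff)
  have "\<exists>r>0. \<forall>t\<in>T. \<forall>x' u'. norm (x' - xs t) < r \<longrightarrow> norm (u' - us t) < r \<longrightarrow>
      norm (DF t x' u' i - DF t (xs t) (us t) i) < e / n" for i
    using rd_along_uniform[OF DF_rd[of i] DF_cont xs_cont us, of "e / n"] e n by (metis divide_pos_pos)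
  then obtain R where R: "\<And>i. R i > 0"
    "\<And>i t x' u'. t \<in> T \<Longrightarrow> norm (x' - xs t) < R i \<Longrightarrow> norm (u' - us t) < R i \<Longrightarrow>
      norm (DF t x' u' i - DF t (xs t) (us t) i) < e / n" by metis
  define r where "r = Min (R ` (Basis :: ('x \<times> 'u) set))"
  have r: "r > 0" "\<And>i. i \<in> Basis \<Longrightarrow> r \<le> R i"
    using R(1) by (auto simp: r_def)
  have close: "norm (DF t x' u' h - Lin t h) \<le> e * norm h"
    if "t \<in> T" "norm (x' - xs t) < r" "norm (u' - us t) < r" for t x' u' h
  proof -
    have "norm (DF t x' u' h - Lin t h) \<le> n * (e / n) * norm h"
    proof (rule norm_linear_le_Basis[where A = "\<lambda>h. DF t x' u' h - Lin t h", folded n_def])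
      show "linear (\<lambda>h. DF t x' u' h - Lin t h)"
        using DF_linear Lin_linear that by (intro linear_compose_sub)
      show "norm (DF t x' u' i - Lin t i) \<le> e / n" if "i \<in> Basis" for i
        using R(2)[of t x' i u'] r(2)[OF that] \<open>t \<in> T\<close> \<open>norm (x' - xs t) < r\<close> \<open>norm (u' - us t) < r\<close>
        unfolding Lin_def by auto
    qed
    then show ?thesis using n by simp
  qed
  show thesis
  proof (rule that[OF r(1)])
    fix t :: real and x1 x2 :: 'x and u1 u2 :: 'u
    assume t: "t \<in> T" and small: "norm x1 < r" "norm u1 < r" "norm x2 < r" "norm u2 < r"
    define S where "S = ball (xs t) r \<times> ball (us t) r"
    have inS: "(xs t + x1, us t + u1) \<in> S" "(xs t + x2, us t + u2) \<in> S"
      using small by (auto simp: S_def dist_norm)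
    interpret L: bounded_linear "Lin t"
      using Lin_linear[OF t] linear_conv_bounded_linear by blast
    define g where "g z = (case z of (x, u) \<Rightarrow> F t x u) - Lin t z" for z
    have "norm (g (xs t + x1, us t + u1) - g (xs t + x2, us t + u2))
        \<le> e * norm ((xs t + x1, us t + u1) - (xs t + x2, us t + u2))"
    proof (rule differentiable_bound[OF _ _ _ inS])
      show "convex S" unfolding S_def by (intro convex_Times convex_ball)
      fix z assume "z \<in> S"
      then obtain x u where z: "z = (x, u)" "norm (x - xs t) < r" "norm (u - us t) < r"
        by (auto simp: S_def dist_norm norm_minus_commute)
      have "((\<lambda>z. case z of (x, u) \<Rightarrow> F t x u) has_derivative DF t (fst z) (snd z)) (at z within S)"
        using has_derivative_at_withinI[OF F_deriv[OF t]] by (metis prod.collapse)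
      then show "(g has_derivative (\<lambda>h. DF t (fst z) (snd z) h - Lin t h)) (at z within S)"
        unfolding g_def by (intro has_derivative_diff L.has_derivative has_derivative_ident)
      show "onorm (\<lambda>h. DF t (fst z) (snd z) h - Lin t h) \<le> e"
        using close[OF t z(2,3)] z(1) by (intro onorm_le) simp
    qed
    moreover have "Lin t (x1 - x2, u1 - u2) = Lin t (xs t + x1, us t + u1) - Lin t (xs t + x2, us t + u2)"
      by (simp add: L.diff[symmetric])
    then have "F t (xs t + x1) (us t + u1) - F t (xs t + x2) (us t + u2) - Lin t (x1 - x2, u1 - u2)
        = g (xs t + x1, us t + u1) - g (xs t + x2, us t + u2)"
      by (simp add: g_def)
    ultimately show "norm (F t (xs t + x1) (us t + u1) - F t (xs t + x2) (us t + u2) - Lin t (x1 - x2, u1 - u2))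
        \<le> e * norm (x1 - x2, u1 - u2)"
      by simp
  qed
qed

subsection \<open>The linearised equation\<close>

text \<open>The pairs of a control variation \<open>w\<close> and the solution \<open>y\<close> of the linearised equation with
  \<open>y a = 0\<close>.  The integral form carries the initial value and makes superposition immediate.\<close>

definition variation :: "(real \<Rightarrow> 'u) \<Rightarrow> (real \<Rightarrow> 'x) \<Rightarrow> bool" where
  "variation w y \<longleftrightarrow> w \<in> Crd T \<and> continuous_on {a..b} y \<and>
     (\<forall>t\<in>{a..b}. y t = integral {a..t} (\<lambda>s. Lin (ts_floor T s) (y (ts_floor T s), w (ts_floor T s))))"

lemma variation_integrand_Crd:
  assumes "w \<in> Crd T" "continuous_on {a..b} y"
  shows "(\<lambda>t. Lin t (y t, w t)) \<in> Crd T"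
  using continuous_imp_Crd[OF continuous_on_subset[OF assms(2) T_sub]] assms(1)
  by (intro Lin_Crd Crd_Pair)

lemma ts_floor_delay: "s \<in> {a..b} \<Longrightarrow> ts_floor T s \<in> {a..s}"
  using ts_floor_le ts_floor_in T_bounds by auto

lemma variation_exists:
  assumes w: "w \<in> Crd T"
  obtains y where "variation w y"
proof -
  obtain M where M: "M > 0" "\<And>t h. t \<in> T \<Longrightarrow> norm (Lin t h) \<le> M * norm h"
    using Lin_bounded by blast
  interpret volterra a b M "ts_floor T" "\<lambda>s y. Lin (ts_floor T s) (y, w (ts_floor T s))"
  proof
    show "norm (Lin (ts_floor T s) (x, w (ts_floor T s)) - Lin (ts_floor T s) (y, w (ts_floor T s)))
        \<le> M * norm (x - y)" if "s \<in> {a..b}" for s x y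
    proof -
      have s: "ts_floor T s \<in> T" using that ts_floor_in by auto
      show ?thesis
        using M(2)[OF s, of "(x - y, 0)"]
          linear_diff[OF Lin_linear[OF s], of "(x, w (ts_floor T s))" "(y, w (ts_floor T s))"]
        by (simp add: norm_Pair)
    qed
    show "(\<lambda>s. Lin (ts_floor T s) (x (ts_floor T s), w (ts_floor T s))) integrable_on {a..b}"
      if "continuous_on {a..b} x" for x
      using Crd_integrable[OF variation_integrand_Crd[OF w that]] .
  qed (use a_less_b M ts_floor_delay in auto)
  obtain y where y: "continuous_on {a..b} y"
    "\<And>t. t \<in> {a..b} \<Longrightarrow> y t = 0 + integral {a..t} (\<lambda>s. Lin (ts_floor T s) (y (ts_floor T s), w (ts_floor T s)))"
    using solution_exists[where c = 0] by blast
  have "variation w y"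
    unfolding variation_def using w y(1) y(2)[unfolded add_0] by blast
  then show thesis by (rule that)
qed

lemma variation_delta_deriv:
  assumes "variation w y" "t \<in> kappa T"
  shows "has_delta_deriv T y (Lin t (y t, w t)) t"
proof (rule has_delta_deriv_cong)
  show "has_delta_deriv T (\<lambda>t. 0 + integral {a..t} (\<lambda>s. Lin (ts_floor T s) (y (ts_floor T s), w (ts_floor T s))))
      (Lin t (y t, w t)) t"
    using assms unfolding variation_def
    by (intro has_delta_deriv_integral[where f = "\<lambda>t. Lin t (y t, w t)"] variation_integrand_Crd) auto
qed (use assms T_sub kappa_sub in \<open>auto simp: variation_def\<close>)

lemma variation_zero: "variation (\<lambda>_. 0) (\<lambda>_. 0)"
proof -
  have "integral {a..t} (\<lambda>s. Lin (ts_floor T s) (0, 0)) = 0" for t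
  proof -
    have "integral {a..t} (\<lambda>s. Lin (ts_floor T s) (0, 0)) = integral {a..t} (\<lambda>s. 0)"
      using linear_0[OF Lin_linear[OF ts_floor_in]] by (intro integral_cong) (auto simp: zero_prod_def)
    then show ?thesis by simp
  qed
  then show ?thesis by (simp add: variation_def Crd_const)
qed

lemma variation_add_scale:
  assumes 1: "variation w1 y1" and 2: "variation w2 y2"
  shows "variation (\<lambda>t. c *\<^sub>R w1 t + w2 t) (\<lambda>t. c *\<^sub>R y1 t + y2 t)"
  unfolding variation_def
proof (intro conjI ballI)
  show "(\<lambda>t. c *\<^sub>R w1 t + w2 t) \<in> Crd T"
    using 1 2 by (auto simp: variation_def intro!: Crd_add Crd_scaleR Crd_const)
  show "continuous_on {a..b} (\<lambda>t. c *\<^sub>R y1 t + y2 t)"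
    using 1 2 by (auto simp: variation_def intro!: continuous_intros)
  fix t assume t: "t \<in> {a..b}"
  let ?I = "\<lambda>y w s. Lin (ts_floor T s) (y (ts_floor T s), w (ts_floor T s))"
  have int: "?I y w integrable_on {a..t}" if "variation w y" for w y
    using Crd_integrable[OF variation_integrand_Crd, of w y] that t
    by (auto simp: variation_def intro: integrable_subinterval_real)
  have "integral {a..t} (?I (\<lambda>t. c *\<^sub>R y1 t + y2 t) (\<lambda>t. c *\<^sub>R w1 t + w2 t))
      = integral {a..t} (\<lambda>s. c *\<^sub>R ?I y1 w1 s + ?I y2 w2 s)"
  proof (rule integral_cong)
    fix s assume "s \<in> {a..t}"
    then have "linear (Lin (ts_floor T s))" using ts_floor_in by (intro Lin_linear) auto
    then show "?I (\<lambda>t. c *\<^sub>R y1 t + y2 t) (\<lambda>t. c *\<^sub>R w1 t + w2 t) s = c *\<^sub>R ?I y1 w1 s + ?I y2 w2 s"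
      by (simp add: linear_add[symmetric] linear_scale[symmetric])
  qed
  also have "\<dots> = c *\<^sub>R y1 t + y2 t"
    using int[OF 1] int[OF 2] 1 2 t
    by (subst integral_add) (auto simp: variation_def intro: integrable_cmul)
  finally show "c *\<^sub>R y1 t + y2 t = integral {a..t} (?I (\<lambda>t. c *\<^sub>R y1 t + y2 t) (\<lambda>t. c *\<^sub>R w1 t + w2 t))" by simp
qed

lemma variation_sum:
  assumes "finite I" "\<And>i. i \<in> I \<Longrightarrow> variation (w i) (y i)"
  shows "variation (\<lambda>t. \<Sum>i\<in>I. c i *\<^sub>R w i t) (\<lambda>t. \<Sum>i\<in>I. c i *\<^sub>R y i t)"
  using assms
  by (induction I) (auto simp: variation_zero intro: variation_add_scale)

lemma variation_start: "variation w y \<Longrightarrow> y a = 0"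
  using a_less_b by (simp add: variation_def)

lemma subspace_variation_end: "subspace {y b |w y. variation w y}"
  unfolding subspace_def
proof (intro conjI allI ballI)
  show "0 \<in> {y b |w y. variation w y}" using variation_zero by force
  fix p q assume "p \<in> {y b |w y. variation w y}" "q \<in> {y b |w y. variation w y}"
  then obtain w1 y1 w2 y2 where "variation w1 y1" "variation w2 y2" "p = y1 b" "q = y2 b" by blast
  then show "p + q \<in> {y b |w y. variation w y}"
    using variation_add_scale[of w1 y1 w2 y2 1] by force
next
  fix c p assume "p \<in> {y b |w y. variation w y}"
  then obtain w y where "variation w y" "p = y b" by blast
  then show "c *\<^sub>R p \<in> {y b |w y. variation w y}"
    using variation_add_scale[OF _ variation_zero, of w y c] by force
qed


section \<open>The endpoint map\<close>

text \<open>If the linearised equation reaches every endpoint, so does the nonlinear one near the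
  trajectory.  Superpose finitely many control variations with coefficient vector \<open>\<epsilon>\<close>, chosen so
  that the linearised endpoint is \<open>\<epsilon>\<close> itself; the perturbed equation, with the deviation
  truncated to a tube on which \<^term>\<open>F\<close> is Lipschitz, is a Volterra equation.  The comparison
  of approximate solutions shows that its endpoint depends continuously on \<open>\<epsilon>\<close>, with derivative
  the identity at \<open>0\<close>, and a map that is continuous near \<open>0\<close> and has a surjective derivative
  there is open at \<open>0\<close>.\<close>

lemma endpoint_map_open:
  assumes full: "\<And>p. \<exists>w y. variation w y \<and> y b = p" and \<delta>: "\<delta> > 0"
  obtains \<eta> where "\<eta> > 0"
    "\<And>p. norm p < \<eta> \<Longrightarrow> \<exists>x u. u \<in> Crd T \<and> (\<forall>t\<in>kappa T. has_delta_deriv T x (F t (x t) (u t)) t) \<and>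
      x a = xs a \<and> x b = xs b + p \<and> (\<forall>t\<in>T. norm (x t - xs t) < \<delta> \<and> norm (u t - us t) < \<delta> \<and>
        norm (F t (x t) (u t) - F t (xs t) (us t)) < \<delta>)"
proof -
  obtain w0 y0 where var0: "\<And>i. variation (w0 i) (y0 i)" "\<And>i. y0 i b = i"
    using full by metis
  define W where "W \<epsilon> t = (\<Sum>i\<in>Basis. (\<epsilon> \<bullet> i) *\<^sub>R w0 i t)" for \<epsilon> :: 'x and t
  define Y where "Y \<epsilon> t = (\<Sum>i\<in>Basis. (\<epsilon> \<bullet> i) *\<^sub>R y0 i t)" for \<epsilon> :: 'x and t
  have var: "variation (W \<epsilon>) (Y \<epsilon>)" for \<epsilon>
    unfolding W_def Y_def by (intro variation_sum var0) simp
  have Y_end: "Y \<epsilon> b = \<epsilon>" for \<epsilon>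
    unfolding Y_def var0(2) by (rule euclidean_representation)
  have W_Crd: "W \<epsilon> \<in> Crd T" for \<epsilon> using var by (simp add: variation_def)
  have Y_cont: "continuous_on {a..b} (Y \<epsilon>)" for \<epsilon> using var by (simp add: variation_def)
  have W_diff: "W \<epsilon> t - W \<epsilon>' t = W (\<epsilon> - \<epsilon>') t" for \<epsilon> \<epsilon>' t
    by (simp add: W_def sum_subtractf[symmetric] inner_diff_left scaleR_left_diff_distrib)
  have lin: "linear (\<lambda>\<epsilon>. W \<epsilon> t)" "linear (\<lambda>\<epsilon>. Y \<epsilon> t)" for t
    by (auto intro!: linearI simp: W_def Y_def inner_add_left inner_scaleR_left scaleR_add_left sum.distrib scaleR_sum_right)
  have finite_bound: "\<exists>c>0. \<forall>i\<in>(Basis::'x set). \<forall>t\<in>T. norm (f i t) \<le> c"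
    if f: "\<And>i. f i \<in> Crd T" for f :: "'x \<Rightarrow> real \<Rightarrow> 'z::banach"
  proof -
    have "\<exists>B>0. \<forall>t\<in>T. norm (f i t) \<le> B" for i using Crd_bounded[OF f[of i]] by metis
    then obtain B where B: "\<And>i. B i > 0" "\<And>i t. t \<in> T \<Longrightarrow> norm (f i t) \<le> B i" by metis
    have "B i \<le> Max (B ` Basis)" if "i \<in> Basis" for i using that by simp
    moreover from this have "Max (B ` Basis) > 0" using B(1) by (meson SOME_Basis less_le_trans)
    ultimately show ?thesis using B(2) by (meson order_trans)
  qed
  define n where "n = real DIM('x)"
  have n: "n > 0" by (simp add: n_def)
  obtain cw where cw: "cw > 0" "\<And>i t. i \<in> Basis \<Longrightarrow> t \<in> T \<Longrightarrow> norm (w0 i t) \<le> cw"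
    using finite_bound[of w0] var0 by (auto simp: variation_def)
  have y0_Crd: "y0 i \<in> Crd T" for i
    using var0(1)[of i] T_sub by (auto simp: variation_def intro: continuous_imp_Crd continuous_on_subset)
  obtain cy where cy: "cy > 0" "\<And>i t. i \<in> Basis \<Longrightarrow> t \<in> T \<Longrightarrow> norm (y0 i t) \<le> cy"
    using finite_bound[of y0, OF y0_Crd] by auto
  define N where "N = n * cw + n * cy"
  have "n * cw > 0" "n * cy > 0" using n cw cy by simp_all
  then have N: "N > 0" by (simp add: N_def)
  have basis: "W i t = w0 i t" "Y i t = y0 i t" if "i \<in> Basis" for i t
    using that by (simp_all add: W_def Y_def inner_Basis if_distrib[of "\<lambda>c. c *\<^sub>R _"] cong: if_cong)
  have W_le: "norm (W \<epsilon> t) \<le> N * norm \<epsilon>" and Y_le: "norm (Y \<epsilon> t) \<le> N * norm \<epsilon>"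
    and WY_le: "norm (Y \<epsilon> t, W \<epsilon> t) \<le> N * norm \<epsilon>" if t: "t \<in> T" for \<epsilon> t
  proof -
    have 1: "norm (W \<epsilon> t) \<le> n * cw * norm \<epsilon>" and 2: "norm (Y \<epsilon> t) \<le> n * cy * norm \<epsilon>"
      unfolding n_def using norm_linear_le_Basis[OF lin(1)] norm_linear_le_Basis[OF lin(2)] cw(2)[OF _ t] cy(2)[OF _ t]
      by (simp_all add: basis)
    then show "norm (Y \<epsilon> t, W \<epsilon> t) \<le> N * norm \<epsilon>"
      using norm_Pair_le[of "Y \<epsilon> t" "W \<epsilon> t"] by (simp add: N_def distrib_right)
    have "n * cw * norm \<epsilon> \<ge> 0" "n * cy * norm \<epsilon> \<ge> 0" using n cw cy by simp_all
    then show "norm (W \<epsilon> t) \<le> N * norm \<epsilon>" "norm (Y \<epsilon> t) \<le> N * norm \<epsilon>"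
      using 1 2 unfolding N_def distrib_right by linarith+
  qed

  \<comment> \<open>Strict differentiability with error factor \<open>1\<close> bounds the Lipschitz constant by \<open>M + 1\<close>.\<close>
  obtain M where M: "M > 0" "\<And>t h. t \<in> T \<Longrightarrow> norm (Lin t h) \<le> M * norm h"
    using Lin_bounded by blast
  obtain r0 where r0: "r0 > 0"
    "\<And>t x1 u1 x2 u2. t \<in> T \<Longrightarrow> norm x1 < r0 \<Longrightarrow> norm u1 < r0 \<Longrightarrow> norm x2 < r0 \<Longrightarrow> norm u2 < r0 \<Longrightarrow>
      norm (F t (xs t + x1) (us t + u1) - F t (xs t + x2) (us t + u2) - Lin t (x1 - x2, u1 - u2))
        \<le> 1 * norm (x1 - x2, u1 - u2)"
    using F_strict_derivative[of 1] zero_less_one by blast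
  define K where "K = M + 1"
  have K: "K > 0" using M by (simp add: K_def)
  have F_lip: "norm (F t (xs t + x1) (us t + u1) - F t (xs t + x2) (us t + u2)) \<le> K * norm (x1 - x2, u1 - u2)"
    if "t \<in> T" "norm x1 < r0" "norm u1 < r0" "norm x2 < r0" "norm u2 < r0" for t x1 u1 x2 u2
  proof -
    have "norm (F t (xs t + x1) (us t + u1) - F t (xs t + x2) (us t + u2))
        \<le> norm (Lin t (x1 - x2, u1 - u2)) + 1 * norm (x1 - x2, u1 - u2)"
      using r0(2)[OF that] norm_triangle_sub[of "F t (xs t + x1) (us t + u1) - F t (xs t + x2) (us t + u2)" "Lin t (x1 - x2, u1 - u2)"]
      by linarith
    then show ?thesis using M(2)[OF that(1), of "(x1 - x2, u1 - u2)"] by (simp add: K_def distrib_right)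
  qed
  define r1 where "r1 = r0 / 2"
  have r1: "0 < r1" "r1 < r0" using r0(1) by (simp_all add: r1_def)
  define P where "P = closest_point (cball (0::'x) r1)"
  have P_in: "norm (P z) < r0" for z
  proof -
    have "P z \<in> cball 0 r1"
      unfolding P_def using r1 by (intro closest_point_in_set) auto
    then show ?thesis using r1 by simp
  qed
  have P_lip: "norm (P z - P z') \<le> norm (z - z')" for z z'
    using closest_point_lipschitz[of "cball (0::'x) r1" z z'] r1 by (simp add: P_def dist_norm)
  have P_id: "P z = z" if "norm z \<le> r1" for z
    using that unfolding P_def by (intro closest_point_self) simp

  \<comment> \<open>Projecting the deviation \<open>z\<close> from \<open>xs\<close> to the tube makes the right-hand side globally Lipschitz
      in \<open>z\<close>; for small \<open>\<epsilon>\<close> the solution stays where the projection is the identity.\<close>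
  define f where "f \<epsilon> t z = F t (xs t + P z) (us t + W \<epsilon> t) - F t (xs t) (us t)" for \<epsilon> t z
  define \<rho>0 where "\<rho>0 = r0 / N"
  have \<rho>0: "\<rho>0 > 0" using r0 N by (simp add: \<rho>0_def)
  have W_small: "norm (W \<epsilon> t) < r0" if "norm \<epsilon> < \<rho>0" "t \<in> T" for \<epsilon> t
  proof -
    have "norm (W \<epsilon> t) \<le> N * norm \<epsilon>" using W_le[OF that(2)] .
    also have "\<dots> < r0" using that(1) N by (simp add: \<rho>0_def field_simps)
    finally show ?thesis .
  qed
  have f_Crd: "(\<lambda>t. f \<epsilon> t (z t)) \<in> Crd T" if z: "continuous_on {a..b} z" for \<epsilon> z
  proof -
    have "continuous_on UNIV P"
      using P_lip by (auto simp: continuous_on_iff dist_norm intro: le_less_trans)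
    then have "continuous_on T (\<lambda>t. P (z t))"
      using continuous_on_subset[OF z T_sub] by (rule continuous_on_compose2) auto
    then have "(\<lambda>t. F t (xs t + P (z t)) (us t + W \<epsilon> t) + (-1) *\<^sub>R F t (xs t) (us t)) \<in> Crd T"
      by (intro Crd_add Crd_scaleR Crd_const F_traj_Crd continuous_intros xs_cont us W_Crd)
    then show ?thesis by (simp add: f_def)
  qed
  have volt: "volterra a b K (ts_floor T) (\<lambda>s. f \<epsilon> (ts_floor T s))" if "norm \<epsilon> < \<rho>0" for \<epsilon>
  proof
    show "norm (f \<epsilon> (ts_floor T s) x - f \<epsilon> (ts_floor T s) y) \<le> K * norm (x - y)" if s: "s \<in> {a..b}" for s x y
    proof -
      have t: "ts_floor T s \<in> T" using s ts_floor_in by auto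
      have "norm (f \<epsilon> (ts_floor T s) x - f \<epsilon> (ts_floor T s) y) \<le> K * norm (P x - P y, 0 :: 'u)"
        using F_lip[OF t, of "P x" "W \<epsilon> (ts_floor T s)" "P y" "W \<epsilon> (ts_floor T s)"] P_in W_small[OF \<open>norm \<epsilon> < \<rho>0\<close> t]
        by (simp add: f_def)
      also have "\<dots> \<le> K * norm (x - y)" using P_lip K by (simp add: norm_Pair)
      finally show ?thesis .
    qed
    show "(\<lambda>s. f \<epsilon> (ts_floor T s) (z (ts_floor T s))) integrable_on {a..b}" if "continuous_on {a..b} z" for z
      using Crd_integrable[OF f_Crd[OF that]] .
  qed (use a_less_b K ts_floor_delay in auto)
  have "\<exists>z. continuous_on {a..b} z \<and>
      (\<forall>t\<in>{a..b}. z t = 0 + integral {a..t} (\<lambda>s. f \<epsilon> (ts_floor T s) (z (ts_floor T s))))" if "norm \<epsilon> < \<rho>0" for \<epsilon>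
    using volterra.solution_exists[OF volt[OF that], of 0] by metis
  then obtain z where z: "\<And>\<epsilon>. norm \<epsilon> < \<rho>0 \<Longrightarrow> continuous_on {a..b} (z \<epsilon>)"
    "\<And>\<epsilon> t. norm \<epsilon> < \<rho>0 \<Longrightarrow> t \<in> {a..b} \<Longrightarrow>
      z \<epsilon> t = 0 + integral {a..t} (\<lambda>s. f \<epsilon> (ts_floor T s) (z \<epsilon> (ts_floor T s)))"
    by metis
  define G where "G = 2 * exp (2 * K * (b - a)) * (b - a)"
  have G: "G > 0" using a_less_b by (simp add: G_def)

  \<comment> \<open>A function whose integrand defect is at most \<open>c\<close> is within \<open>G * c\<close> of the solution.\<close>
  have near: "norm (z \<epsilon> t - v t) \<le> G * c"
    if \<epsilon>: "norm \<epsilon> < \<rho>0" and v: "continuous_on {a..b} v" and h: "h \<in> Crd T"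
      and veq: "\<And>t. t \<in> {a..b} \<Longrightarrow> v t = integral {a..t} (\<lambda>s. h (ts_floor T s))"
      and c: "\<And>t. t \<in> T \<Longrightarrow> norm (h t - f \<epsilon> t (v t)) \<le> c" and t: "t \<in> {a..b}" for \<epsilon> v h c t
  proof -
    have "norm (v r - (0 + integral {a..r} (\<lambda>s. f \<epsilon> (ts_floor T s) (v (ts_floor T s))))) \<le> c * (b - a)"
      if r: "r \<in> {a..b}" for r
    proof -
      have int: "(\<lambda>s. h (ts_floor T s)) integrable_on {a..r}"
        "(\<lambda>s. f \<epsilon> (ts_floor T s) (v (ts_floor T s))) integrable_on {a..r}"
        using r integrable_subinterval_real[OF Crd_integrable[OF h]]
          integrable_subinterval_real[OF Crd_integrable[OF f_Crd[OF v, of \<epsilon>]]] by auto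
      have "norm (integral {a..r} (\<lambda>s. h (ts_floor T s) - f \<epsilon> (ts_floor T s) (v (ts_floor T s)))) \<le> integral {a..r} (\<lambda>_. c)"
        using c ts_floor_in int by (intro integral_norm_bound_integral integrable_diff) auto
      also have "\<dots> = c * (r - a)" using r by simp
      also have "\<dots> \<le> c * (b - a)"
        using r order_trans[OF norm_ge_zero c[OF a_in]] by (intro mult_left_mono) auto
      finally show ?thesis using veq[OF r] by (simp add: integral_diff[OF int])
    qed
    from volterra.approximate_solution_close[OF volt[OF \<epsilon>] z(1)[OF \<epsilon>] v z(2)[OF \<epsilon>] this t]
    show ?thesis by (simp add: G_def mult_ac)
  qed
  have z_lip: "norm (z \<epsilon> t - z \<epsilon>' t) \<le> G * (K * (N * norm (\<epsilon> - \<epsilon>')))"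
    if \<epsilon>: "norm \<epsilon> < \<rho>0" "norm \<epsilon>' < \<rho>0" and t: "t \<in> {a..b}" for \<epsilon> \<epsilon>' t
  proof (rule near[OF \<epsilon>(1) z(1)[OF \<epsilon>(2)] f_Crd[OF z(1)[OF \<epsilon>(2)], of \<epsilon>'] _ _ t])
    show "z \<epsilon>' t = integral {a..t} (\<lambda>s. f \<epsilon>' (ts_floor T s) (z \<epsilon>' (ts_floor T s)))" if "t \<in> {a..b}" for t
      using z(2)[OF \<epsilon>(2) that] by simp
    show "norm (f \<epsilon>' t (z \<epsilon>' t) - f \<epsilon> t (z \<epsilon>' t)) \<le> K * (N * norm (\<epsilon> - \<epsilon>'))" if t: "t \<in> T" for t
    proof -
      have "norm (f \<epsilon>' t (z \<epsilon>' t) - f \<epsilon> t (z \<epsilon>' t)) \<le> K * norm (0 :: 'x, W \<epsilon>' t - W \<epsilon> t)"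
        using F_lip[OF t, of "P (z \<epsilon>' t)" "W \<epsilon>' t" "P (z \<epsilon>' t)" "W \<epsilon> t"] P_in W_small[OF _ t] \<epsilon> by (simp add: f_def)
      also have "\<dots> \<le> K * (N * norm (\<epsilon>' - \<epsilon>))"
        using W_le[OF t, of "\<epsilon>' - \<epsilon>"] K by (simp add: norm_Pair W_diff)
      finally show ?thesis by (simp add: norm_minus_commute)
    qed
  qed
  have z0: "z 0 t = 0" if t: "t \<in> {a..b}" for t
  proof -
    have "P 0 = 0" using P_id[of 0] r1 by simp
    then have "norm (z 0 t - 0) \<le> G * 0"
      using \<rho>0 lin(1)[THEN linear_0]
      by (intro near[of 0 "\<lambda>_. 0" "\<lambda>_. 0" 0 t, OF _ _ Crd_const _ _ t]) (auto simp: f_def)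
    then show ?thesis by simp
  qed
  define C where "C = G * K * N"
  have C: "C > 0" using G K N by (simp add: C_def)
  have z_le: "norm (z \<epsilon> t) \<le> C * norm \<epsilon>" if "norm \<epsilon> < \<rho>0" "t \<in> {a..b}" for \<epsilon> t
    using z_lip[OF that(1) _ that(2), of 0] z0[OF that(2)] \<rho>0 by (simp add: C_def mult_ac)

  have bT: "b \<in> {a..b}" using a_less_b by simp
  have cont: "continuous_on (ball 0 \<rho>0) (\<lambda>\<epsilon>. z \<epsilon> b)"
  proof (rule continuous_on_subset[OF lipschitz_on_continuous_on])
    show "C-lipschitz_on (ball 0 \<rho>0) (\<lambda>\<epsilon>. z \<epsilon> b)"
      using z_lip[OF _ _ bT] C by (intro lipschitz_onI) (auto simp: dist_norm C_def mult_ac)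
  qed simp
  have deriv: "((\<lambda>\<epsilon>. z \<epsilon> b) has_derivative (\<lambda>\<epsilon>. \<epsilon>)) (at 0)"
    unfolding has_derivative_at_alt
  proof (intro conjI allI impI)
    show "bounded_linear (\<lambda>\<epsilon>::'x. \<epsilon>)" by (rule bounded_linear_ident)
    fix e :: real assume "e > 0"
    define e' where "e' = e / (G * N)"
    have e': "e' > 0" "G * (e' * N) = e" using \<open>e > 0\<close> G N by (simp_all add: e'_def)
    obtain r where r: "r > 0"
      "\<And>t x1 u1 x2 u2. t \<in> T \<Longrightarrow> norm x1 < r \<Longrightarrow> norm u1 < r \<Longrightarrow> norm x2 < r \<Longrightarrow> norm u2 < r \<Longrightarrow>
        norm (F t (xs t + x1) (us t + u1) - F t (xs t + x2) (us t + u2) - Lin t (x1 - x2, u1 - u2))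
          \<le> e' * norm (x1 - x2, u1 - u2)"
      using F_strict_derivative[OF e'(1)] by blast
    define d where "d = min \<rho>0 (min r r1 / N)"
    have d: "d > 0" using \<rho>0 r r1 N by (simp add: d_def)
    have "norm (z \<epsilon> b - z 0 b - (\<epsilon> - 0)) \<le> e * norm (\<epsilon> - 0)" if \<epsilon>: "norm (\<epsilon> - 0) < d" for \<epsilon>
    proof -
      have \<epsilon>0: "norm \<epsilon> < \<rho>0" and "norm \<epsilon> < min r r1 / N" using \<epsilon> by (simp_all add: d_def)
      then have small: "N * norm \<epsilon> < min r r1" using N by (simp add: field_simps)
      have "norm (z \<epsilon> b - Y \<epsilon> b) \<le> G * (e' * (N * norm \<epsilon>))"
      proof (rule near[OF \<epsilon>0 Y_cont variation_integrand_Crd[OF W_Crd Y_cont] _ _ bT])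
        show "Y \<epsilon> t = integral {a..t} (\<lambda>s. Lin (ts_floor T s) (Y \<epsilon> (ts_floor T s), W \<epsilon> (ts_floor T s)))"
          if "t \<in> {a..b}" for t
          using var[of \<epsilon>] that by (simp add: variation_def)
        show "norm (Lin t (Y \<epsilon> t, W \<epsilon> t) - f \<epsilon> t (Y \<epsilon> t)) \<le> e' * (N * norm \<epsilon>)" if t: "t \<in> T" for t
        proof -
          have "norm (Y \<epsilon> t) < min r r1" "norm (W \<epsilon> t) < r"
            using Y_le[OF t, of \<epsilon>] W_le[OF t, of \<epsilon>] small by auto
          then have "norm (F t (xs t + P (Y \<epsilon> t)) (us t + W \<epsilon> t) - F t (xs t + 0) (us t + 0) - Lin t (Y \<epsilon> t - 0, W \<epsilon> t - 0))
              \<le> e' * norm (Y \<epsilon> t - 0, W \<epsilon> t - 0)"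
            using r(1) P_id[of "Y \<epsilon> t"] by (simp only:) (intro r(2) t, auto)
          also have "\<dots> \<le> e' * (N * norm \<epsilon>)" using WY_le[OF t] e' by simp
          finally show ?thesis by (simp add: f_def norm_minus_commute)
        qed
      qed
      also have "\<dots> = e * norm \<epsilon>" using e'(2) by (simp add: mult_ac)
      finally show ?thesis using Y_end z0[OF bT] by simp
    qed
    then show "\<exists>d>0. \<forall>\<epsilon>. norm (\<epsilon> - 0) < d \<longrightarrow> norm (z \<epsilon> b - z 0 b - (\<epsilon> - 0)) \<le> e * norm (\<epsilon> - 0)"
      using d by blast
  qed
  define D where "D = 1 + C + N + K * (C + N)"
  have D: "D > 0" "C < D" "N < D" "K * (C + N) < D" using C N K by (auto simp: D_def intro!: add_pos_pos)
  define \<rho> where "\<rho> = min \<rho>0 (min (r1 / C) (\<delta> / D))"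
  have \<rho>: "\<rho> > 0" using \<rho>0 r1 C \<delta> D by (simp add: \<rho>_def)
  have "z 0 b \<in> interior ((\<lambda>\<epsilon>. z \<epsilon> b) ` ball 0 \<rho>)"
  proof (rule sussmann_open_mapping[OF open_ball cont _ deriv, of id])
    show "ball 0 \<rho> \<subseteq> ball (0::'x) \<rho>0" by (auto simp: \<rho>_def)
  qed (use \<rho> \<rho>0 in \<open>auto simp: id_def o_def interior_open intro: bounded_linear_ident\<close>)
  then obtain \<eta> where \<eta>: "\<eta> > 0" "ball 0 \<eta> \<subseteq> (\<lambda>\<epsilon>. z \<epsilon> b) ` ball 0 \<rho>"
    using z0[OF bT] unfolding mem_interior by auto
  show thesis
  proof (rule that[OF \<eta>(1)])
    fix p :: 'x assume "norm p < \<eta>"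
    then have "p \<in> ball 0 \<eta>" by simp
    then obtain \<epsilon> where \<epsilon>: "norm \<epsilon> < \<rho>" "z \<epsilon> b = p" using \<eta>(2) by auto
    have \<epsilon>0: "norm \<epsilon> < \<rho>0" and \<epsilon>1: "norm \<epsilon> < r1 / C" and \<epsilon>2: "norm \<epsilon> < \<delta> / D"
      using \<epsilon>(1) by (simp_all add: \<rho>_def)
    have inactive: "P (z \<epsilon> t) = z \<epsilon> t" "norm (z \<epsilon> t) < r0" if "t \<in> {a..b}" for t
    proof -
      have "norm (z \<epsilon> t) \<le> r1"
        using z_le[OF \<epsilon>0 that] \<epsilon>1 C by (simp add: field_simps)
      then show "P (z \<epsilon> t) = z \<epsilon> t" "norm (z \<epsilon> t) < r0" using P_id r1 by auto
    qed
    have bound: "c * norm \<epsilon> < \<delta>" if "c < D" for c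
    proof -
      have "c * norm \<epsilon> \<le> D * norm \<epsilon>" using that by (intro mult_right_mono) auto
      also have "\<dots> < \<delta>" using \<epsilon>2 D by (simp add: field_simps)
      finally show ?thesis .
    qed
    define x where "x t = xs t + z \<epsilon> t" for t
    define u where "u t = us t + W \<epsilon> t" for t
    have "u \<in> Crd T" unfolding u_def by (intro Crd_add us W_Crd)
    moreover have "has_delta_deriv T x (F t (x t) (u t)) t" if t: "t \<in> kappa T" for t
    proof -
      have tT: "t \<in> T" "t \<in> {a..b}" using t kappa_sub T_sub by auto
      have "has_delta_deriv T (z \<epsilon>) (f \<epsilon> t (z \<epsilon> t)) t"
        using has_delta_deriv_integral[OF f_Crd[OF z(1)[OF \<epsilon>0]] t, of 0 \<epsilon>]
        by (rule has_delta_deriv_cong) (use z(2)[OF \<epsilon>0] T_sub tT in auto)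
      then have "has_delta_deriv T x (F t (xs t) (us t) + f \<epsilon> t (z \<epsilon> t)) t"
        unfolding x_def by (intro has_delta_deriv_add xs t)
      then show ?thesis using inactive(1)[OF tT(2)] by (simp add: f_def x_def u_def)
    qed
    moreover have "x a = xs a" using z(2)[OF \<epsilon>0, of a] a_less_b by (simp add: x_def)
    moreover have "x b = xs b + p" by (simp add: x_def \<epsilon>(2))
    moreover have "norm (x t - xs t) < \<delta> \<and> norm (u t - us t) < \<delta> \<and> norm (F t (x t) (u t) - F t (xs t) (us t)) < \<delta>"
      if t: "t \<in> T" for t
    proof (intro conjI)
      have t': "t \<in> {a..b}" using t T_sub by auto
      have 1: "norm (z \<epsilon> t) \<le> C * norm \<epsilon>" and 2: "norm (W \<epsilon> t) \<le> N * norm \<epsilon>"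
        using z_le[OF \<epsilon>0 t'] W_le[OF t] by auto
      show "norm (x t - xs t) < \<delta>" "norm (u t - us t) < \<delta>"
        using 1 2 bound[OF D(2)] bound[OF D(3)] by (simp_all add: x_def u_def)
      have "norm (F t (xs t + z \<epsilon> t) (us t + W \<epsilon> t) - F t (xs t + 0) (us t + 0)) \<le> K * norm (z \<epsilon> t - 0, W \<epsilon> t - 0)"
        using r0(1) by (intro F_lip t inactive(2)[OF t'] W_small[OF \<epsilon>0]) auto
      also have "\<dots> \<le> K * ((C + N) * norm \<epsilon>)"
        using 1 2 K norm_Pair_le[of "z \<epsilon> t" "W \<epsilon> t"] by (simp add: distrib_right)
      also have "\<dots> < \<delta>" using bound[OF D(4)] by (simp add: mult_ac)
      finally show "norm (F t (x t) (u t) - F t (xs t) (us t)) < \<delta>" by (simp add: x_def u_def)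
    qed
    ultimately show "\<exists>x u. u \<in> Crd T \<and> (\<forall>t\<in>kappa T. has_delta_deriv T x (F t (x t) (u t)) t) \<and>
      x a = xs a \<and> x b = xs b + p \<and> (\<forall>t\<in>T. norm (x t - xs t) < \<delta> \<and> norm (u t - us t) < \<delta> \<and>
        norm (F t (x t) (u t) - F t (xs t) (us t)) < \<delta>)" by blast
  qed
qed


text \<open>The linearised endpoints form a subspace.  It is proper if the endpoint map is not open, and
  then it has a nonzero normal.\<close>

lemma endpoint_alternative:
  assumes \<delta>: "\<delta> > 0"
    and no: "\<And>\<eta>. \<eta> > 0 \<Longrightarrow> \<exists>p. norm p < \<eta> \<and>
      \<not> (\<exists>x u. u \<in> Crd T \<and> (\<forall>t\<in>kappa T. has_delta_deriv T x (F t (x t) (u t)) t) \<and>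
        x a = xs a \<and> x b = xs b + p \<and> (\<forall>t\<in>T. norm (x t - xs t) < \<delta> \<and> norm (u t - us t) < \<delta> \<and>
          norm (F t (x t) (u t) - F t (xs t) (us t)) < \<delta>))"
  obtains \<nu> where "\<nu> \<noteq> 0" "\<And>w y. variation w y \<Longrightarrow> \<nu> \<bullet> y b = 0"
proof -
  let ?V = "{y b |w y. variation w y}"
  have "?V \<noteq> UNIV"
  proof
    assume *: "?V = UNIV"
    have full: "\<exists>w y. variation w y \<and> y b = p" for p
    proof -
      have "p \<in> ?V" using * by simp
      then show ?thesis by blast
    qed
    show False
      by (rule endpoint_map_open[OF full \<delta>]) (use no in blast)
  qed
  moreover have span: "span ?V = ?V"
    using subspace_variation_end by (rule span_eq_iff[THEN iffD2])
  ultimately have "span ?V \<noteq> UNIV" by (simp only: not_False_eq_True)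
  then have "dim ?V < DIM('x)"
    using dim_subset_UNIV[of ?V] dim_eq_full[of ?V] by auto
  then obtain \<nu> where \<nu>: "\<nu> \<noteq> 0" "\<And>p. p \<in> span ?V \<Longrightarrow> orthogonal \<nu> p"
    using orthogonal_to_subspace_exists by blast
  then show thesis
    using that[OF \<nu>(1)] unfolding span orthogonal_def by blast
qed

section \<open>The costate\<close>

lemma Lin_state_linear: "t \<in> T \<Longrightarrow> linear (\<lambda>x. Lin t (x, 0))"
  by (intro linearI) (simp_all add: linear_add[OF Lin_linear, symmetric] linear_scale[OF Lin_linear, symmetric])

lemma Lin_control_linear: "t \<in> T \<Longrightarrow> linear (\<lambda>v. Lin t (0, v))"
  by (intro linearI) (simp_all add: linear_add[OF Lin_linear, symmetric] linear_scale[OF Lin_linear, symmetric])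

lemma adjoint_Crd:
  fixes A :: "real \<Rightarrow> 'p::euclidean_space \<Rightarrow> 'q::euclidean_space"
  assumes lin: "\<And>t. t \<in> T \<Longrightarrow> linear (A t)" and A: "\<And>i. (\<lambda>t. A t i) \<in> Crd T" and q: "q \<in> Crd T"
  shows "(\<lambda>t. adjoint (A t) (q t)) \<in> Crd T"
proof -
  have "(\<lambda>t. \<Sum>i\<in>Basis. (A t i \<bullet> q t) *\<^sub>R i) \<in> Crd T"
    by (intro Crd_sum Crd_scaleR Crd_inner Crd_const A q)
  moreover have "(\<Sum>i\<in>Basis. (A t i \<bullet> q t) *\<^sub>R i) = adjoint (A t) (q t)" if "t \<in> T" for t
    using euclidean_representation[of "adjoint (A t) (q t)"] adjoint_works[OF lin[OF that], of _ "q t"]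
    by (simp add: inner_commute)
  ultimately show ?thesis by (subst Crd_cong[symmetric])
qed

text \<open>With \<open>A x = Lin t (x, 0)\<close>, the adjoint equation \<open>\<psi>\<^sup>\<Delta> = - A\<^sup>* \<psi>\<^sup>\<sigma>\<close> contains the costate at \<^term>\<open>sigma T t\<close>, so a step backwards
  in time is explicit even across a gap, and the equation is solvable from \<^term>\<open>b\<close>: after the reflection \<open>t \<mapsto> - t\<close> it is
  a Volterra equation whose delayed time is \<open>- sigma T (ts_floor T (- s))\<close>.\<close>

lemma adjoint_equation_solvable:
  obtains \<psi> where "\<psi> b = \<nu>"
    "\<And>t. t \<in> kappa T \<Longrightarrow> has_delta_deriv T \<psi> (- adjoint (\<lambda>x. Lin t (x, 0)) (\<psi> (sigma T t))) t"
proof -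
  define A where "A t = adjoint (\<lambda>x. Lin t (x, 0))" for t
  obtain M where M: "M > 0" "\<And>t h. t \<in> T \<Longrightarrow> norm (Lin t h) \<le> M * norm h"
    using Lin_bounded by blast
  have A_Crd: "(\<lambda>t. A t (l (sigma T t))) \<in> Crd T" if "continuous_on T l" for l
    unfolding A_def by (intro adjoint_Crd Lin_state_linear Lin_Crd Crd_const Crd_comp_sigma that)
  have A_linear: "linear (A t)" if "t \<in> T" for t
    unfolding A_def using Lin_state_linear[OF that] by (rule adjoint_linear)
  have A_le: "norm (A t q) \<le> M * norm q" if t: "t \<in> T" for t q
  proof -
    have "norm (A t q) * norm (A t q) = A t q \<bullet> A t q"
      by (simp add: dot_square_norm power2_eq_square)
    also have "\<dots> = Lin t (A t q, 0) \<bullet> q"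
      unfolding A_def by (rule adjoint_works[OF Lin_state_linear[OF t]])
    also have "\<dots> \<le> norm (Lin t (A t q, 0)) * norm q"
      by (rule norm_cauchy_schwarz)
    also have "\<dots> \<le> (M * norm (A t q)) * norm q"
      using M(2)[OF t, of "(A t q, 0)"] by (intro mult_right_mono) (auto simp: norm_Pair)
    finally have *: "norm (A t q) * norm (A t q) \<le> norm (A t q) * (M * norm q)" by (simp add: mult_ac)
    have "0 \<le> M * norm q" using M(1) by simp
    then show ?thesis using * by (cases "norm (A t q) = 0") (auto simp: mult_le_cancel_left)
  qed
  let ?d = "\<lambda>s. - sigma T (ts_floor T (- s))" and ?f = "\<lambda>s. A (ts_floor T (- s))"
  have m_Crd: "(\<lambda>t. A t (m (- sigma T t))) \<in> Crd T" if m: "continuous_on {-b..-a} m" for m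
  proof (rule A_Crd[where l = "\<lambda>t. m (- t)"])
    show "continuous_on T (\<lambda>t. m (- t))"
      by (rule continuous_on_compose2[OF m]) (use T_sub in \<open>auto intro: continuous_intros\<close>)
  qed
  interpret volterra "-b" "-a" M ?d ?f
  proof
    show "?d s \<in> {- b..s}" if "s \<in> {- b..- a}" for s
      using sigma_ts_floor_ge[of "- s"] that T_bounds(2)[OF sigma_in[OF ts_floor_in[of "- s"]]] by auto
    show "norm (?f s x - ?f s y) \<le> M * norm (x - y)" if "s \<in> {- b..- a}" for s x y
    proof -
      have "ts_floor T (- s) \<in> T" using that by (intro ts_floor_in) auto
      then show ?thesis using A_le linear_diff[OF A_linear] by metis
    qed
    show "(\<lambda>s. ?f s (m (?d s))) integrable_on {- b..- a}" if "continuous_on {- b..- a} m" for m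
      using Crd_integrable[OF m_Crd[OF that]]
        Henstock_Kurzweil_Integration.integrable_reflect_real[where f = "\<lambda>r. A (ts_floor T r) (m (- sigma T (ts_floor T r)))"] by simp
  qed (use a_less_b M in auto)
  obtain m where m: "continuous_on {- b..- a} m"
    "\<And>t. t \<in> {- b..- a} \<Longrightarrow> m t = \<nu> + integral {- b..t} (\<lambda>s. ?f s (m (?d s)))"
    using solution_exists[where c = \<nu>] by blast
  define \<psi> where "\<psi> t = m (- t)" for t
  define h where "h t = A t (\<psi> (sigma T t))" for t
  have h: "h \<in> Crd T" unfolding h_def \<psi>_def using m_Crd[OF m(1)] .
  have eq: "\<psi> t = (\<nu> + integral {a..b} (\<lambda>s. h (ts_floor T s))) + integral {a..t} (\<lambda>s. (-1) *\<^sub>R h (ts_floor T s))"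
    if t: "t \<in> T" for t
  proof -
    have t': "a \<le> t" "t \<le> b" using T_bounds t by auto
    have "integral {- b..- t} (\<lambda>s. ?f s (m (?d s))) = integral {t..b} (\<lambda>s. h (ts_floor T s))"
      using Henstock_Kurzweil_Integration.integral_reflect_real[where f = "\<lambda>s. h (ts_floor T s)"] by (simp add: h_def \<psi>_def)
    moreover have "integral {a..t} (\<lambda>s. h (ts_floor T s)) + integral {t..b} (\<lambda>s. h (ts_floor T s))
        = integral {a..b} (\<lambda>s. h (ts_floor T s))"
      using Crd_integrable[OF h] t' by (intro Henstock_Kurzweil_Integration.integral_combine)
    ultimately show ?thesis
      using m(2)[of "- t"] t' by (simp add: \<psi>_def algebra_simps)
  qed
  show thesis
  proof (rule that)
    show "\<psi> b = \<nu>" using eq[OF b_in] by simp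
    fix t assume t: "t \<in> kappa T"
    have "has_delta_deriv T \<psi> ((-1) *\<^sub>R h t) t"
    proof (rule has_delta_deriv_cong[OF has_delta_deriv_integral[OF _ t]])
      show "(\<lambda>t. (-1) *\<^sub>R h t) \<in> Crd T" by (intro Crd_scaleR Crd_const h)
    qed (use eq t kappa_sub in auto)
    then show "has_delta_deriv T \<psi> (- adjoint (\<lambda>x. Lin t (x, 0)) (\<psi> (sigma T t))) t"
      by (simp add: h_def A_def)
  qed
qed

text \<open>Duality: with \<open>B v = Lin t (0, v)\<close>, along a variation \<open>(w, y)\<close> the function \<open>\<psi> \<bullet> y\<close> has delta derivative \<open>\<psi>\<^sup>\<sigma> \<bullet> B w\<close>.  If \<open>\<nu>\<close> is
  orthogonal to all linearised endpoints, the choice \<open>w = B\<^sup>* \<psi>\<^sup>\<sigma>\<close> makes this a nonnegative function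
  with zero delta integral.\<close>

lemma costate_annihilates_controls:
  assumes \<nu>: "\<And>w y. variation w y \<Longrightarrow> \<nu> \<bullet> y b = 0"
    and terminal: "\<psi> b = \<nu>"
    and adj: "\<And>t. t \<in> kappa T \<Longrightarrow> has_delta_deriv T \<psi> (- adjoint (\<lambda>x. Lin t (x, 0)) (\<psi> (sigma T t))) t"
    and t: "t \<in> kappa T"
  shows "Lin t (0, v) \<bullet> \<psi> (sigma T t) = 0"
proof -
  have cont: "continuous_on T \<psi>" using adj by (rule continuous_on_if_has_delta_deriv)
  define w where "w t = adjoint (\<lambda>v. Lin t (0, v)) (\<psi> (sigma T t))" for t
  have w: "w \<in> Crd T"
    unfolding w_def by (intro adjoint_Crd Lin_control_linear Lin_Crd Crd_const Crd_comp_sigma cont)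
  obtain y where y: "variation w y" using variation_exists[OF w] .
  define p where "p t = \<psi> t \<bullet> y t" for t
  have w_inner: "v \<bullet> w t = Lin t (0, v) \<bullet> \<psi> (sigma T t)" if "t \<in> T" for t v
    unfolding w_def by (rule adjoint_works[OF Lin_control_linear[OF that]])
  have p: "has_delta_deriv T p (w t \<bullet> w t) t" if t: "t \<in> kappa T" for t
  proof -
    have tT: "t \<in> T" using t kappa_sub by auto
    have "has_delta_deriv T p (\<psi> (sigma T t) \<bullet> Lin t (y t, w t) + (- adjoint (\<lambda>x. Lin t (x, 0)) (\<psi> (sigma T t))) \<bullet> y t) t"
      unfolding p_def by (intro has_delta_deriv_inner adj[OF t] variation_delta_deriv[OF y t] tT)
    moreover have "Lin t (y t, w t) = Lin t (y t, 0) + Lin t (0, w t)"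
      by (simp add: linear_add[OF Lin_linear[OF tT], symmetric])
    moreover have "adjoint (\<lambda>x. Lin t (x, 0)) (\<psi> (sigma T t)) \<bullet> y t = Lin t (y t, 0) \<bullet> \<psi> (sigma T t)"
      using adjoint_works[OF Lin_state_linear[OF tT]] by (simp add: inner_commute)
    ultimately show ?thesis
      using w_inner[OF tT, of "w t"] by (simp add: inner_add_right inner_commute)
  qed
  have ww: "(\<lambda>t. w t \<bullet> w t) \<in> Crd T" by (intro Crd_inner w)
  have "p a = 0" "p b = 0"
    using variation_start[OF y] \<nu>[OF y] terminal by (simp_all add: p_def)
  let ?I = "\<lambda>t. integral {a..t} (\<lambda>s. w (ts_floor T s) \<bullet> w (ts_floor T s))"
  have p_eq: "p t = ?I t" if "t \<in> T" for t
    using delta_antiderivative_eq_integral[OF ww p that] \<open>p a = 0\<close> by simp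
  have "p t = 0" if "t \<in> T" for t
  proof -
    have int: "(\<lambda>s. w (ts_floor T s) \<bullet> w (ts_floor T s)) integrable_on {a..r}" if "r \<le> b" for r
      using Crd_integrable[OF ww] that by (auto intro: integrable_subinterval_real)
    have "?I t \<le> ?I b"
      using T_bounds[OF that] int by (intro integral_subset_le) auto
    moreover have "0 \<le> ?I t"
      using T_bounds[OF that] int by (intro integral_nonneg) auto
    ultimately show ?thesis using p_eq[OF that] p_eq[OF b_in] \<open>p b = 0\<close> by simp
  qed
  then have "has_delta_deriv T p 0 t"
    using has_delta_deriv_cong[OF has_delta_deriv_const, of 0 p t] t kappa_sub by auto
  then have "w t \<bullet> w t = 0" using has_delta_deriv_unique[OF p[OF t]] t by blast
  then show ?thesis using w_inner[of t v] t kappa_sub by auto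
qed

end

section \<open>The Euler-Lagrange equations\<close>

lemma C1_map_frechet_derivative:
  assumes "C1_map f"
  shows "(f has_derivative frechet_derivative f (at x)) (at x)"
    and "continuous_on UNIV (\<lambda>x. frechet_derivative f (at x) h)"
proof -
  obtain f' where f': "\<And>x. (f has_derivative blinfun_apply (f' x)) (at x)" "continuous_on UNIV f'"
    using assms unfolding C1_map_def by blast
  have eq: "frechet_derivative f (at x) = blinfun_apply (f' x)" for x
    using frechet_derivative_at[OF f'(1)] by simp
  show "(f has_derivative frechet_derivative f (at x)) (at x)" using f'(1) eq by simp
  show "continuous_on UNIV (\<lambda>x. frechet_derivative f (at x) h)"
    unfolding eq using f'(2) by (intro continuous_intros)
qed

lemma grad_eqI:
  assumes f: "(f has_derivative f') (at x)" and f': "\<And>h. f' h = h \<bullet> g"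
  shows "grad f x = g"
proof -
  have "deriv (\<lambda>s. f (x + s *\<^sub>R axis i 1)) 0 = g $ i" for i
  proof (rule DERIV_imp_deriv)
    have "((\<lambda>s::real. x + s *\<^sub>R axis i 1) has_derivative (\<lambda>s. s *\<^sub>R axis i 1)) (at 0)"
      by (auto intro!: derivative_eq_intros)
    then have "((\<lambda>s. f (x + s *\<^sub>R axis i 1)) has_derivative (\<lambda>s. f' (s *\<^sub>R axis i 1))) (at 0)"
      using has_derivative_compose[of "\<lambda>s. x + s *\<^sub>R axis i 1" _ 0 UNIV f f'] f by simp
    moreover have "(\<lambda>s. f' (s *\<^sub>R axis i 1)) = (*) (g $ i)"
      by (auto simp: f' inner_axis' mult.commute)
    ultimately show "((\<lambda>s. f (x + s *\<^sub>R axis i 1)) has_field_derivative g $ i) (at 0)"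
      by (simp add: has_field_derivative_def)
  qed
  then show ?thesis by (simp add: grad_def vec_eq_iff)
qed

lemma has_derivative_partial:
  assumes "((\<lambda>(y, u). f y u) has_derivative D) (at (y, u))"
  shows "((\<lambda>x. f x u) has_derivative (\<lambda>h. D (h, 0))) (at y)"
    and "((\<lambda>x. f y x) has_derivative (\<lambda>h. D (0, h))) (at u)"
proof -
  have "((\<lambda>x. (x, u)) has_derivative (\<lambda>h. (h, 0))) (at y)" "((\<lambda>x. (y, x)) has_derivative (\<lambda>h. (0, h))) (at u)"
    by (auto intro!: derivative_eq_intros)
  from this[THEN has_derivative_compose, of "\<lambda>(y, u). f y u" D] assms
  show "((\<lambda>x. f x u) has_derivative (\<lambda>h. D (h, 0))) (at y)"
    and "((\<lambda>x. f y x) has_derivative (\<lambda>h. D (0, h))) (at u)" by simp_all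
qed

context compact_time_scale
begin

lemma rd_continuous_on_kappa:
  assumes "f \<in> Crd T" "\<And>t. t \<in> kappa T \<Longrightarrow> g t = f t"
  shows "rd_continuous_on T (kappa T) g"
  unfolding rd_continuous_on_def
proof (intro ballI conjI impI)
  fix t assume t: "t \<in> kappa T"
  then have tT: "t \<in> T" using kappa_sub by auto
  have *: "(g \<longlongrightarrow> l) (at t within S)" if "(f \<longlongrightarrow> l) (at t within S')" "S \<subseteq> S'" "S \<subseteq> kappa T" for l S S'
    using tendsto_within_subset[OF that(1,2)] assms(2) that(3)
    by (intro Lim_transform_within[of f l t S 1 g]) auto
  show "continuous (at t within kappa T) g" if "right_dense T t"
    using Crd_continuous[OF assms(1) tT] that *[of "f t" T "kappa T"] kappa_sub assms(2)[OF t]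
    by (simp add: continuous_within right_dense_def)
  obtain l where "(f \<longlongrightarrow> l) (at t within T \<inter> {..<t})"
    using Crd_left_limit[OF assms(1) tT] by blast
  then show "\<exists>l. (g \<longlongrightarrow> l) (at t within kappa T \<inter> {..<t})"
    using *[of l "T \<inter> {..<t}" "kappa T \<inter> {..<t}"] kappa_sub by blast
qed

lemma solvesI:
  assumes "\<And>t. t \<in> kappa T \<Longrightarrow> has_delta_deriv T y (\<phi> t (y t) (u t)) t"
    and "rd_along T \<phi>" "u \<in> Crd T"
  shows "solves T \<phi> y u"
proof -
  have "(\<lambda>t. \<phi> t (y t) (u t)) \<in> Crd T"
    using assms continuous_on_if_has_delta_deriv[OF assms(1)] unfolding rd_along_def by blast
  then have "rd_continuous_on T (kappa T) (delta_deriv T y)"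
    using delta_deriv_eq[OF assms(1)] by (rule rd_continuous_on_kappa)
  then show ?thesis
    using assms(1) delta_deriv_eq[OF assms(1)] unfolding solves_def C1rd_def delta_differentiable_def by blast
qed

lemma solvesD: "solves T \<phi> y u \<Longrightarrow> t \<in> kappa T \<Longrightarrow> has_delta_deriv T y (\<phi> t (y t) (u t)) t"
  using has_delta_deriv_delta_deriv[of y t] unfolding solves_def C1rd_def by auto

lemma sup_norm_le:
  assumes "\<And>t. t \<in> kappa T \<Longrightarrow> norm (f t) \<le> c"
  shows "sup_norm T f \<le> c"
  unfolding sup_norm_def using assms a_in_kappa by (intro cSUP_least) auto

end

text \<open>Dropping competitors preserves minimality, so both endpoints may be regarded as fixed at
  the values of the minimizer.  The cost becomes the final value of an additional state with
  derivative \<open>L\<close>.  Minimality forbids a lower cost at the same final state, so the endpoint map of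
  the extended system is not open, and its linearised endpoints are orthogonal to some
  \<open>\<nu> \<noteq> 0\<close>, normalised to have a nonnegative cost component.  The costate with terminal value
  \<open>\<nu>\<close> consists of a constant \<open>\<psi>0\<close>, since \<open>L\<close> and \<open>\<phi>\<close> do not depend on the cost state, and of \<open>\<psi>\<close>.\<close>

theorem corollary2:
  fixes T0 T :: "real set" and a b :: real
    and L :: "real \<Rightarrow> real ^ 'n \<Rightarrow> real ^ 'm \<Rightarrow> real"
    and \<phi> :: "real \<Rightarrow> real ^ 'n \<Rightarrow> real ^ 'm \<Rightarrow> real ^ 'n"
    and ya yb :: "(real ^ 'n) option"
    and y_star :: "real \<Rightarrow> real ^ 'n" and u_star :: "real \<Rightarrow> real ^ 'm"
  assumes "time_scale T0" and "a < b" and "T = {a..b} \<inter> T0" and "a \<in> T" and "b \<in> T"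
    and "CARD('m) \<le> CARD('n)"
    and "\<forall>t\<in>T. C1_map (\<lambda>(y, u). L t y u)"
    and "\<forall>t\<in>T. C1_map (\<lambda>(y, u). \<phi> t y u)"
    and "rd_regular T L" and "rd_regular T \<phi>"
    and "\<forall>u\<in>Crd T. \<exists>y. solves T \<phi> y u"
    and "weak_local_minimizer T a b L \<phi> ya yb y_star u_star"
  shows "\<exists>\<psi>0 \<psi>. \<psi>0 \<ge> 0 \<and>
           (\<forall>t\<in>kappa T. delta_differentiable T \<psi> t) \<and>
           (\<psi>0 \<noteq> 0 \<or> (\<exists>t\<in>T. \<psi> t \<noteq> 0)) \<and>
           euler_lagrange T L \<phi> y_star u_star \<psi>0 \<psi>"
proof -
  interpret compact_time_scale T a b
  proof
    show "closed T" using assms(1,3) by (auto simp: time_scale_def intro: closed_Int)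
  qed (use assms in auto)
  define DL where "DL t z = frechet_derivative (\<lambda>(y, u). L t y u) (at z)" for t z
  define D\<phi> where "D\<phi> t z = frechet_derivative (\<lambda>(y, u). \<phi> t y u) (at z)" for t z
  have DL: "((\<lambda>(y, u). L t y u) has_derivative DL t z) (at z)" "continuous_on UNIV (\<lambda>z. DL t z h)"
    and D\<phi>: "((\<lambda>(y, u). \<phi> t y u) has_derivative D\<phi> t z) (at z)" "continuous_on UNIV (\<lambda>z. D\<phi> t z h)"
    if "t \<in> T" for t z h
    using that assms(7,8) C1_map_frechet_derivative unfolding DL_def D\<phi>_def by blast+
  have L_rd: "rd_along T L" "\<And>h. rd_along T (\<lambda>t y u. DL t (y, u) h)"
    and \<phi>_rd: "rd_along T \<phi>" "\<And>h. rd_along T (\<lambda>t y u. D\<phi> t (y, u) h)"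
    using assms(9,10) unfolding rd_regular_def DL_def D\<phi>_def by blast+
  from assms(12) obtain \<delta> where \<delta>: "\<delta> > 0" and adm: "admissible T a b \<phi> ya yb y_star u_star"
    and min: "\<And>y u. admissible T a b \<phi> ya yb y u \<Longrightarrow>
      sup_norm1 T (\<lambda>t. y t - y_star t) + sup_norm T (\<lambda>t. u t - u_star t) < \<delta> \<Longrightarrow>
      cost T a b L y_star u_star \<le> cost T a b L y u"
    unfolding weak_local_minimizer_def by blast
  have u: "u_star \<in> Crd T" and y: "\<And>t. t \<in> kappa T \<Longrightarrow> has_delta_deriv T y_star (\<phi> t (y_star t) (u_star t)) t"
    using adm solvesD unfolding admissible_def by blast+
  have y_cont: "continuous_on T y_star" using y by (rule continuous_on_if_has_delta_deriv)

  define J where "J t = 0 + integral {a..t} (\<lambda>s. L (ts_floor T s) (y_star (ts_floor T s)) (u_star (ts_floor T s)))" for t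
  have J: "has_delta_deriv T J (L t (y_star t) (u_star t)) t" if "t \<in> kappa T" for t
    unfolding J_def
    by (rule has_delta_deriv_integral[where f = "\<lambda>t. L t (y_star t) (u_star t)", OF _ that])
      (use L_rd(1) y_cont u in \<open>auto simp: rd_along_def\<close>)
  define F where "F t x v = (L t (snd x) v, \<phi> t (snd x) v)" for t and x :: "real \<times> (real ^ 'n)" and v
  define DF where "DF t x v h = (DL t (snd x, v) (snd (fst h), snd h), D\<phi> t (snd x, v) (snd (fst h), snd h))"
    for t and x :: "real \<times> (real ^ 'n)" and v and h :: "(real \<times> (real ^ 'n)) \<times> (real ^ 'm)"
  define xs where "xs t = (J t, y_star t)" for t
  interpret control_system T a b F DF xs u_star
  proof
    show "rd_along T F"
      unfolding rd_along_def F_def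
    proof (intro allI impI Crd_Pair)
      fix x :: "real \<Rightarrow> real \<times> (real ^ 'n)" and v :: "real \<Rightarrow> real ^ 'm"
      assume "continuous_on T x" "v \<in> Crd T"
      then have "continuous_on T (\<lambda>t. snd (x t))" by (intro continuous_intros)
      with \<open>v \<in> Crd T\<close> show "(\<lambda>t. L t (snd (x t)) (v t)) \<in> Crd T" "(\<lambda>t. \<phi> t (snd (x t)) (v t)) \<in> Crd T"
        using L_rd(1) \<phi>_rd(1) unfolding rd_along_def by blast+
    qed
    show "rd_along T (\<lambda>t x v. DF t x v h)" for h
      unfolding rd_along_def DF_def
    proof (intro allI impI Crd_Pair)
      fix x :: "real \<Rightarrow> real \<times> (real ^ 'n)" and v :: "real \<Rightarrow> real ^ 'm"
      assume "continuous_on T x" "v \<in> Crd T"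
      then have "continuous_on T (\<lambda>t. snd (x t))" by (intro continuous_intros)
      with \<open>v \<in> Crd T\<close> show "(\<lambda>t. DL t (snd (x t), v t) (snd (fst h), snd h)) \<in> Crd T"
        "(\<lambda>t. D\<phi> t (snd (x t), v t) (snd (fst h), snd h)) \<in> Crd T"
        using L_rd(2) \<phi>_rd(2) unfolding rd_along_def by blast+
    qed
    show "((\<lambda>(x, v). F t x v) has_derivative DF t x v) (at (x, v))" if t: "t \<in> T" for t x v
    proof -
      have proj: "((\<lambda>z::(real \<times> (real ^ 'n)) \<times> (real ^ 'm). (snd (fst z), snd z)) has_derivative
          (\<lambda>h. (snd (fst h), snd h))) (at (x, v))"
        by (auto intro!: derivative_eq_intros)
      show ?thesis
        using has_derivative_Pair[OF has_derivative_compose[OF proj DL(1)[OF t]]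
            has_derivative_compose[OF proj D\<phi>(1)[OF t]]]
        by (simp add: F_def DF_def[abs_def] case_prod_unfold)
    qed
    show "continuous_on UNIV (\<lambda>(x, v). DF t x v h)" if t: "t \<in> T" for t h
    proof -
      have "continuous_on UNIV (\<lambda>z. (DL t (snd (fst z), snd z) (snd (fst h), snd h),
          D\<phi> t (snd (fst z), snd z) (snd (fst h), snd h)))"
        by (intro continuous_on_Pair continuous_on_compose2[OF DL(2)[OF t]] continuous_on_compose2[OF D\<phi>(2)[OF t]]
            continuous_intros) auto
      then show ?thesis by (simp add: DF_def case_prod_unfold)
    qed
    show "u_star \<in> Crd T" by (rule u)
    show "has_delta_deriv T xs (F t (xs t) (u_star t)) t" if "t \<in> kappa T" for t
      using has_delta_deriv_Pair[OF J[OF that] y[OF that]] by (simp add: xs_def[abs_def] F_def)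
  qed

  have norm_snd: "norm (snd z) \<le> norm z" for z :: "real \<times> (real ^ 'n)"
    by (metis norm_snd_le prod.collapse)

  \<comment> \<open>A final value with lower cost and the same final state cannot be attained near by.\<close>
  have no: "\<exists>p. norm p < \<eta> \<and>
      \<not> (\<exists>x v. v \<in> Crd T \<and> (\<forall>t\<in>kappa T. has_delta_deriv T x (F t (x t) (v t)) t) \<and>
        x a = xs a \<and> x b = xs b + p \<and> (\<forall>t\<in>T. norm (x t - xs t) < \<delta> / 4 \<and> norm (v t - u_star t) < \<delta> / 4 \<and>
          norm (F t (x t) (v t) - F t (xs t) (u_star t)) < \<delta> / 4))" if \<eta>: "\<eta> > 0" for \<eta>
  proof (intro exI conjI notI)
    show "norm (- (\<eta> / 2), 0 :: real ^ 'n) < \<eta>" using \<eta> by (simp add: norm_Pair)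
    assume "\<exists>x v. v \<in> Crd T \<and> (\<forall>t\<in>kappa T. has_delta_deriv T x (F t (x t) (v t)) t) \<and>
        x a = xs a \<and> x b = xs b + (- (\<eta> / 2), 0) \<and>
        (\<forall>t\<in>T. norm (x t - xs t) < \<delta> / 4 \<and> norm (v t - u_star t) < \<delta> / 4 \<and>
          norm (F t (x t) (v t) - F t (xs t) (u_star t)) < \<delta> / 4)"
    then obtain x v where v: "v \<in> Crd T" and x: "\<And>t. t \<in> kappa T \<Longrightarrow> has_delta_deriv T x (F t (x t) (v t)) t"
      and ends: "x a = xs a" "x b = xs b + (- (\<eta> / 2), 0)"
      and near: "\<And>t. t \<in> T \<Longrightarrow> norm (x t - xs t) < \<delta> / 4" "\<And>t. t \<in> T \<Longrightarrow> norm (v t - u_star t) < \<delta> / 4"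
        "\<And>t. t \<in> T \<Longrightarrow> norm (F t (x t) (v t) - F t (xs t) (u_star t)) < \<delta> / 4" by blast
    define z where "z t = snd (x t)" for t
    have z: "has_delta_deriv T z (\<phi> t (z t) (v t)) t" if "t \<in> kappa T" for t
      using has_delta_deriv_linear[OF bounded_linear_snd x[OF that]] by (simp add: z_def[abs_def] F_def)
    have c: "has_delta_deriv T (\<lambda>t. fst (x t)) (L t (z t) (v t)) t" if "t \<in> kappa T" for t
      using has_delta_deriv_linear[OF bounded_linear_fst x[OF that]] by (simp add: z_def F_def)
    have "z a = y_star a" "z b = y_star b" using ends by (simp_all add: z_def xs_def)
    then have "admissible T a b \<phi> ya yb z v"
      using adm v solvesI[OF z \<phi>_rd(1) v] unfolding admissible_def by auto
    moreover have "sup_norm1 T (\<lambda>t. z t - y_star t) + sup_norm T (\<lambda>t. v t - u_star t) < \<delta>"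
    proof -
      have "sup_norm T (\<lambda>t. z t - y_star t) \<le> \<delta> / 4"
      proof (rule sup_norm_le)
        fix t assume "t \<in> kappa T"
        then show "norm (z t - y_star t) \<le> \<delta> / 4"
          using near(1)[of t] kappa_sub norm_snd[of "x t - xs t"] by (auto simp: z_def xs_def)
      qed
      moreover have "sup_norm T (delta_deriv T (\<lambda>t. z t - y_star t)) \<le> \<delta> / 4"
      proof (rule sup_norm_le)
        fix t assume t: "t \<in> kappa T"
        then have "delta_deriv T (\<lambda>t. z t - y_star t) t = \<phi> t (z t) (v t) - \<phi> t (y_star t) (u_star t)"
          by (intro delta_deriv_eq has_delta_deriv_diff z y)
        then show "norm (delta_deriv T (\<lambda>t. z t - y_star t) t) \<le> \<delta> / 4"
          using near(3)[of t] t kappa_sub norm_snd[of "F t (x t) (v t) - F t (xs t) (u_star t)"]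
          by (auto simp: z_def xs_def F_def)
      qed
      moreover have "sup_norm T (\<lambda>t. v t - u_star t) \<le> \<delta> / 4"
        using near(2) kappa_sub by (intro sup_norm_le) (auto intro: less_imp_le)
      ultimately show ?thesis using \<delta> by (simp add: sup_norm1_def)
    qed
    ultimately have "cost T a b L y_star u_star \<le> cost T a b L z v" by (rule min)
    moreover have "cost T a b L y_star u_star = J b - J a"
      unfolding cost_def using J a_in b_in by (rule delta_integral_eq)
    moreover have "cost T a b L z v = fst (x b) - fst (x a)"
      unfolding cost_def using c a_in b_in by (rule delta_integral_eq)
    ultimately show False using ends \<eta> by (simp add: xs_def)
  qed
  have "\<delta> / 4 > 0" using \<delta> by simp
  then obtain \<nu>' where \<nu>': "\<nu>' \<noteq> 0" "\<And>w y. variation w y \<Longrightarrow> \<nu>' \<bullet> y b = 0"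
    using endpoint_alternative[OF _ no] by blast
  define \<nu> where "\<nu> = (if fst \<nu>' \<ge> 0 then \<nu>' else - \<nu>')"
  have \<nu>: "\<nu> \<noteq> 0" "fst \<nu> \<ge> 0" "\<And>w y. variation w y \<Longrightarrow> \<nu> \<bullet> y b = 0"
    using \<nu>' by (auto simp: \<nu>_def)
  obtain q where q: "q b = \<nu>"
    "\<And>t. t \<in> kappa T \<Longrightarrow> has_delta_deriv T q (- adjoint (\<lambda>x. Lin t (x, 0)) (q (sigma T t))) t"
    using adjoint_equation_solvable by blast
  have q_control: "Lin t (0, h) \<bullet> q (sigma T t) = 0" if "t \<in> kappa T" for t h
    using \<nu>(3) q that by (rule costate_annihilates_controls[of \<nu> q])
  have DL0: "DL t z 0 = 0" and D\<phi>0: "D\<phi> t z 0 = 0" if "t \<in> T" for t z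
    using linear_0[OF has_derivative_linear[OF DL(1)[OF that]]] linear_0[OF has_derivative_linear[OF D\<phi>(1)[OF that]]]
    by simp_all

  define H where "H t = adjoint (\<lambda>x. Lin t (x, 0)) (q (sigma T t))" for t
  have H: "h \<bullet> H t = Lin t (h, 0) \<bullet> q (sigma T t)" if "t \<in> T" for t h
    unfolding H_def by (rule adjoint_works[OF Lin_state_linear[OF that]])
  have "fst (H t) = 0" if t: "t \<in> T" for t
  proof -
    have "Lin t ((1, 0), 0) = 0"
      using DL0[OF t] D\<phi>0[OF t] by (simp add: Lin_def DF_def zero_prod_def)
    then show ?thesis using H[OF t, of "(1, 0)"] by (simp add: inner_prod_def)
  qed
  then have "has_delta_deriv T (\<lambda>t. fst (q t)) 0 t" if "t \<in> kappa T" for t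
    using has_delta_deriv_linear[OF bounded_linear_fst q(2)[OF that]] that kappa_sub by (auto simp: H_def)
  then have q_fst: "fst (q t) = fst \<nu>" if "t \<in> T" for t
    using has_delta_deriv_zero_constant[of "\<lambda>t. fst (q t)"] that b_in q(1) by metis
  define \<psi>0 where "\<psi>0 = fst \<nu>"
  define \<psi> where "\<psi> t = snd (q t)" for t
  have q_sigma: "q (sigma T t) = (\<psi>0, \<psi> (sigma T t))" if "t \<in> T" for t
    using q_fst[OF sigma_in[OF that]] by (simp add: \<psi>0_def \<psi>_def prod_eq_iff)
  have Lin_inner: "Lin t ((0, hy), hu) \<bullet> q (sigma T t)
      = \<psi>0 * DL t (y_star t, u_star t) (hy, hu) + \<psi> (sigma T t) \<bullet> D\<phi> t (y_star t, u_star t) (hy, hu)"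
    if "t \<in> T" for t hy hu
    by (simp add: q_sigma[OF that] Lin_def DF_def xs_def inner_prod_def inner_commute)
  have \<psi>: "has_delta_deriv T \<psi> (- snd (H t)) t" if "t \<in> kappa T" for t
    using has_delta_deriv_linear[OF bounded_linear_snd q(2)[OF that]] by (simp add: \<psi>_def[abs_def] H_def)

  \<comment> \<open>The partial derivatives of the augmented Lagrangian along the extremal.\<close>
  define p where "p t = \<psi> (sigma T t)" for t
  define v where "v = delta_deriv T y_star"
  have Ly: "grad (\<lambda>x. Lstar L \<phi> \<psi>0 t x (u_star t) (p t) (v t)) (y_star t) = snd (H t)" if t: "t \<in> T" for t
  proof (rule grad_eqI)
    show "((\<lambda>x. Lstar L \<phi> \<psi>0 t x (u_star t) (p t) (v t)) has_derivative
        (\<lambda>h. \<psi>0 * DL t (y_star t, u_star t) (h, 0) + p t \<bullet> (D\<phi> t (y_star t, u_star t) (h, 0) - 0))) (at (y_star t))"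
      unfolding Lstar_def
      by (intro has_derivative_add has_derivative_mult_right has_derivative_inner_right has_derivative_diff
          has_derivative_const has_derivative_partial(1) DL(1) D\<phi>(1) t)
    show "\<psi>0 * DL t (y_star t, u_star t) (h, 0) + p t \<bullet> (D\<phi> t (y_star t, u_star t) (h, 0) - 0) = h \<bullet> snd (H t)" for h
      using H[OF t, of "(0, h)"] Lin_inner[OF t, of h 0] by (simp add: p_def inner_prod_def)
  qed
  have Lu: "grad (\<lambda>x. Lstar L \<phi> \<psi>0 t (y_star t) x (p t) (v t)) (u_star t) = 0" if t: "t \<in> kappa T" for t
  proof (rule grad_eqI)
    have tT: "t \<in> T" using t kappa_sub by auto
    show "((\<lambda>x. Lstar L \<phi> \<psi>0 t (y_star t) x (p t) (v t)) has_derivative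
        (\<lambda>h. \<psi>0 * DL t (y_star t, u_star t) (0, h) + p t \<bullet> (D\<phi> t (y_star t, u_star t) (0, h) - 0))) (at (u_star t))"
      unfolding Lstar_def
      by (intro has_derivative_add has_derivative_mult_right has_derivative_inner_right has_derivative_diff
          has_derivative_const has_derivative_partial(2) DL(1) D\<phi>(1) tT)
    show "\<psi>0 * DL t (y_star t, u_star t) (0, h) + p t \<bullet> (D\<phi> t (y_star t, u_star t) (0, h) - 0) = h \<bullet> 0" for h
      using q_control[OF t, of h] Lin_inner[OF tT, of 0 h] by (simp add: p_def zero_prod_def)
  qed
  have Lp: "grad (\<lambda>x. Lstar L \<phi> \<psi>0 t (y_star t) (u_star t) x (v t)) (p t) = 0" if t: "t \<in> kappa T" for t
  proof (rule grad_eqI)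
    show "((\<lambda>x. Lstar L \<phi> \<psi>0 t (y_star t) (u_star t) x (v t)) has_derivative
        (\<lambda>h. h \<bullet> (\<phi> t (y_star t) (u_star t) - v t))) (at (p t))"
      unfolding Lstar_def by (auto intro!: derivative_eq_intros)
    show "h \<bullet> (\<phi> t (y_star t) (u_star t) - v t) = h \<bullet> 0" for h
      using delta_deriv_eq[OF y[OF t] t] by (simp add: v_def)
  qed
  have Lv: "grad (\<lambda>x. Lstar L \<phi> \<psi>0 t (y_star t) (u_star t) (p t) x) (v t) = - p t" for t
  proof (rule grad_eqI)
    show "((\<lambda>x. Lstar L \<phi> \<psi>0 t (y_star t) (u_star t) (p t) x) has_derivative (\<lambda>h. p t \<bullet> (- h))) (at (v t))"
      unfolding Lstar_def by (auto intro!: derivative_eq_intros)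
  qed (simp add: inner_commute)

  \<comment> \<open>Outside \<open>kappa T\<close> there is at most the point \<open>b\<close>, where the graininess vanishes.\<close>
  have last: "s = b" if "s \<in> T" "s \<notin> kappa T" for s
    using that T_bounds(2) by (force simp: kappa_iff)
  have Lv_Ly: "- p s - mu T s *\<^sub>R snd (H s) = - \<psi> s" if s: "s \<in> T" for s
  proof (cases "s \<in> kappa T")
    case True
    then show ?thesis
      using has_delta_deriv_jump[OF \<psi>[OF True] s] by (simp add: p_def mu_def algebra_simps)
  next
    case False
    then show ?thesis using last[OF s] by (simp add: p_def mu_def)
  qed
  have Lu_mu: "mu T s *\<^sub>R grad (\<lambda>x. Lstar L \<phi> \<psi>0 s (y_star s) x (p s) (v s)) (u_star s) = 0" if s: "s \<in> T" for s
    using Lu[of s] last[OF s] by (cases "s \<in> kappa T") (auto simp: mu_def)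
  have kk: "kappa (kappa T) \<subseteq> kappa T" by (auto simp: kappa_def)
  have "euler_lagrange T L \<phi> y_star u_star \<psi>0 \<psi>"
    unfolding euler_lagrange_def Let_def v_def[symmetric] p_def[symmetric]
  proof (intro ballI conjI)
    fix t assume "t \<in> kappa (kappa T)"
    then have t: "t \<in> kappa T" "t \<in> T" using kk kappa_sub by auto
    show "has_delta_deriv T
        (\<lambda>s. grad (\<lambda>x. Lstar L \<phi> \<psi>0 s (y_star s) (u_star s) (p s) x) (v s) -
          mu T s *\<^sub>R grad (\<lambda>x. Lstar L \<phi> \<psi>0 s x (u_star s) (p s) (v s)) (y_star s))
        (grad (\<lambda>x. Lstar L \<phi> \<psi>0 t x (u_star t) (p t) (v t)) (y_star t)) t"
      unfolding Ly[OF t(2)]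
    proof (rule has_delta_deriv_cong)
      show "has_delta_deriv T (\<lambda>s. - \<psi> s) (snd (H t)) t"
        using has_delta_deriv_minus[OF \<psi>[OF t(1)]] by simp
    qed (simp_all add: Lv Ly Lv_Ly t)
    show "has_delta_deriv T (\<lambda>s. - (mu T s *\<^sub>R grad (\<lambda>x. Lstar L \<phi> \<psi>0 s (y_star s) x (p s) (v s)) (u_star s)))
        (grad (\<lambda>x. Lstar L \<phi> \<psi>0 t (y_star t) x (p t) (v t)) (u_star t)) t"
      unfolding Lu[OF t(1)]
      by (rule has_delta_deriv_cong[OF has_delta_deriv_const[of 0]]) (simp_all add: Lu_mu t)
    show "grad (\<lambda>x. Lstar L \<phi> \<psi>0 t (y_star t) (u_star t) x (v t)) (p t) = 0"
      by (rule Lp[OF t(1)])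
  qed
  moreover have "\<psi>0 \<ge> 0" using \<nu>(2) by (simp add: \<psi>0_def)
  moreover have "\<forall>t\<in>kappa T. delta_differentiable T \<psi> t"
    using \<psi> unfolding delta_differentiable_def by blast
  moreover have "\<psi>0 \<noteq> 0 \<or> (\<exists>t\<in>T. \<psi> t \<noteq> 0)"
    using \<nu>(1) q(1) b_in by (auto simp: \<psi>0_def \<psi>_def prod_eq_iff intro!: bexI[of _ b])
  ultimately show ?thesis by blast
qed

end
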